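(* Let $(\Omega,\mathcal{E},P)$ be a probability space, $\mathcal{F}$ a sub-$\sigma$-algebra of $\mathcal{E}$, and $(S,\|\cdot\|)$ a random normed module over $K$ with base $(\Omega,\mathcal{E},P)$, with random conjugate space $S^*$. Let $1\le p<+\infty$ and $1<q\le+\infty$ be a pair of Hölder conjugate numbers. Then the canonical mapping $T:L^{q}_{\mathcal{F}}(S^{*})\to(L^{p}_{\mathcal{F}}(S))^{*}$ is surjective and random-norm preserving, where for each $f\in L^{q}_{\mathcal{F}}(S^{*})$, $T_f:=T(f):L^{p}_{\mathcal{F}}(S)\to L^{0}(\mathcal{F},K)$ is defined by $T_f(g)=E[f(g)\,|\,\mathcal{F}]$ for all $g\in L^{p}_{\mathcal{F}}(S)$.
   Context: $K=\mathbb{R}$ or $\mathbb{C}$. For a $\sigma$-algebra $\mathcal G$ on $\Omega$ (here $\mathcal G=\mathcal E$ or $\mathcal F$), $L^{0}(\mathcal{G},K)$ is the algebra of equivalence classes (under a.s. equality) of $K$-valued $\mathcal{G}$-measurable functions; $L^0(\mathcal G,\bar{\mathbb R})$ (extended real-valued functions) is a complete lattice under a.s. pointwise order, with infimum $\wedge$; $L^0_+(\mathcal G,\mathbb R)$ and $L^0_+(\mathcal G,\bar{\mathbb R})$ are the sets of nonnegative elements. A random normed module over $K$ with base $(\Omega,\mathcal G,P)$ is a left $L^0(\mathcal G,K)$-module $S$ with an $L^0$-norm $\|\cdot\|:S\to L^0_+(\mathcal G,\mathbb R)$, i.e. $\|\xi x\|=|\xi|\|x\|$, $\|x+y\|\le\|x\|+\|y\|$,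 and $\|x\|=0$ iff $x=\theta$. Its random conjugate space $S^*$ is the $L^0(\mathcal G,K)$-module of module homomorphisms $f:S\to L^0(\mathcal G,K)$ for which there is $\xi\in L^0_+(\mathcal G,\mathbb R)$ with $|f(x)|\le\xi\|x\|$ for all $x\in S$ (equivalently, the continuous ones, for either the $(\varepsilon,\lambda)$- or the locally $L^0$-convex topology), with $L^0$-norm $\|f\|^*=\wedge\{\xi\in L^0_+(\mathcal G,\mathbb R):|f(x)|\le\xi\|x\|\ \forall x\in S\}$; it is again a random normed module with base $(\Omega,\mathcal G,P)$. For a random normed module $(S,\|\cdot\|)$ with base $(\Omega,\mathcal E,P)$ and $1\le p\le+\infty$, define $|||\cdot|||_p:S\to L^0_+(\mathcal F,\bar{\mathbb R})$ by $|||x|||_p=(E[\|x\|^p\,|\,\mathcal F])^{1/p}$ for $p<\infty$ and $|||x|||_\infty=\wedge\{\xi\in L^0_+(\mathcal F,\bar{\mathbb R}):\xi\ge\|x\|\}$, where $E[\cdot|\mathcal F]$ is the (generalized) conditional expectation. Put $L^p_{\mathcal F}(S)=\{x\in S:|||x|||_p\in L^0_+(\mathcal F,\mathbb R)\}$; $(L^p_{\mathcal F}(S),|||\cdot|||_p)$ is a random normed module over $K$ with base $(\Omega,\mathcal F,P)$. $L^q_{\mathcal F}(S^* )$ is obtained in the same way from $(S^*,\|\cdot\|^* )$. $(L^p_{\mathcal F}(S))^*$ is the random conjugate space of $(L^p_{\mathcal F}(S),|||\cdot|||_p)$. Random-norm preserving means that the $L^0$-norm of $T_f$ in $(L^p_{\mathcal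 F}(S))^*$ equals $|||f|||_q$. *)

theory Defs
  imports "HOL-Probability.Probability" "HOL-Algebra.Module"
begin

section \<open>The spaces \<open>L\<^sup>0\<close>\<close>

definition ae_eq_rel :: "'w measure \<Rightarrow> ('w \<Rightarrow> 'b::topological_space) rel" where
  "ae_eq_rel M = {(f, g). f \<in> borel_measurable M \<and> g \<in> borel_measurable M \<and> (AE w in M. f w = g w)}"

definition L0 :: "'w measure \<Rightarrow> ('w \<Rightarrow> 'b::topological_space) set set" where
  "L0 M = borel_measurable M // ae_eq_rel M"

definition L0_class :: "'w measure \<Rightarrow> ('w \<Rightarrow> 'b::topological_space) \<Rightarrow> ('w \<Rightarrow> 'b) set" where
  "L0_class M f = ae_eq_rel M `` {f}"

text \<open>All operations below are defined through an arbitrarily chosen representative; they do not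
  depend on this choice, since they respect almost sure equality.\<close>

definition L0_rep :: "('w \<Rightarrow> 'b) set \<Rightarrow> 'w \<Rightarrow> 'b" where
  "L0_rep X = (SOME f. f \<in> X)"

definition L0_map :: "'w measure \<Rightarrow> ('b \<Rightarrow> 'c::topological_space) \<Rightarrow> ('w \<Rightarrow> 'b) set \<Rightarrow> ('w \<Rightarrow> 'c) set" where
  "L0_map M h X = L0_class M (\<lambda>w. h (L0_rep X w))"

definition L0_le :: "'w measure \<Rightarrow> ('w \<Rightarrow> 'b::order) set \<Rightarrow> ('w \<Rightarrow> 'b) set \<Rightarrow> bool" where
  "L0_le M X Y \<longleftrightarrow> (AE w in M. L0_rep X w \<le> L0_rep Y w)"

definition L0_nonneg :: "'w measure \<Rightarrow> ('w \<Rightarrow> real) set set" where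
  "L0_nonneg M = {X \<in> L0 M. AE w in M. 0 \<le> L0_rep X w}"

definition L0_order :: "'w measure \<Rightarrow> ('w \<Rightarrow> 'b::{topological_space, order}) set gorder" where
  "L0_order M = \<lparr>carrier = L0 M, eq = (=), le = L0_le M\<rparr>"

definition L0_ring :: "'w measure \<Rightarrow> ('w \<Rightarrow> 'k::real_normed_field) set ring" where
  "L0_ring M =
     \<lparr>carrier = L0 M,
      mult = (\<lambda>X Y. L0_class M (\<lambda>w. L0_rep X w * L0_rep Y w)),
      one = L0_class M (\<lambda>w. 1),
      zero = L0_class M (\<lambda>w. 0),
      add = (\<lambda>X Y. L0_class M (\<lambda>w. L0_rep X w + L0_rep Y w))\<rparr>"

lemma equiv_ae_eq_rel: "equiv (borel_measurable M) (ae_eq_rel M)"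
proof (rule equivI)
  show "trans (ae_eq_rel M)"
  proof (rule transI)
    fix f g h assume "(f, g) \<in> ae_eq_rel M" "(g, h) \<in> ae_eq_rel M"
    then have "f \<in> borel_measurable M" "h \<in> borel_measurable M"
      and a: "AE w in M. f w = g w" and b: "AE w in M. g w = h w"
      by (auto simp: ae_eq_rel_def)
    moreover have "AE w in M. f w = h w" using a b by eventually_elim simp
    ultimately show "(f, h) \<in> ae_eq_rel M" by (simp add: ae_eq_rel_def)
  qed
  show "sym (ae_eq_rel M)"
    by (auto simp: ae_eq_rel_def sym_def eq_commute)
qed (auto simp: ae_eq_rel_def refl_on_def)

lemma L0_class_in_L0: "f \<in> borel_measurable M \<Longrightarrow> L0_class M f \<in> L0 M"
  by (simp add: L0_def L0_class_def quotientI)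

lemma L0_class_eq_iff:
  assumes "f \<in> borel_measurable M" "g \<in> borel_measurable M"
  shows "L0_class M f = L0_class M g \<longleftrightarrow> (AE w in M. f w = g w)"
  unfolding L0_class_def eq_equiv_class_iff[OF equiv_ae_eq_rel assms]
  using assms by (simp add: ae_eq_rel_def)

lemma L0_rep_in: "X \<in> L0 M \<Longrightarrow> L0_rep X \<in> X"
  unfolding L0_rep_def L0_def
  using in_quotient_imp_non_empty[OF equiv_ae_eq_rel, of X M] by (simp add: some_in_eq)

lemma L0_rep_measurable: "X \<in> L0 M \<Longrightarrow> L0_rep X \<in> borel_measurable M"
  using L0_rep_in[of X M] in_quotient_imp_subset[OF equiv_ae_eq_rel, of X M]
  by (auto simp: L0_def)

lemma L0_class_rep:
  assumes "X \<in> L0 M"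
  shows "L0_class M (L0_rep X) = X"
proof -
  obtain f where X: "X = ae_eq_rel M `` {f}"
    using assms unfolding L0_def by (rule quotientE)
  then have "(f, L0_rep X) \<in> ae_eq_rel M"
    using L0_rep_in[OF assms] by simp
  then show ?thesis
    unfolding L0_class_def X by (rule equiv_class_eq[OF equiv_ae_eq_rel, symmetric])
qed

lemma L0_rep_class:
  assumes "f \<in> borel_measurable M"
  shows "AE w in M. L0_rep (L0_class M f) w = f w"
  using L0_class_eq_iff[OF L0_rep_measurable[OF L0_class_in_L0[OF assms]] assms]
    L0_class_rep[OF L0_class_in_L0[OF assms]] by simp

lemma L0_class_cong: "(AE w in M. f w = g w) \<Longrightarrow> f \<in> borel_measurable M \<Longrightarrow> g \<in> borel_measurable M \<Longrightarrow>
    L0_class M f = L0_class M g"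
  by (simp add: L0_class_eq_iff)

lemma L0_cases:
  assumes "X \<in> L0 M"
  obtains f where "f \<in> borel_measurable M" "X = L0_class M f"
  using L0_rep_measurable[OF assms] L0_class_rep[OF assms, symmetric] by (rule that)

context
  fixes M :: "'w measure" and f g :: "'w \<Rightarrow> 'k::{real_normed_field, second_countable_topology}"
  assumes f [measurable]: "f \<in> borel_measurable M" and g [measurable]: "g \<in> borel_measurable M"
begin

lemma L0_ring_add_class: "L0_class M f \<oplus>\<^bsub>L0_ring M\<^esub> L0_class M g = L0_class M (\<lambda>w. f w + g w)"
proof -
  have [measurable]: "L0_rep (L0_class M f) \<in> borel_measurable M" "L0_rep (L0_class M g) \<in> borel_measurable M"
    by (simp_all add: L0_rep_measurable L0_class_in_L0)
  have "AE w in M. L0_rep (L0_class M f) w + L0_rep (L0_class M g) w = f w + g w"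
    using L0_rep_class[OF f] L0_rep_class[OF g] by eventually_elim simp
  then show ?thesis unfolding L0_ring_def ring.simps by (rule L0_class_cong) measurable
qed

lemma L0_ring_mult_class: "L0_class M f \<otimes>\<^bsub>L0_ring M\<^esub> L0_class M g = L0_class M (\<lambda>w. f w * g w)"
proof -
  have [measurable]: "L0_rep (L0_class M f) \<in> borel_measurable M" "L0_rep (L0_class M g) \<in> borel_measurable M"
    by (simp_all add: L0_rep_measurable L0_class_in_L0)
  have "AE w in M. L0_rep (L0_class M f) w * L0_rep (L0_class M g) w = f w * g w"
    using L0_rep_class[OF f] L0_rep_class[OF g] by eventually_elim simp
  then show ?thesis unfolding L0_ring_def monoid.simps by (rule L0_class_cong) measurable
qed

end

lemma L0_ring_carrier: "carrier (L0_ring M) = L0 M"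
  and L0_ring_zero: "\<zero>\<^bsub>L0_ring M\<^esub> = L0_class M (\<lambda>w. 0)"
  and L0_ring_one: "\<one>\<^bsub>L0_ring M\<^esub> = L0_class M (\<lambda>w. 1)"
  by (simp_all add: L0_ring_def)

lemma cring_L0_ring:
  "cring (L0_ring M :: ('w \<Rightarrow> 'k::{real_normed_field, second_countable_topology}) set ring)"
  (is "cring ?R")
proof -
  note simps = L0_ring_zero L0_ring_one L0_ring_add_class L0_ring_mult_class
    borel_measurable_add borel_measurable_times
  have const: "\<zero>\<^bsub>?R\<^esub> \<in> L0 M" "\<one>\<^bsub>?R\<^esub> \<in> L0 M"
    by (simp_all add: simps L0_class_in_L0)
  have ring_ops:
    "X \<oplus>\<^bsub>?R\<^esub> Y \<in> L0 M" "X \<otimes>\<^bsub>?R\<^esub> Y \<in> L0 M"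
    "X \<oplus>\<^bsub>?R\<^esub> Y \<oplus>\<^bsub>?R\<^esub> Z = X \<oplus>\<^bsub>?R\<^esub> (Y \<oplus>\<^bsub>?R\<^esub> Z)" "X \<oplus>\<^bsub>?R\<^esub> Y = Y \<oplus>\<^bsub>?R\<^esub> X" "\<zero>\<^bsub>?R\<^esub> \<oplus>\<^bsub>?R\<^esub> X = X"
    "X \<otimes>\<^bsub>?R\<^esub> Y \<otimes>\<^bsub>?R\<^esub> Z = X \<otimes>\<^bsub>?R\<^esub> (Y \<otimes>\<^bsub>?R\<^esub> Z)" "X \<otimes>\<^bsub>?R\<^esub> Y = Y \<otimes>\<^bsub>?R\<^esub> X" "\<one>\<^bsub>?R\<^esub> \<otimes>\<^bsub>?R\<^esub> X = X"
    "(X \<oplus>\<^bsub>?R\<^esub> Y) \<otimes>\<^bsub>?R\<^esub> Z = X \<otimes>\<^bsub>?R\<^esub> Z \<oplus>\<^bsub>?R\<^esub> Y \<otimes>\<^bsub>?R\<^esub> Z"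
    "\<exists>V\<in>L0 M. V \<oplus>\<^bsub>?R\<^esub> X = \<zero>\<^bsub>?R\<^esub>"
    if XYZ: "X \<in> L0 M" "Y \<in> L0 M" "Z \<in> L0 M" for X Y Z
  proof -
    obtain f where [simp]: "f \<in> borel_measurable M" "X = L0_class M f"
      using XYZ(1) by (rule L0_cases)
    obtain g where [simp]: "g \<in> borel_measurable M" "Y = L0_class M g"
      using XYZ(2) by (rule L0_cases)
    obtain h where [simp]: "h \<in> borel_measurable M" "Z = L0_class M h"
      using XYZ(3) by (rule L0_cases)
    show "X \<oplus>\<^bsub>?R\<^esub> Y \<in> L0 M" "X \<otimes>\<^bsub>?R\<^esub> Y \<in> L0 M"
      by (simp_all add: simps L0_class_in_L0)
    show "X \<oplus>\<^bsub>?R\<^esub> Y \<oplus>\<^bsub>?R\<^esub> Z = X \<oplus>\<^bsub>?R\<^esub> (Y \<oplus>\<^bsub>?R\<^esub> Z)"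
      by (simp add: simps add.assoc)
    show "X \<otimes>\<^bsub>?R\<^esub> Y \<otimes>\<^bsub>?R\<^esub> Z = X \<otimes>\<^bsub>?R\<^esub> (Y \<otimes>\<^bsub>?R\<^esub> Z)"
      by (simp add: simps mult.assoc)
    show "X \<oplus>\<^bsub>?R\<^esub> Y = Y \<oplus>\<^bsub>?R\<^esub> X" "X \<otimes>\<^bsub>?R\<^esub> Y = Y \<otimes>\<^bsub>?R\<^esub> X"
      by (simp_all add: simps add.commute mult.commute)
    show "\<zero>\<^bsub>?R\<^esub> \<oplus>\<^bsub>?R\<^esub> X = X" "\<one>\<^bsub>?R\<^esub> \<otimes>\<^bsub>?R\<^esub> X = X"
      by (simp_all add: simps)
    show "(X \<oplus>\<^bsub>?R\<^esub> Y) \<otimes>\<^bsub>?R\<^esub> Z = X \<otimes>\<^bsub>?R\<^esub> Z \<oplus>\<^bsub>?R\<^esub> Y \<otimes>\<^bsub>?R\<^esub> Z"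
      by (simp add: simps distrib_right)
    show "\<exists>V\<in>L0 M. V \<oplus>\<^bsub>?R\<^esub> X = \<zero>\<^bsub>?R\<^esub>"
      by (rule bexI[of _ "L0_class M (\<lambda>w. - f w)"]) (simp_all add: simps L0_class_in_L0)
  qed
  show ?thesis
  proof (rule cringI)
    show "abelian_group ?R"
      by (rule abelian_groupI; (unfold L0_ring_carrier)?; (rule const)?; (rule ring_ops; assumption)?)
    show "comm_monoid ?R"
      by (rule comm_monoidI; (unfold L0_ring_carrier)?; (rule const)?; (rule ring_ops; assumption)?)
  qed (unfold L0_ring_carrier, rule ring_ops; assumption)
qed


section \<open>Random normed modules and random conjugate spaces\<close>

text \<open>The field \<open>K\<close> is a type \<open>'k\<close> that is both a \<^class>\<open>real_normed_field\<close> and a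
  \<^class>\<open>euclidean_space\<close>: \<^typ>\<open>real\<close> and \<^typ>\<open>complex\<close> are instances, and by the theorem of
  Frobenius these are the only ones up to isometric isomorphism.\<close>

record ('w, 'k, 's) rn_module = "(('w \<Rightarrow> 'k) set, 's) module" +
  rnorm :: "'s \<Rightarrow> ('w \<Rightarrow> real) set"

locale random_normed_module = prob_space M + S?: Module.module "L0_ring M" S
  for M :: "'w measure" and S :: "('w, 'k::{real_normed_field, euclidean_space}, 's) rn_module" (structure) +
  assumes rnorm_closed: "x \<in> carrier S \<Longrightarrow> rnorm S x \<in> L0_nonneg M"
    and rnorm_smult: "\<lbrakk>a \<in> L0 M; x \<in> carrier S\<rbrakk> \<Longrightarrow>
      rnorm S (a \<odot>\<^bsub>S\<^esub> x) = L0_map M norm a \<otimes>\<^bsub>L0_ring M\<^esub> rnorm S x"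
    and rnorm_triangle: "\<lbrakk>x \<in> carrier S; y \<in> carrier S\<rbrakk> \<Longrightarrow>
      L0_le M (rnorm S (x \<oplus>\<^bsub>S\<^esub> y)) (rnorm S x \<oplus>\<^bsub>L0_ring M\<^esub> rnorm S y)"
    and rnorm_eq_zero_iff: "x \<in> carrier S \<Longrightarrow> rnorm S x = \<zero>\<^bsub>L0_ring M\<^esub> \<longleftrightarrow> x = \<zero>\<^bsub>S\<^esub>"

definition rn_bounds ::
  "'w measure \<Rightarrow> ('w, 'k::{real_normed_field, euclidean_space}, 's) rn_module \<Rightarrow>
    ('s \<Rightarrow> ('w \<Rightarrow> 'k) set) \<Rightarrow> ('w \<Rightarrow> real) set set" where
  "rn_bounds M S f =
     {\<xi> \<in> L0_nonneg M. \<forall>x\<in>carrier S. L0_le M (L0_map M norm (f x)) (\<xi> \<otimes>\<^bsub>L0_ring M\<^esub> rnorm S x)}"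

text \<open>The \<open>L\<^sup>0\<close>-norm is an infimum of a nonempty set of nonnegative real-valued classes, so taking it
  in the order of real-valued rather than extended real-valued classes makes no difference.
  The fields \<open>mult\<close> and \<open>one\<close> of a module record are meaningless.\<close>

definition random_conjugate ::
  "'w measure \<Rightarrow> ('w, 'k::{real_normed_field, euclidean_space}, 's) rn_module \<Rightarrow>
    ('w, 'k, 's \<Rightarrow> ('w \<Rightarrow> 'k) set) rn_module" where
  "random_conjugate M S =
     \<lparr>carrier = {f \<in> carrier S \<rightarrow>\<^sub>E L0 M.
        (\<forall>x\<in>carrier S. \<forall>y\<in>carrier S. f (x \<oplus>\<^bsub>S\<^esub> y) = f x \<oplus>\<^bsub>L0_ring M\<^esub> f y) \<and>
        (\<forall>a\<in>L0 M. \<forall>x\<in>carrier S. f (a \<odot>\<^bsub>S\<^esub> x) = a \<otimes>\<^bsub>L0_ring M\<^esub> f x) \<and>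
        rn_bounds M S f \<noteq> {}},
      mult = undefined,
      one = undefined,
      zero = (\<lambda>x\<in>carrier S. \<zero>\<^bsub>L0_ring M\<^esub>),
      add = (\<lambda>f g. \<lambda>x\<in>carrier S. f x \<oplus>\<^bsub>L0_ring M\<^esub> g x),
      smult = (\<lambda>a f. \<lambda>x\<in>carrier S. a \<otimes>\<^bsub>L0_ring M\<^esub> f x),
      rnorm = (\<lambda>f. \<Sqinter>\<^bsub>L0_order M\<^esub> (rn_bounds M S f))\<rparr>"


section \<open>Conditional \<open>L\<^sup>p\<close>-modules and the canonical mapping\<close>

text \<open>Classes in \<open>L\<^sup>0(\<F>)\<close> are taken with respect to \<^term>\<open>restr_to_subalg M F\<close>, the probability
  space \<open>(\<Omega>, \<F>, P)\<close>. Such a class contains only \<open>\<F>\<close>-measurable functions; the next map is the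
  inclusion of \<open>L\<^sup>0(\<F>)\<close> into \<open>L\<^sup>0(\<E>)\<close>.\<close>

definition L0_incl :: "'w measure \<Rightarrow> ('w \<Rightarrow> 'b::topological_space) set \<Rightarrow> ('w \<Rightarrow> 'b) set" where
  "L0_incl M X = L0_class M (L0_rep X)"

definition ennreal_powr :: "ennreal \<Rightarrow> real \<Rightarrow> ennreal" where
  "ennreal_powr x r = (if x = \<infinity> then \<infinity> else ennreal (enn2real x powr r))"

text \<open>The conditional norm \<open>|||x|||\<^sub>p\<close>, where the nonnegative extended real-valued classes
  \<open>L\<^sup>0\<^sub>+(\<F>, [-\<infinity>,\<infinity>])\<close> are rendered as classes of \<^typ>\<open>ennreal\<close>-valued functions.\<close>

definition cond_norm ::
  "'w measure \<Rightarrow> 'w measure \<Rightarrow> ennreal \<Rightarrow>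
    ('w, 'k::{real_normed_field, euclidean_space}, 's) rn_module \<Rightarrow> 's \<Rightarrow> ('w \<Rightarrow> ennreal) set" where
  "cond_norm M F p S x =
     (if p = \<infinity>
      then \<Sqinter>\<^bsub>L0_order (restr_to_subalg M F)\<^esub>
        {\<xi> \<in> L0 (restr_to_subalg M F). L0_le M (L0_map M ennreal (rnorm S x)) (L0_incl M \<xi>)}
      else L0_class (restr_to_subalg M F)
        (\<lambda>w. ennreal_powr
          (nn_cond_exp M F (\<lambda>v. ennreal (L0_rep (rnorm S x) v powr enn2real p)) w) (1 / enn2real p)))"

definition cond_Lp ::
  "'w measure \<Rightarrow> 'w measure \<Rightarrow> ennreal \<Rightarrow>
    ('w, 'k::{real_normed_field, euclidean_space}, 's) rn_module \<Rightarrow> ('w, 'k, 's) rn_module" where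
  "cond_Lp M F p S =
     S\<lparr>carrier := {x \<in> carrier S. AE w in M. L0_rep (cond_norm M F p S x) w < \<infinity>},
       smult := (\<lambda>a x. L0_incl M a \<odot>\<^bsub>S\<^esub> x),
       rnorm := (\<lambda>x. L0_map (restr_to_subalg M F) enn2real (cond_norm M F p S x))\<rparr>"

text \<open>The generalized conditional expectation of a \<open>K\<close>-valued function, computed in coordinates.
  \<^const>\<open>real_cond_exp\<close> is the difference of the (always existing) conditional expectations of the
  positive and the negative part, hence it is the generalized conditional expectation of every
  \<open>f\<close> with \<open>E[|f| | \<F>] < \<infinity>\<close> almost surely, integrable or not.\<close>

definition cond_exp ::
  "'w measure \<Rightarrow> 'w measure \<Rightarrow> ('w \<Rightarrow> 'k::euclidean_space) \<Rightarrow> 'w \<Rightarrow> 'k" where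
  "cond_exp M F f = (\<lambda>w. \<Sum>b\<in>Basis. real_cond_exp M F (\<lambda>v. f v \<bullet> b) w *\<^sub>R b)"

definition canonical_map ::
  "'w measure \<Rightarrow> 'w measure \<Rightarrow> ennreal \<Rightarrow>
    ('w, 'k::{real_normed_field, euclidean_space}, 's) rn_module \<Rightarrow>
    ('s \<Rightarrow> ('w \<Rightarrow> 'k) set) \<Rightarrow> 's \<Rightarrow> ('w \<Rightarrow> 'k) set" where
  "canonical_map M F p S f =
     (\<lambda>g\<in>carrier (cond_Lp M F p S). L0_class (restr_to_subalg M F) (cond_exp M F (L0_rep (f g))))"

end

theory Submission
  imports Defs
begin

text \<open>
  Let \<open>\<Phi>\<close> be a bounded functional on \<open>L\<^sup>p\<^sub>\<F>(S)\<close>. For \<open>g \<in> L\<^sup>p\<^sub>\<F>(S)\<close> the set function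
  \<open>A \<mapsto> E[w \<Phi>(1\<^sub>A g)]\<close>, with an \<open>\<F>\<close>-measurable weight \<open>w > 0\<close> that makes everything bounded, is an absolutely
  continuous signed measure; its density divided by \<open>w\<close> is the unique \<open>Y\<^sub>g\<close> with \<open>E[1\<^sub>A Y\<^sub>g | \<F>] = \<Phi>(1\<^sub>A g)\<close>
  for all \<open>A \<in> \<E>\<close>. By uniqueness \<open>g \<mapsto> Y\<^sub>g\<close> is additive and homogeneous for bounded \<open>\<E>\<close>-measurable
  scalars, so \<open>f(x) = Y\<^bsub>cx\<^esub> / c\<close> with \<open>c = 1 / (1 + \<parallel>x\<parallel>)\<close> extends it to a homomorphism on \<open>S\<close>.

  If \<open>|E[f(g) | \<F>]| \<le> \<eta> |||g|||\<^sub>p\<close> for all \<open>g\<close>, then testing with suitable multiples of \<open>x\<close> gives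
  \<open>E[|f(x)|\<^sup>q | \<F>] \<le> \<eta>\<^sup>q\<close> whenever \<open>\<parallel>x\<parallel> \<le> 1\<close> (and \<open>|f(x)| \<le> \<eta>\<close> if \<open>p = 1\<close>). The family of these \<open>|f(x)|\<close> is
  directed, so its essential supremum \<open>N\<close> is the limit of an increasing sequence and inherits the estimate by
  monotone convergence; as \<open>\<parallel>f\<parallel>\<^sup>* \<le> N\<close>, this yields \<open>|||f|||\<^sub>q \<le> \<eta>\<close>. The converse estimate is the conditional
  Hoelder inequality.
\<close>

section \<open>Generalized conditional expectations\<close>

text \<open>Two obstacles shape the proof. \<open>S\<close> carries neither completeness nor
  countable gluing, so elements of \<open>S\<close> can be combined along finite partitions only.
  Limits are therefore taken of functions and never of elements: each running maximum of the family
  is \<open>norm (ff y)\<close> for a single \<open>y\<close>, but their supremum need not be. For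
  the same reason the functional is extended by rescaling rather than by approximation. The unit
  ball lies in \<open>Lp\<close> for every exponent, because a bounded function has a bounded
  conditional expectation, and \<open>Y\<close> of \<open>c x\<close> divided by \<open>c\<close>
  does not depend on the normalising \<open>c\<close>. The second obstacle is that
  \<open>f(g)\<close> need not be integrable; its conditional expectation is only finite almost
  surely. Integrals exist after multiplication by a positive \<open>F\<close>-measurable weight, and
  such a weight passes through conditional expectations and can be cancelled. For the functional the
  weight is \<open>1 / ((1 + \<eta>) (1 + |||g|||))\<close>: its two factors absorb the bound of the
  functional and the size of \<open>g\<close>.\<close>

locale prob_subalgebra = prob_space M for M :: "'w measure" +
  fixes F :: "'w measure"
  assumes subalgebra: "subalgebra M F"

sublocale prob_subalgebra \<subseteq> finite_measure_subalgebra M F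
  by unfold_locales (rule subalgebra)

context prob_subalgebra
begin

abbreviation "nnE \<equiv> nn_cond_exp M F"
abbreviation "realE \<equiv> real_cond_exp M F"
abbreviation condE :: "('w \<Rightarrow> 'b::euclidean_space) \<Rightarrow> 'w \<Rightarrow> 'b" where
  "condE \<equiv> cond_exp M F"

lemma F_measurable [measurable_dest]: "f \<in> measurable F N \<Longrightarrow> f \<in> measurable M N"
  using subalg by (rule measurable_from_subalg)

lemma F_sets [measurable_dest]: "A \<in> sets F \<Longrightarrow> A \<in> sets M"
  using subalg by (auto simp: subalgebra_def)

text \<open>Equivalently, \<open>w h\<close> is integrable for some \<open>\<F>\<close>-measurable \<open>w > 0\<close>. This is how the library's results on
  conditional expectations of integrable functions are carried over.\<close>

definition cond_integrable :: "('w \<Rightarrow> 'b::euclidean_space) \<Rightarrow> bool" where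
  "cond_integrable h \<longleftrightarrow> h \<in> borel_measurable M \<and>
    (AE w in M. nnE (\<lambda>v. ennreal (norm (h v))) w < \<infinity>)"

lemma cond_integrable_measurable [measurable_dest]:
  "cond_integrable h \<Longrightarrow> h \<in> borel_measurable M"
  by (simp add: cond_integrable_def)

text \<open>Where \<open>nnE f\<close> is infinite, \<open>enn2real\<close> yields 0 and the weight
  is 1, so it is positive everywhere. Where \<open>nnE f\<close> is finite, its product with the
  weight is at most 1.\<close>

definition cweight :: "('w \<Rightarrow> ennreal) \<Rightarrow> 'w \<Rightarrow> real" where
  "cweight f v = 1 / (1 + enn2real (nnE f v))"

lemma cweight_measurable [measurable]: "cweight f \<in> borel_measurable F"
  unfolding cweight_def by measurable

lemma cweight_pos: "0 < cweight f v" and cweight_le_1: "cweight f v \<le> 1"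
  using enn2real_nonneg[of "nnE f v"] by (auto simp: cweight_def divide_le_eq add_pos_nonneg)

text \<open>The weight is \<open>F\<close>-measurable, so under the integral \<open>f\<close> may be
  replaced by \<open>nnE f\<close>, whose product with the weight is at most 1.\<close>

lemma nn_integral_cweight:
  assumes [measurable]: "f \<in> borel_measurable M" and fin: "AE v in M. nnE f v < \<infinity>"
  shows "(\<integral>\<^sup>+v. ennreal (cweight f v) * f v \<partial>M) < \<infinity>"
proof -
  have "(\<integral>\<^sup>+v. ennreal (cweight f v) * f v \<partial>M) = (\<integral>\<^sup>+v. ennreal (cweight f v) * nnE f v \<partial>M)"
    by (rule nn_cond_exp_intg[symmetric]) measurable
  also have "\<dots> \<le> (\<integral>\<^sup>+v. 1 \<partial>M)"
  proof (rule nn_integral_mono_AE)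
    show "AE v in M. ennreal (cweight f v) * nnE f v \<le> 1"
      using fin
    proof eventually_elim
      case (elim v)
      then obtain r where "nnE f v = ennreal r" "0 \<le> r" by (cases "nnE f v") auto
      then show ?case by (simp flip: ennreal_mult' ennreal_1 add: divide_simps cweight_def)
    qed
  qed
  also have "\<dots> < \<infinity>" by (simp add: emeasure_space_1)
  finally show ?thesis .
qed

lemma nn_cond_exp_finite_imp_finite:
  assumes [measurable]: "f \<in> borel_measurable M" and fin: "AE v in M. nnE f v < \<infinity>"
  shows "AE v in M. f v < \<infinity>"
proof -
  have "(\<integral>\<^sup>+v. ennreal (cweight f v) * f v \<partial>M) \<noteq> \<infinity>"
    using nn_integral_cweight[OF assms] by simp
  then have "AE v in M. ennreal (cweight f v) * f v \<noteq> \<infinity>"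
    by (intro nn_integral_noteq_infinite) measurable
  then show ?thesis
  proof eventually_elim
    case (elim v)
    with cweight_pos[of f v] show ?case
      by (auto simp: ennreal_mult_eq_top_iff less_top[symmetric])
  qed
qed

lemma cond_integrable_weightE:
  assumes "cond_integrable h"
  obtains w where "w \<in> borel_measurable F" "\<And>v. 0 < w v" "\<And>v. w v \<le> (1::real)"
    "integrable M (\<lambda>v. w v *\<^sub>R h v)"
proof
  note [measurable] = cond_integrable_measurable[OF assms]
  let ?w = "cweight (\<lambda>v. ennreal (norm (h v)))"
  show "?w \<in> borel_measurable F" "0 < ?w v" "?w v \<le> 1" for v
    by (rule cweight_measurable cweight_pos cweight_le_1)+
  have "ennreal (norm (?w v *\<^sub>R h v)) = ennreal (?w v) * ennreal (norm (h v))" for v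
    by (simp add: ennreal_mult' abs_of_pos[OF cweight_pos] less_imp_le[OF cweight_pos])
  then have "(\<integral>\<^sup>+v. ennreal (norm (?w v *\<^sub>R h v)) \<partial>M) < \<infinity>"
    using assms nn_integral_cweight[of "\<lambda>v. ennreal (norm (h v))"] by (simp add: cond_integrable_def)
  then show "integrable M (\<lambda>v. ?w v *\<^sub>R h v)"
    by (intro integrableI_bounded) simp_all
qed

lemma cond_integrable_weightI:
  assumes [measurable]: "w \<in> borel_measurable F" "h \<in> borel_measurable M"
    and pos: "\<And>v. 0 < w v" and int: "integrable M (\<lambda>v. w v *\<^sub>R h v)"
  shows "cond_integrable h"
proof -
  let ?N = "nnE (\<lambda>v. ennreal (norm (h v)))"
  have "(\<integral>\<^sup>+v. ennreal (w v) * ?N v \<partial>M) = (\<integral>\<^sup>+v. ennreal (w v) * ennreal (norm (h v)) \<partial>M)"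
    by (rule nn_cond_exp_intg) measurable
  also have "\<dots> = (\<integral>\<^sup>+v. ennreal (norm (w v *\<^sub>R h v)) \<partial>M)"
    using pos by (intro nn_integral_cong) (auto simp: ennreal_mult' less_imp_le)
  finally have "(\<integral>\<^sup>+v. ennreal (w v) * ?N v \<partial>M) \<noteq> \<infinity>"
    using int by (simp add: integrable_iff_bounded)
  then have "AE v in M. ennreal (w v) * ?N v \<noteq> \<infinity>"
    by (intro nn_integral_noteq_infinite) measurable
  then have "AE v in M. ?N v < \<infinity>"
  proof eventually_elim
    case (elim v)
    show ?case
    proof (rule ccontr)
      assume "\<not> ?N v < \<infinity>"
      then have "?N v = \<infinity>" by (simp add: less_top[symmetric])
      with elim pos[of v] show False by (simp add: ennreal_mult_eq_top_iff)
    qed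
  qed
  then show ?thesis by (simp add: cond_integrable_def)
qed

lemma cond_integrable_bound:
  assumes "AE w in M. nnE (\<lambda>v. ennreal (g v)) w < \<infinity>" "AE w in M. norm (h w) \<le> g w"
    and [measurable]: "g \<in> borel_measurable M" "h \<in> borel_measurable M"
  shows "cond_integrable h"
proof -
  have "AE w in M. nnE (\<lambda>v. ennreal (norm (h v))) w \<le> nnE (\<lambda>v. ennreal (g v)) w"
    using assms(2) by (intro nn_cond_exp_mono) (auto intro: ennreal_leI)
  with assms(1) have "AE w in M. nnE (\<lambda>v. ennreal (norm (h v))) w < \<infinity>"
    by eventually_elim (rule le_less_trans)
  then show ?thesis by (simp add: cond_integrable_def)
qed

lemma cond_integrable_dominated:
  assumes "cond_integrable g" "AE w in M. norm (h w) \<le> norm (g w)" "h \<in> borel_measurable M"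
  shows "cond_integrable h"
proof (rule cond_integrable_bound[OF _ assms(2)])
  show "AE w in M. nnE (\<lambda>v. ennreal (norm (g v))) w < \<infinity>"
    using assms(1) by (simp add: cond_integrable_def)
  show "(\<lambda>w. norm (g w)) \<in> borel_measurable M"
    using cond_integrable_measurable[OF assms(1)] by measurable
qed (rule assms(3))

lemma integrable_cond_integrable: "integrable M h \<Longrightarrow> cond_integrable h"
  by (rule cond_integrable_weightI[of "\<lambda>_. 1"]) auto

lemma integrable_bounded_scaleR:
  fixes h :: "'w \<Rightarrow> 'b::euclidean_space"
  assumes "integrable M h" "a \<in> borel_measurable M" "\<And>v. \<bar>a v\<bar> \<le> (1::real)"
  shows "integrable M (\<lambda>v. a v *\<^sub>R h v)"
proof (rule Bochner_Integration.integrable_bound[OF assms(1)])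
  show "(\<lambda>v. a v *\<^sub>R h v) \<in> borel_measurable M" using assms by measurable
  show "AE v in M. norm (a v *\<^sub>R h v) \<le> norm (h v)"
    using assms(3) by (auto intro!: mult_left_le_one_le)
qed

text \<open>Both weights are bounded by 1, so their product still works for each function. A common
  weight lets additivity and uniqueness for integrable functions apply to two functions at
  once.\<close>

lemma cond_integrable_weight2E:
  assumes "cond_integrable h1" "cond_integrable h2"
  obtains w where "w \<in> borel_measurable F" "\<And>v. 0 < w v"
    "integrable M (\<lambda>v. w v *\<^sub>R h1 v)" "integrable M (\<lambda>v. w v *\<^sub>R h2 v)"
proof -
  obtain w1 where [measurable]: "w1 \<in> borel_measurable F" and w1: "\<And>v. 0 < w1 v" "\<And>v. w1 v \<le> 1"
    "integrable M (\<lambda>v. w1 v *\<^sub>R h1 v)" using cond_integrable_weightE[OF assms(1)] by metis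
  obtain w2 where [measurable]: "w2 \<in> borel_measurable F" and w2: "\<And>v. 0 < w2 v" "\<And>v. w2 v \<le> 1"
    "integrable M (\<lambda>v. w2 v *\<^sub>R h2 v)" using cond_integrable_weightE[OF assms(2)] by metis
  have "\<bar>w1 v\<bar> \<le> 1" "\<bar>w2 v\<bar> \<le> 1" for v
    using w1(1,2)[of v] w2(1,2)[of v] by auto
  then have "integrable M (\<lambda>v. (w1 v * w2 v) *\<^sub>R h1 v)" "integrable M (\<lambda>v. (w1 v * w2 v) *\<^sub>R h2 v)"
    using integrable_bounded_scaleR[OF w1(3), of w2] integrable_bounded_scaleR[OF w2(3), of w1]
    by (simp_all add: mult.commute)
  then show ?thesis
    using w1(1) w2(1) by (intro that[of "\<lambda>v. w1 v * w2 v"]) auto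
qed

lemma cond_integrable_add:
  assumes "cond_integrable h1" "cond_integrable h2"
  shows "cond_integrable (\<lambda>v. h1 v + h2 v)"
proof -
  note [measurable] = assms[THEN cond_integrable_measurable]
  obtain w where [measurable]: "w \<in> borel_measurable F" and w: "\<And>v. 0 < w v"
    "integrable M (\<lambda>v. w v *\<^sub>R h1 v)" "integrable M (\<lambda>v. w v *\<^sub>R h2 v)"
    using cond_integrable_weight2E[OF assms] by metis
  show ?thesis
    using w by (intro cond_integrable_weightI[of w]) (auto simp: scaleR_add_right)
qed

lemma cond_integrable_F_mult:
  fixes h :: "'w \<Rightarrow> 'b::{real_normed_algebra, euclidean_space}"
  assumes "cond_integrable h" and [measurable]: "a \<in> borel_measurable F"
  shows "cond_integrable (\<lambda>v. a v * h v)"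
proof -
  note [measurable] = assms(1)[THEN cond_integrable_measurable]
  obtain w where [measurable]: "w \<in> borel_measurable F" and w: "\<And>v. 0 < w v" "\<And>v. w v \<le> 1"
    "integrable M (\<lambda>v. w v *\<^sub>R h v)" using cond_integrable_weightE[OF assms(1)] by metis
  show ?thesis
  \<comment> \<open>Dividing by \<open>1 + norm (a v)\<close> absorbs the unbounded factor
    \<open>a\<close> and keeps the weight positive and \<open>F\<close>-measurable.\<close>
  proof (rule cond_integrable_weightI[of "\<lambda>v. w v / (1 + norm (a v))"])
    show "integrable M (\<lambda>v. (w v / (1 + norm (a v))) *\<^sub>R (a v * h v))"
    proof (rule Bochner_Integration.integrable_bound[OF w(3)])
      show "AE v in M. norm ((w v / (1 + norm (a v))) *\<^sub>R (a v * h v)) \<le> norm (w v *\<^sub>R h v)"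
      proof (rule AE_I2)
        fix v
        have pos: "0 < 1 + norm (a v)" by (simp add: add_pos_nonneg)
        have "norm (a v * h v) \<le> norm (a v) * norm (h v)" by (rule norm_mult_ineq)
        also have "\<dots> \<le> (1 + norm (a v)) * norm (h v)" by (rule mult_right_mono) auto
        finally have "norm (a v * h v) / (1 + norm (a v)) \<le> norm (h v)"
          using pos by (simp only: divide_le_eq if_True mult.commute)
        then have "w v * (norm (a v * h v) / (1 + norm (a v))) \<le> w v * norm (h v)"
          using w(1)[of v] by (intro mult_left_mono) auto
        moreover have "norm ((w v / (1 + norm (a v))) *\<^sub>R (a v * h v)) = w v * (norm (a v * h v) / (1 + norm (a v)))"
          using w(1)[of v] pos by (simp only: norm_scaleR abs_divide abs_of_pos times_divide_eq_left times_divide_eq_right)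
        moreover have "norm (w v *\<^sub>R h v) = w v * norm (h v)"
          using w(1)[of v] by (simp only: norm_scaleR abs_of_pos)
        ultimately show "norm ((w v / (1 + norm (a v))) *\<^sub>R (a v * h v)) \<le> norm (w v *\<^sub>R h v)"
          by (simp only:)
      qed
    qed measurable
    show "0 < w v / (1 + norm (a v))" for v
      using w(1)[of v] by (intro divide_pos_pos add_pos_nonneg) auto
  qed measurable
qed

text \<open>Under a common weight all three functions are integrable; the weight is then pulled out
  of each term and cancelled.\<close>

lemma real_cond_exp_add':
  assumes "cond_integrable h1" "cond_integrable h2"
  shows "AE v in M. realE (\<lambda>v. h1 v + h2 v) v = realE h1 v + realE h2 v"
proof -
  note [measurable] = assms[THEN cond_integrable_measurable]
  obtain w where [measurable]: "w \<in> borel_measurable F" and pos: "\<And>v. 0 < w v"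
    and "integrable M (\<lambda>v. w v *\<^sub>R h1 v)" "integrable M (\<lambda>v. w v *\<^sub>R h2 v)"
    using cond_integrable_weight2E[OF assms] by metis
  then have i: "integrable M (\<lambda>v. w v * h1 v)" "integrable M (\<lambda>v. w v * h2 v)"
    by simp_all
  then have i': "integrable M (\<lambda>v. w v * (h1 v + h2 v))"
    by (simp add: distrib_left)
  have "AE v in M. realE (\<lambda>v. w v * h1 v + w v * h2 v) v
      = realE (\<lambda>v. w v * h1 v) v + realE (\<lambda>v. w v * h2 v) v"
    by (rule real_cond_exp_add[OF i])
  moreover have "AE v in M. realE (\<lambda>v. w v * (h1 v + h2 v)) v
      = w v * realE (\<lambda>v. h1 v + h2 v) v"
    by (rule real_cond_exp_mult[OF _ _ i']) measurable
  moreover have "AE v in M. realE (\<lambda>v. w v * h1 v) v = w v * realE h1 v"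
    by (rule real_cond_exp_mult[OF _ _ i(1)]) measurable
  moreover have "AE v in M. realE (\<lambda>v. w v * h2 v) v = w v * realE h2 v"
    by (rule real_cond_exp_mult[OF _ _ i(2)]) measurable
  ultimately show ?thesis
  proof eventually_elim
    case (elim v)
    then have "w v * realE (\<lambda>v. h1 v + h2 v) v
        = w v * (realE h1 v + realE h2 v)"
      by (simp add: distrib_left)
    then show ?case using pos[of v] by simp
  qed
qed

text \<open>The weight belongs to the product \<open>a h\<close>, so \<open>w (a h)\<close> and
  \<open>(w a) h\<close> are the same integrable function. Pulling out \<open>w\<close> in one
  grouping and \<open>w a\<close> in the other leaves the claim after cancelling
  \<open>w\<close>.\<close>

lemma real_cond_exp_mult':
  assumes "cond_integrable h" and [measurable]: "a \<in> borel_measurable F"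
  shows "AE v in M. realE (\<lambda>v. a v * h v) v = a v * realE h v"
proof -
  note [measurable] = assms(1)[THEN cond_integrable_measurable]
  obtain w where [measurable]: "w \<in> borel_measurable F" and w: "\<And>v. 0 < w v" "\<And>v. w v \<le> 1"
    "integrable M (\<lambda>v. w v *\<^sub>R (a v * h v))"
    using cond_integrable_weightE[OF cond_integrable_F_mult[OF assms]] by metis
  have "AE v in M. realE (\<lambda>v. w v * (a v * h v)) v = w v * realE (\<lambda>v. a v * h v) v"
    using w by (intro real_cond_exp_mult) auto
  moreover have "AE v in M. realE (\<lambda>v. (w v * a v) * h v) v = (w v * a v) * realE h v"
    using w by (intro real_cond_exp_mult) (auto simp: mult.assoc)
  ultimately show ?thesis
  proof eventually_elim
    case (elim v)
    then show ?case using w(1)[of v] by (simp add: mult.assoc)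
  qed
qed

lemma cond_integrable_const: "cond_integrable (\<lambda>v. c)"
  by (rule integrable_cond_integrable) simp

lemma cond_integrable_sum:
  assumes "finite I" "\<And>i. i \<in> I \<Longrightarrow> cond_integrable (h i)"
  shows "cond_integrable (\<lambda>v. \<Sum>i\<in>I. h i v)"
  using assms
proof induction
  case empty
  show ?case by (simp add: cond_integrable_const)
next
  case (insert i I)
  then show ?case by (simp add: cond_integrable_add)
qed

lemma real_cond_exp_sum':
  assumes "finite I" "\<And>i. i \<in> I \<Longrightarrow> cond_integrable (h i)"
  shows "AE v in M. realE (\<lambda>v. \<Sum>i\<in>I. h i v) v = (\<Sum>i\<in>I. realE (h i) v)"
  using assms
proof induction
  case empty
  show ?case using real_cond_exp_F_meas[of "\<lambda>_. 0"] by simp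
next
  case (insert i I)
  have ci: "cond_integrable (h i)" "\<And>i. i \<in> I \<Longrightarrow> cond_integrable (h i)"
    using insert by auto
  have "AE v in M. realE (\<lambda>v. h i v + (\<Sum>i\<in>I. h i v)) v
    = realE (h i) v + realE (\<lambda>v. \<Sum>i\<in>I. h i v) v"
    using insert(1) ci by (intro real_cond_exp_add' cond_integrable_sum)
  moreover have "AE v in M. realE (\<lambda>v. \<Sum>i\<in>I. h i v) v = (\<Sum>i\<in>I. realE (h i) v)"
    using insert(3)[OF ci(2)] .
  ultimately show ?case by eventually_elim (simp add: insert(1,2))
qed

lemma cond_exp_F_measurable [measurable]: "condE h \<in> borel_measurable F"
  unfolding cond_exp_def by measurable

lemma cond_exp_inner_Basis:
  "b \<in> Basis \<Longrightarrow> condE h v \<bullet> b = realE (\<lambda>v. h v \<bullet> b) v"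
  unfolding cond_exp_def by (simp add: inner_sum_left inner_Basis if_distrib cong: if_cong)

lemma cond_integrable_inner:
  assumes "cond_integrable h"
  shows "cond_integrable (\<lambda>v. h v \<bullet> b)"
proof -
  note [measurable] = assms[THEN cond_integrable_measurable]
  obtain w where [measurable]: "w \<in> borel_measurable F" and w: "\<And>v. 0 < w v" "\<And>v. w v \<le> 1"
    "integrable M (\<lambda>v. w v *\<^sub>R h v)" using cond_integrable_weightE[OF assms(1)] by metis
  have "integrable M (\<lambda>v. (w v *\<^sub>R h v) \<bullet> b)"
    using w by (intro integrable_inner_left) 
  then show ?thesis
    using w by (intro cond_integrable_weightI[of w]) auto
qed

text \<open>\<open>condE\<close> is built from coordinates in \<open>Basis\<close>; expanding
  \<open>c\<close> reaches every direction. The one needed later is the unit \<open>1\<close> of the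
  field, which the type classes do not place in \<open>Basis\<close>.\<close>

lemma real_cond_exp_inner:
  assumes "cond_integrable h"
  shows "AE v in M. realE (\<lambda>v. h v \<bullet> c) v = condE h v \<bullet> c"
proof -
  have "AE v in M. realE (\<lambda>v. \<Sum>b\<in>Basis. (c \<bullet> b) * (h v \<bullet> b)) v =
      (\<Sum>b\<in>Basis. realE (\<lambda>v. (c \<bullet> b) * (h v \<bullet> b)) v)"
    using assms by (intro real_cond_exp_sum' cond_integrable_F_mult cond_integrable_inner) auto
  moreover have "AE v in M. \<forall>b\<in>Basis. realE (\<lambda>v. (c \<bullet> b) * (h v \<bullet> b)) v
      = (c \<bullet> b) * realE (\<lambda>v. h v \<bullet> b) v"
    using assms by (intro AE_finite_allI real_cond_exp_mult' cond_integrable_inner) auto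
  ultimately show ?thesis
    by eventually_elim (simp add: euclidean_inner[of _ c] cond_exp_inner_Basis mult.commute)
qed

lemma cond_exp_eqI:
  assumes "\<And>b. b \<in> Basis \<Longrightarrow> AE v in M. realE (\<lambda>v. h v \<bullet> b) v = z v \<bullet> b"
  shows "AE v in M. condE h v = z v"
proof -
  have "AE v in M. \<forall>b\<in>Basis. realE (\<lambda>v. h v \<bullet> b) v = z v \<bullet> b"
    using assms by (intro AE_finite_allI) auto
  then show ?thesis
  proof eventually_elim
    case (elim v)
    show ?case by (rule euclidean_eqI) (use elim in \<open>simp add: cond_exp_inner_Basis\<close>)
  qed
qed

lemma cond_exp_cong:
  assumes "AE v in M. h v = h' v" and [measurable]: "h \<in> borel_measurable M" "h' \<in> borel_measurable M"
  shows "AE v in M. condE h v = condE h' v"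
proof (rule cond_exp_eqI)
  fix b :: 'a assume "b \<in> Basis"
  have "AE v in M. realE (\<lambda>v. h v \<bullet> b) v = realE (\<lambda>v. h' v \<bullet> b) v"
    using assms(1) by (intro real_cond_exp_cong) (auto elim!: eventually_mono)
  then show "AE v in M. realE (\<lambda>v. h v \<bullet> b) v = condE h' v \<bullet> b"
    by (simp add: cond_exp_inner_Basis \<open>b \<in> Basis\<close>)
qed

lemma cond_exp_add:
  assumes "cond_integrable h1" "cond_integrable h2"
  shows "AE v in M. condE (\<lambda>v. h1 v + h2 v) v = condE h1 v + condE h2 v"
proof (rule cond_exp_eqI)
  fix b :: 'a assume "b \<in> Basis"
  then show "AE v in M. realE (\<lambda>v. (h1 v + h2 v) \<bullet> b) v = (condE h1 v + condE h2 v) \<bullet> b"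
    using real_cond_exp_add'[OF assms[THEN cond_integrable_inner], of b b]
    by (simp add: inner_add_left cond_exp_inner_Basis)
qed

text \<open>The product is only known to be bilinear, so \<open>(x * y) \<bullet> b\<close> is
  expanded with the structure constants \<open>(c * d) \<bullet> b\<close>. Each term is a real
  \<open>F\<close>-measurable coefficient times a coordinate of \<open>h\<close>, which is the real
  case.\<close>

lemma cond_exp_mult:
  fixes h :: "'w \<Rightarrow> 'b::{real_normed_algebra, euclidean_space}"
  assumes h: "cond_integrable h" and [measurable]: "a \<in> borel_measurable F"
  shows "AE v in M. condE (\<lambda>v. a v * h v) v = a v * condE h v"
proof (rule cond_exp_eqI)
  fix b :: 'b assume b: "b \<in> Basis"
  have expand: "(x * y) \<bullet> b = (\<Sum>c\<in>Basis. \<Sum>d\<in>Basis. ((x \<bullet> c) * ((c * d) \<bullet> b)) * (y \<bullet> d))" for x y :: 'b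
  proof -
    have "(x * y) \<bullet> b = ((\<Sum>c\<in>Basis. (x \<bullet> c) *\<^sub>R c) * (\<Sum>d\<in>Basis. (y \<bullet> d) *\<^sub>R d)) \<bullet> b"
      by (simp only: euclidean_representation)
    also have "\<dots> = (\<Sum>c\<in>Basis. \<Sum>d\<in>Basis. ((x \<bullet> c) * ((c * d) \<bullet> b)) * (y \<bullet> d))"
      by (simp add: sum_product inner_sum_left mult_ac del: euclidean_representation)
    finally show ?thesis .
  qed
  let ?t = "\<lambda>c d v. ((a v \<bullet> c) * ((c * d) \<bullet> b)) * (h v \<bullet> d)"
  have int: "cond_integrable (?t c d)" for c d
    by (intro cond_integrable_F_mult cond_integrable_inner h) measurable
  have "AE v in M. realE (\<lambda>v. \<Sum>c\<in>Basis. \<Sum>d\<in>Basis. ?t c d v) v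
      = (\<Sum>c\<in>Basis. realE (\<lambda>v. \<Sum>d\<in>Basis. ?t c d v) v)"
    by (intro real_cond_exp_sum' cond_integrable_sum int) auto
  moreover have "AE v in M. \<forall>c\<in>Basis. realE (\<lambda>v. \<Sum>d\<in>Basis. ?t c d v) v
      = (\<Sum>d\<in>Basis. realE (?t c d) v)"
    by (intro AE_finite_allI real_cond_exp_sum' int) auto
  moreover have "AE v in M. \<forall>c\<in>Basis. \<forall>d\<in>Basis. realE (?t c d) v =
      ((a v \<bullet> c) * ((c * d) \<bullet> b)) * realE (\<lambda>v. h v \<bullet> d) v"
    by (intro AE_finite_allI real_cond_exp_mult' cond_integrable_inner h) auto
  ultimately show "AE v in M. realE (\<lambda>v. (a v * h v) \<bullet> b) v = (a v * condE h v) \<bullet> b"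
  proof eventually_elim
    case (elim v)
    have "(\<lambda>v. (a v * h v) \<bullet> b) = (\<lambda>v. \<Sum>c\<in>Basis. \<Sum>d\<in>Basis. ?t c d v)"
      by (intro ext expand)
    moreover have "(a v * condE h v) \<bullet> b =
        (\<Sum>c\<in>Basis. \<Sum>d\<in>Basis. ((a v \<bullet> c) * ((c * d) \<bullet> b)) * (condE h v \<bullet> d))"
      by (rule expand)
    ultimately show ?case using elim by (simp add: cond_exp_inner_Basis)
  qed
qed

text \<open>An \<open>F\<close>-measurable \<open>a\<close> of modulus 1 rotates
  \<open>condE h\<close> onto its own norm. Since \<open>a\<close> passes through the conditional
  expectation, the real inequality for the component of \<open>a h\<close> along \<open>1\<close>
  suffices.\<close>

lemma cond_exp_norm_le:
  fixes h :: "'w \<Rightarrow> 'b::{real_normed_field, euclidean_space}"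
  assumes h: "cond_integrable h"
  shows "AE v in M. ennreal (norm (condE h v)) \<le> nnE (\<lambda>v. ennreal (norm (h v))) v"
proof -
  note [measurable] = assms[THEN cond_integrable_measurable]
  let ?z = "condE h"
  \<comment> \<open>The value 1 where \<open>?z\<close> vanishes keeps \<open>norm (a v) = 1\<close>
    everywhere.\<close>
  define a where "a v = (if ?z v = 0 then 1 else of_real (norm (?z v)) / ?z v)" for v
  have [measurable]: "a \<in> borel_measurable F" unfolding a_def by measurable
  have az: "a v * ?z v = of_real (norm (?z v))" and na: "norm (a v) = 1" for v
    by (auto simp: a_def norm_divide)
  have ci: "cond_integrable (\<lambda>v. a v * h v)"
    by (intro cond_integrable_F_mult h) measurable
  have 1: "AE v in M. realE (\<lambda>v. (a v * h v) \<bullet> 1) v = condE (\<lambda>v. a v * h v) v \<bullet> 1"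
    by (rule real_cond_exp_inner[OF ci])
  have 2: "AE v in M. condE (\<lambda>v. a v * h v) v = a v * ?z v"
    by (rule cond_exp_mult[OF h]) measurable
  have 3: "AE v in M. ennreal \<bar>realE (\<lambda>v. (a v * h v) \<bullet> 1) v\<bar> \<le> nnE (\<lambda>v. ennreal \<bar>(a v * h v) \<bullet> 1\<bar>) v"
    by (rule real_cond_exp_abs) measurable
  have "\<bar>(a v * h v) \<bullet> 1\<bar> \<le> norm (h v)" for v
    using Cauchy_Schwarz_ineq2[of "a v * h v" 1] by (simp add: norm_mult na)
  then have 4: "AE v in M. nnE (\<lambda>v. ennreal \<bar>(a v * h v) \<bullet> 1\<bar>) v \<le> nnE (\<lambda>v. ennreal (norm (h v))) v"
    by (intro nn_cond_exp_mono) (auto intro: ennreal_leI)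
  from 1 2 3 4 show ?thesis
  proof eventually_elim
    case (elim v)
    \<comment> \<open>The unit has norm 1, so \<open>1 \<bullet> 1 = 1\<close> and the component
      along \<open>1\<close> of a real multiple of the unit is that real number.\<close>
    have "norm (?z v) = \<bar>realE (\<lambda>v. (a v * h v) \<bullet> 1) v\<bar>"
      using elim(1,2) by (simp add: az of_real_def) (simp add: power2_norm_eq_inner[symmetric])
    then show ?case using elim(3,4) by simp
  qed
qed

lemma set_integral_cond_exp:
  fixes h :: "'w \<Rightarrow> 'b::euclidean_space"
  assumes "integrable M h"
  shows "integrable M (condE h)" and "A \<in> sets F \<Longrightarrow> (LINT v:A|M. condE h v) = (LINT v:A|M. h v)"
proof -
  have i: "integrable M (\<lambda>v. h v \<bullet> b)" for b using assms by simp
  then show int: "integrable M (condE h)"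
    unfolding cond_exp_def by (intro Bochner_Integration.integrable_sum integrable_scaleR_left real_cond_exp_int)
  assume "A \<in> sets F"
  then have [measurable]: "A \<in> sets M" by measurable
  show "(LINT v:A|M. condE h v) = (LINT v:A|M. h v)"
  proof (rule euclidean_eqI)
    fix b :: 'b assume b: "b \<in> Basis"
    have "(LINT v:A|M. g v) \<bullet> b = (LINT v:A|M. g v \<bullet> b)" if "integrable M g" for g :: "'w \<Rightarrow> 'b"
      unfolding set_lebesgue_integral_def
      by (subst integral_inner_left[symmetric]) (auto intro: that integrable_mult_indicator)
    then show "(LINT v:A|M. condE h v) \<bullet> b = (LINT v:A|M. h v) \<bullet> b"
      using real_cond_exp_intA[OF i \<open>A \<in> sets F\<close>, of b] by (simp add: int assms cond_exp_inner_Basis b)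
  qed
qed

lemma integral_cond_exp:
  fixes h :: "'w \<Rightarrow> 'b::euclidean_space"
  assumes "integrable M h"
  shows "(LINT v|M. condE h v) = (LINT v|M. h v)"
proof -
  have "space M \<in> sets F"
    using subalg by (metis subalgebra_def sets.top)
  from set_integral_cond_exp(2)[OF assms this] show ?thesis
    by (simp add: set_integral_space assms set_integral_cond_exp(1))
qed

text \<open>The sets range over all of \<open>M\<close> and not just over \<open>F\<close>.
  Integrating the weighted hypothesis thus gives equal integrals of \<open>w Y\<close> and
  \<open>w Y'\<close> over every event, and densities are unique.\<close>

lemma cond_exp_unique:
  fixes Y Y' :: "'w \<Rightarrow> 'b::{real_normed_field, euclidean_space}"
  assumes ci: "cond_integrable Y" "cond_integrable Y'"
    and eq: "\<And>A. A \<in> sets M \<Longrightarrow> AE v in M. condE (\<lambda>v. indicator A v *\<^sub>R Y v) v = condE (\<lambda>v. indicator A v *\<^sub>R Y' v) v"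
  shows "AE v in M. Y v = Y' v"
proof -
  note [measurable] = ci[THEN cond_integrable_measurable]
  obtain w where [measurable]: "w \<in> borel_measurable F" and wpos: "\<And>v. 0 < w v"
    and i: "integrable M (\<lambda>v. w v *\<^sub>R Y v)" "integrable M (\<lambda>v. w v *\<^sub>R Y' v)"
    using cond_integrable_weight2E[OF ci] by metis
  have key: "AE v in M. condE (\<lambda>v. indicator A v *\<^sub>R (w v *\<^sub>R Z v)) v = of_real (w v) * condE (\<lambda>v. indicator A v *\<^sub>R Z v) v"
    if "cond_integrable Z" "A \<in> sets M" for A and Z :: "'w \<Rightarrow> 'b"
  proof -
    note [measurable] = that(2) that(1)[THEN cond_integrable_measurable]
    have "cond_integrable (\<lambda>v. indicator A v *\<^sub>R Z v)"
      by (rule cond_integrable_dominated[OF that(1)]) (auto simp: indicator_def)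
    from cond_exp_mult[OF this, of "\<lambda>v. of_real (w v)"]
    show ?thesis by (simp add: scaleR_conv_of_real mult_ac)
  qed
  have "AE v in M. w v *\<^sub>R Y v = w v *\<^sub>R Y' v"
  proof (rule density_unique_banach[OF i])
    fix A assume A [measurable]: "A \<in> sets M"
    have ii: "integrable M (\<lambda>v. indicator A v *\<^sub>R (w v *\<^sub>R Y v))" "integrable M (\<lambda>v. indicator A v *\<^sub>R (w v *\<^sub>R Y' v))"
      using i by (intro integrable_mult_indicator; simp)+
    have "(LINT v|M. condE (\<lambda>v. indicator A v *\<^sub>R (w v *\<^sub>R Y v)) v) = (LINT v|M. condE (\<lambda>v. indicator A v *\<^sub>R (w v *\<^sub>R Y' v)) v)"
    proof (rule integral_cong_AE)
      show "AE v in M. condE (\<lambda>v. indicator A v *\<^sub>R (w v *\<^sub>R Y v)) v = condE (\<lambda>v. indicator A v *\<^sub>R (w v *\<^sub>R Y' v)) v"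
        using key[OF ci(1) A] key[OF ci(2) A] eq[OF A] by eventually_elim simp
    qed measurable
    then show "(LINT v:A|M. w v *\<^sub>R Y v) = (LINT v:A|M. w v *\<^sub>R Y' v)"
      by (simp only: integral_cond_exp ii set_lebesgue_integral_def)
  qed
  then show ?thesis 
  proof eventually_elim
    case (elim v)
    then show ?case using wpos[of v] by simp
  qed
qed

end

section \<open>Countable essential suprema and infima of extended nonnegative functions\<close>

lemma ennreal_inverse_inverse: "inverse (inverse x) = (x::ennreal)"
proof (cases x)
  case (real r)
  then show ?thesis by (cases "r = 0") (auto simp: inverse_ennreal less_le)
qed auto

lemma ennreal_inverse_mono_iff: "inverse a \<le> inverse b \<longleftrightarrow> b \<le> (a::ennreal)"
proof -
  have anti: "inverse y \<le> inverse x" if "x \<le> y" for x y :: ennreal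
  proof (cases "x = 0 \<or> y = \<infinity>")
    case False
    with that have "x \<noteq> \<infinity>" "y \<noteq> \<infinity>" by (auto simp: top_unique)
    then obtain r s where rs: "x = ennreal r" "y = ennreal s" "0 \<le> r" "0 \<le> s"
      by (metis ennreal_cases infinity_ennreal_def)
    with False have "0 < r" by (auto simp: less_le)
    with rs that show ?thesis
      by (auto simp: inverse_ennreal ennreal_le_iff2 less_le intro!: le_imp_inverse_le ennreal_leI)
  qed auto
  show ?thesis
    using anti[of b a] anti[of "inverse a" "inverse b"] by (auto simp: ennreal_inverse_inverse)
qed

context prob_space
begin

text \<open>The functional \<open>J\<close> attains its infimum, because countably many sequences
  can be merged into one. Inserting a further \<open>h\<close> cannot lower \<open>J\<close>, so it
  cannot raise the supremum on a set of positive measure.\<close>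

lemma ess_sup_countable:
  fixes H :: "('a \<Rightarrow> ennreal) set"
  assumes "H \<noteq> {}" "H \<subseteq> borel_measurable M"
  obtains s :: "nat \<Rightarrow> 'a \<Rightarrow> ennreal" where "range s \<subseteq> H" "\<And>h. h \<in> H \<Longrightarrow> AE w in M. h w \<le> (SUP n. s n w)"
proof -
  \<comment> \<open>The strictly decreasing map into \<open>[0, 1]\<close> keeps the integral finite
    even where the supremum is infinite, so that integrals can be subtracted.\<close>
  define J where "J s = (\<integral>\<^sup>+w. inverse (1 + (SUP n. s n w)) \<partial>M)" for s :: "nat \<Rightarrow> 'a \<Rightarrow> ennreal"
  define Q where "Q = {s :: nat \<Rightarrow> 'a \<Rightarrow> ennreal. range s \<subseteq> H}"
  have meas: "(\<lambda>w. SUP n. s n w) \<in> borel_measurable M" if "s \<in> Q" for s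
    using that assms(2) by (intro borel_measurable_SUP) (auto simp: Q_def)
  obtain h0 where "h0 \<in> H" using assms(1) by auto
  then have "(\<lambda>_. h0) \<in> Q" by (auto simp: Q_def)
  then have "J ` Q \<noteq> {}" by auto
  from ennreal_Inf_countable_INF[OF this]
  obtain f :: "nat \<Rightarrow> ennreal" where f: "range f \<subseteq> J ` Q" "Inf (J ` Q) = (INF i. f i)" by blast
  then have "\<forall>k. \<exists>s. s \<in> Q \<and> f k = J s" by blast
  then obtain S where S: "\<And>k. S k \<in> Q" "\<And>k. f k = J (S k)" by metis
  \<comment> \<open>The pairing interleaves all sequences \<open>S k\<close>, so the supremum along
    \<open>s\<close> dominates each of theirs.\<close>
  define s where "s n = S (fst (prod_decode n)) (snd (prod_decode n))" for n
  have sQ: "s \<in> Q" using S(1) by (auto simp: Q_def s_def)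
  have sS: "(SUP n. S k n w) \<le> (SUP n. s n w)" for k w
  proof (rule SUP_least)
    fix n show "S k n w \<le> (SUP n. s n w)"
      by (rule SUP_upper2[of "prod_encode (k, n)"]) (auto simp: s_def)
  qed
  have "J s \<le> f k" for k
    unfolding S(2) J_def using sS
    by (intro nn_integral_mono) (simp add: ennreal_inverse_mono_iff add_left_mono)
  then have sInf: "J s \<le> Inf (J ` Q)" unfolding f(2) by (rule INF_greatest)
  show ?thesis
  proof
    show "range s \<subseteq> H" using sQ by (simp add: Q_def)
    fix h assume h: "h \<in> H"
    define t where "t = case_nat h s"
    have tQ: "t \<in> Q" using sQ h by (auto simp: Q_def t_def image_subset_iff split: nat.splits)
    have [measurable]: "(\<lambda>w. SUP n. s n w) \<in> borel_measurable M" "(\<lambda>w. SUP n. t n w) \<in> borel_measurable M"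
      using meas[OF sQ] meas[OF tQ] .
    have ht: "h w \<le> (SUP n. t n w)" for w
      by (rule SUP_upper2[of 0]) (auto simp: t_def)
    have st: "(SUP n. s n w) \<le> (SUP n. t n w)" for w
    proof (rule SUP_least)
      fix n show "s n w \<le> (SUP n. t n w)"
        by (rule SUP_upper2[of "Suc n"]) (auto simp: t_def)
    qed
    have fin: "J t \<noteq> \<infinity>"
    proof -
      have "J t \<le> (\<integral>\<^sup>+w. 1 \<partial>M)" unfolding J_def
        using ennreal_inverse_mono_iff[of _ 1] by (intro nn_integral_mono) (auto simp: add_increasing2)
      also have "\<dots> < \<infinity>" by (simp add: emeasure_space_1)
      finally show ?thesis by simp
    qed
    have le: "inverse (1 + (SUP n. t n w)) \<le> inverse (1 + (SUP n. s n w))" for w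
      using st by (simp add: ennreal_inverse_mono_iff add_left_mono)
    have "J s \<le> J t" using sInf tQ by (auto intro: order_trans INF_lower)
    then have "J s - J t = 0" using fin by (simp add: diff_eq_0_iff_ennreal less_top)
    moreover have "(\<integral>\<^sup>+w. inverse (1 + (SUP n. s n w)) - inverse (1 + (SUP n. t n w)) \<partial>M) = J s - J t"
      unfolding J_def using fin le by (intro nn_integral_diff) (auto simp: J_def)
    ultimately have "AE w in M. inverse (1 + (SUP n. s n w)) - inverse (1 + (SUP n. t n w)) = 0"
      by (subst nn_integral_0_iff_AE[symmetric]) auto
    then show "AE w in M. h w \<le> (SUP n. s n w)"
    proof eventually_elim
      case (elim w)
      then have "inverse (1 + (SUP n. s n w)) \<le> inverse (1 + (SUP n. t n w))"
        by (rule ennreal_minus_eq_0)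
      then have "(SUP n. t n w) \<le> (SUP n. s n w)"
        unfolding ennreal_inverse_mono_iff by simp
      with ht show ?case by (rule order_trans)
    qed
  qed
qed

text \<open>Inversion reverses the order of \<open>[0, \<infinity>]\<close> and exchanges 0 with
  \<infinity>, which reduces this to \<open>ess_sup_countable\<close>.\<close>

lemma ess_inf_countable:
  fixes H :: "('a \<Rightarrow> ennreal) set"
  assumes "H \<noteq> {}" "H \<subseteq> borel_measurable M"
  obtains s :: "nat \<Rightarrow> 'a \<Rightarrow> ennreal" where "range s \<subseteq> H" "\<And>h. h \<in> H \<Longrightarrow> AE w in M. (INF n. s n w) \<le> h w"
proof -
  let ?G = "(\<lambda>h w. inverse (h w)) ` H"
  have "?G \<noteq> {}" "?G \<subseteq> borel_measurable M" using assms by auto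
  then obtain s :: "nat \<Rightarrow> 'a \<Rightarrow> ennreal" where s: "range s \<subseteq> ?G" "\<And>h. h \<in> ?G \<Longrightarrow> AE w in M. h w \<le> (SUP n. s n w)"
    using ess_sup_countable[of ?G] by blast
  have "\<forall>n. \<exists>h\<in>H. s n = (\<lambda>w. inverse (h w))"
  proof
    fix n
    have "s n \<in> ?G" using s(1) by auto
    then show "\<exists>h\<in>H. s n = (\<lambda>w. inverse (h w))" by auto
  qed
  then obtain t where t: "\<And>n. t n \<in> H" "\<And>n. s n = (\<lambda>w. inverse (t n w))" by metis
  show ?thesis
  proof
    show "range t \<subseteq> H" using t(1) by auto
    fix h assume "h \<in> H"
    then have "AE w in M. inverse (h w) \<le> (SUP n. s n w)" by (intro s(2)) auto
    then show "AE w in M. (INF n. t n w) \<le> h w"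
    proof eventually_elim
      case (elim w)
      also have "(SUP n. s n w) \<le> inverse (INF n. t n w)"
        by (rule SUP_least) (auto simp: t(2) ennreal_inverse_mono_iff intro: INF_lower)
      finally show ?case by (simp add: ennreal_inverse_mono_iff)
    qed
  qed
qed

end

section \<open>Conditional monotone convergence and the conditional Hoelder inequality\<close>

context prob_subalgebra
begin

text \<open>Both sides are compared on each set of \<open>F\<close>. Monotone convergence is applied
  to the \<open>u n\<close> and to their conditional expectations, the latter increasing only almost
  everywhere.\<close>

lemma nn_cond_exp_SUP:
  fixes u :: "nat \<Rightarrow> 'w \<Rightarrow> ennreal"
  assumes [measurable]: "\<And>n. u n \<in> borel_measurable M" and inc: "\<And>n v. u n v \<le> u (Suc n) v"
  shows "AE v in M. nnE (\<lambda>v. SUP n. u n v) v = (SUP n. nnE (u n) v)"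
proof -
  have "AE v in M. (SUP n. nnE (u n) v) = nnE (\<lambda>v. SUP n. u n v) v"
  proof (rule nn_cond_exp_charact)
    fix A assume A: "A \<in> sets F"
    then have [measurable]: "A \<in> sets F" "A \<in> sets M" by measurable
    have "(\<integral>\<^sup>+ v\<in>A. (SUP n. u n v) \<partial>M) = (\<integral>\<^sup>+ v. (SUP n. indicator A v * u n v) \<partial>M)"
      by (simp add: SUP_mult_left_ennreal mult.commute)
    also have "\<dots> = (SUP n. \<integral>\<^sup>+ v. indicator A v * u n v \<partial>M)"
      by (intro nn_integral_monotone_convergence_SUP_AE AE_I2 mult_left_mono inc) auto
    also have "\<dots> = (SUP n. \<integral>\<^sup>+ v. indicator A v * nnE (u n) v \<partial>M)"
      by (simp add: nn_cond_exp_intg)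
    also have "\<dots> = (\<integral>\<^sup>+ v. (SUP n. indicator A v * nnE (u n) v) \<partial>M)"
    proof (rule nn_integral_monotone_convergence_SUP_AE[symmetric])
      fix n
      have "AE v in M. nnE (u n) v \<le> nnE (u (Suc n)) v"
        by (intro nn_cond_exp_mono) (auto intro: inc)
      then show "AE v in M. indicator A v * nnE (u n) v \<le> indicator A v * nnE (u (Suc n)) v"
        by eventually_elim (rule mult_left_mono, auto)
    qed measurable
    finally show "(\<integral>\<^sup>+ v\<in>A. (SUP n. u n v) \<partial>M) = (\<integral>\<^sup>+ v\<in>A. (SUP n. nnE (u n) v) \<partial>M)"
      by (simp add: SUP_mult_left_ennreal mult.commute)
  qed measurable
  then show ?thesis by eventually_elim simp
qed

lemma nn_cond_exp_SUP_le:
  fixes u :: "nat \<Rightarrow> 'w \<Rightarrow> ennreal"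
  assumes "\<And>n. u n \<in> borel_measurable M" "\<And>n v. u n v \<le> u (Suc n) v"
    and "\<And>n. AE v in M. nnE (u n) v \<le> c v"
  shows "AE v in M. nnE (\<lambda>v. SUP n. u n v) v \<le> c v"
proof -
  have "AE v in M. \<forall>n. nnE (u n) v \<le> c v" using assms(3) by (simp add: AE_all_countable)
  then show ?thesis using nn_cond_exp_SUP[of u, OF assms(1,2)]
    by eventually_elim (simp add: SUP_least)
qed

lemma nn_cond_exp_F_mult:
  assumes [measurable]: "a \<in> borel_measurable F" "u \<in> borel_measurable M" and "\<And>v. 0 \<le> a v"
  shows "AE v in M. nnE (\<lambda>v. ennreal (a v * u v)) v = ennreal (a v) * nnE (\<lambda>v. ennreal (u v)) v"
proof -
  have "AE v in M. ennreal (a v) * nnE (\<lambda>v. ennreal (u v)) v = nnE (\<lambda>v. ennreal (a v) * ennreal (u v)) v"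
    by (rule nn_cond_exp_prod) measurable
  then show ?thesis unfolding ennreal_mult'[OF assms(3)] by eventually_elim simp
qed

text \<open>Young's inequality is applied to \<open>u / s\<close> and \<open>v / t\<close> with
  \<open>F\<close>-measurable normalisers, which leave the conditional expectation. The summand
  \<open>e > 0\<close> keeps them positive where a conditional norm vanishes.\<close>

lemma nn_cond_exp_Hoelder:
  fixes u v :: "'w \<Rightarrow> real"
  assumes pq: "p > 1" "q > 1" "1 / p + 1 / q = 1"
    and [measurable]: "u \<in> borel_measurable M" "v \<in> borel_measurable M"
    and u0: "\<And>w. 0 \<le> u w" and v0: "\<And>w. 0 \<le> v w"
    and fu: "AE w in M. nnE (\<lambda>w. ennreal (u w powr p)) w < \<infinity>"
    and fv: "AE w in M. nnE (\<lambda>w. ennreal (v w powr q)) w < \<infinity>"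
  shows "AE w in M. nnE (\<lambda>w. ennreal (u w * v w)) w \<le>
    ennreal (enn2real (nnE (\<lambda>w. ennreal (u w powr p)) w) powr (1 / p) *
             enn2real (nnE (\<lambda>w. ennreal (v w powr q)) w) powr (1 / q))"
proof -
  let ?N = "nnE (\<lambda>w. ennreal (u w * v w))"
  define a where "a w = enn2real (nnE (\<lambda>w. ennreal (u w powr p)) w)" for w
  define b where "b w = enn2real (nnE (\<lambda>w. ennreal (v w powr q)) w)" for w
  have [measurable]: "a \<in> borel_measurable F" "b \<in> borel_measurable F"
    unfolding a_def b_def by measurable
  have ab0: "0 \<le> a w" "0 \<le> b w" for w by (auto simp: a_def b_def)
  have "AE w in M. ?N w \<le> ennreal ((a w powr (1/p) + e) * (b w powr (1/q) + e))" if e: "e > 0" for e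
  proof -
    define s where "s w = a w powr (1/p) + e" for w
    define t where "t w = b w powr (1/q) + e" for w
    have [measurable]: "s \<in> borel_measurable F" "t \<in> borel_measurable F"
      unfolding s_def t_def by measurable
    have s0: "0 < s w" and t0: "0 < t w" for w using e by (auto simp: s_def t_def add_nonneg_pos)
    \<comment> \<open>\<open>c\<close> and \<open>d\<close> are the coefficients of
      \<open>u powr p\<close> and \<open>v powr q\<close> after Young's inequality is multiplied
      back by \<open>s t\<close>.\<close>
    define c where "c w = s w * t w / (p * s w powr p)" for w
    define d where "d w = s w * t w / (q * t w powr q)" for w
    have [measurable]: "c \<in> borel_measurable F" "d \<in> borel_measurable F"
      unfolding c_def d_def by measurable
    have cd0: "0 \<le> c w" "0 \<le> d w" for w
      using s0[of w] t0[of w] pq by (auto simp: c_def d_def)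
    have young: "u w * v w \<le> c w * u w powr p + d w * v w powr q" for w
    proof -
      have "u w * v w = (s w * t w) * ((u w / s w) * (v w / t w))"
        using s0[of w] t0[of w] by simp
      also have "\<dots> \<le> (s w * t w) * ((u w / s w) powr p / p + (v w / t w) powr q / q)"
        using s0[of w] t0[of w] u0[of w] v0[of w]
        by (intro mult_left_mono Youngs_inequality pq) auto
      also have "\<dots> = c w * u w powr p + d w * v w powr q"
        using s0[of w] t0[of w] u0[of w] v0[of w]
        by (simp add: c_def d_def powr_divide distrib_left mult.commute)
      finally show ?thesis .
    qed
    have "AE w in M. ?N w \<le> nnE (\<lambda>w. ennreal (c w * u w powr p) + ennreal (d w * v w powr q)) w"
      using young cd0 by (intro nn_cond_exp_mono AE_I2) (auto simp flip: ennreal_plus intro!: ennreal_leI)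
    moreover have "AE w in M. nnE (\<lambda>w. ennreal (c w * u w powr p)) w + nnE (\<lambda>w. ennreal (d w * v w powr q)) w
        = nnE (\<lambda>w. ennreal (c w * u w powr p) + ennreal (d w * v w powr q)) w"
      by (rule nn_cond_exp_sum) measurable
    moreover have "AE w in M. nnE (\<lambda>w. ennreal (c w * u w powr p)) w = ennreal (c w) * nnE (\<lambda>w. ennreal (u w powr p)) w"
      using cd0 by (intro nn_cond_exp_F_mult) auto
    moreover have "AE w in M. nnE (\<lambda>w. ennreal (d w * v w powr q)) w = ennreal (d w) * nnE (\<lambda>w. ennreal (v w powr q)) w"
      using cd0 by (intro nn_cond_exp_F_mult) auto
    ultimately show ?thesis using fu fv
    proof eventually_elim
      case (elim w)
      have "nnE (\<lambda>w. ennreal (u w powr p)) w = ennreal (a w)"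
        "nnE (\<lambda>w. ennreal (v w powr q)) w = ennreal (b w)"
        using elim by (auto simp: a_def b_def)
      with elim have "?N w \<le> ennreal (c w) * ennreal (a w) + ennreal (d w) * ennreal (b w)"
        by simp
      also have "\<dots> = ennreal (c w * a w + d w * b w)"
        using cd0[of w] ab0[of w] by (simp add: ennreal_mult)
      also have "\<dots> \<le> ennreal (s w * t w)"
      proof (rule ennreal_leI)
        have "a w = (a w powr (1/p)) powr p" "b w = (b w powr (1/q)) powr q"
          using pq(1,2) ab0[of w] by (simp_all add: powr_powr)
        moreover have "(a w powr (1/p)) powr p \<le> s w powr p" "(b w powr (1/q)) powr q \<le> t w powr q"
          using e pq(1,2) by (auto simp: s_def t_def intro!: powr_mono2)
        ultimately have "a w \<le> s w powr p" "b w \<le> t w powr q" by simp_all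
        then have "c w * a w + d w * b w \<le> c w * s w powr p + d w * t w powr q"
          using cd0[of w] by (intro add_mono mult_left_mono) auto
        also have "\<dots> = s w * t w * (1 / p + 1 / q)"
          using s0[of w] t0[of w] pq(1,2) by (simp add: c_def d_def distrib_left)
        finally show "c w * a w + d w * b w \<le> s w * t w" by (simp only: pq mult_1_right)
      qed
      finally show ?case by (simp add: s_def t_def)
    qed
  qed
  \<comment> \<open>Only the values \<open>e = 1 / (n + 1)\<close> are used, so that one null set
    serves them all in the limit.\<close>
  then have "AE w in M. \<forall>n. ?N w \<le> ennreal ((a w powr (1/p) + 1 / real (Suc n)) * (b w powr (1/q) + 1 / real (Suc n)))"
    unfolding AE_all_countable by auto
  then show ?thesis
    unfolding a_def[symmetric] b_def[symmetric]
  proof eventually_elim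
    case (elim w)
    have "(\<lambda>n. ennreal ((a w powr (1/p) + 1 / real (Suc n)) * (b w powr (1/q) + 1 / real (Suc n))))
        \<longlonglongrightarrow> ennreal ((a w powr (1/p) + 0) * (b w powr (1/q) + 0))"
      by (intro tendsto_ennrealI tendsto_intros LIMSEQ_Suc[OF lim_1_over_n])
    from LIMSEQ_le_const[OF this] elim show ?case by auto
  qed
qed

end

section \<open>A Radon--Nikodym theorem for signed set functions\<close>

text \<open>Together with finite additivity, \<open>ac\<close> implies countable additivity. It takes the place of domination by a
  measure, since the set functions below are only bounded by multiples of \<open>(\<integral>\<^sub>A \<rho>)\<^bsup>1/p\<^esup>\<close>.\<close>

locale ac_set_function = prob_space M for M :: "'a measure" +
  fixes \<nu> :: "'a set \<Rightarrow> real" and \<rho> :: "'a \<Rightarrow> real"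
  assumes add: "\<lbrakk>A \<in> sets M; B \<in> sets M; A \<inter> B = {}\<rbrakk> \<Longrightarrow> \<nu> (A \<union> B) = \<nu> A + \<nu> B"
    and \<rho>: "integrable M \<rho>" "\<And>x. 0 \<le> \<rho> x"
    and ac: "0 < e \<Longrightarrow> \<exists>C\<ge>0. \<forall>A\<in>sets M. \<bar>\<nu> A\<bar> \<le> e + C * (LINT x:A|M. \<rho> x)"
begin

lemma empty: "\<nu> {} = 0"
  using add[of "{}" "{}"] by simp

lemma null: 
  assumes "A \<in> null_sets M"
  shows "\<nu> A = 0"
proof (rule ccontr)
  assume "\<nu> A \<noteq> 0"
  then obtain C where "\<bar>\<nu> A\<bar> \<le> \<bar>\<nu> A\<bar> / 2 + C * (LINT x:A|M. \<rho> x)"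
    using ac[of "\<bar>\<nu> A\<bar> / 2"] assms by auto
  moreover have "(LINT x:A|M. \<rho> x) = 0"
    unfolding set_lebesgue_integral_def using AE_not_in[OF assms]
    by (intro integral_eq_zero_AE) (auto elim: eventually_mono simp: indicator_def)
  ultimately show False using \<open>\<nu> A \<noteq> 0\<close> by simp
qed

text \<open>Dominated convergence with majorant \<open>\<rho>\<close> drives the integrals to 0, so
  the constant that \<open>ac\<close> provides for \<open>e / 2\<close> does no harm in the limit.
  This continuity at the empty set is the source of countable additivity.\<close>

lemma tendsto_decreasing:
  assumes A: "\<And>n. A n \<in> sets M" and dec: "decseq A" and empty: "(\<Inter>n. A n) = {}"
  shows "(\<lambda>n. \<nu> (A n)) \<longlonglongrightarrow> 0"
proof (rule LIMSEQ_I)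
  fix e :: real assume "0 < e"
  then obtain C where C: "0 \<le> C" "\<And>A. A \<in> sets M \<Longrightarrow> \<bar>\<nu> A\<bar> \<le> e / 2 + C * (LINT x:A|M. \<rho> x)"
    using ac[of "e / 2"] by auto
  have "(\<lambda>n. LINT x|M. indicator (A n) x *\<^sub>R \<rho> x) \<longlonglongrightarrow> (LINT x|M. 0)"
  proof (rule integral_dominated_convergence[OF _ _ \<rho>(1)])
    show "AE x in M. (\<lambda>n. indicat_real (A n) x *\<^sub>R \<rho> x) \<longlonglongrightarrow> 0"
    proof (rule AE_I2)
      fix x
      obtain n where "x \<notin> A n" using empty by auto
      then have "eventually (\<lambda>k. indicat_real (A k) x *\<^sub>R \<rho> x = 0) sequentially"
        using dec by (intro eventually_sequentiallyI[of n]) (auto simp: decseq_def indicator_def)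
      then show "(\<lambda>n. indicat_real (A n) x *\<^sub>R \<rho> x) \<longlonglongrightarrow> 0"
        by (rule tendsto_eventually)
    qed
    show "AE x in M. norm (indicat_real (A n) x *\<^sub>R \<rho> x) \<le> \<rho> x" for n
      using \<rho>(2) by (auto simp: indicator_def)
    show "(\<lambda>x. indicat_real (A n) x *\<^sub>R \<rho> x) \<in> borel_measurable M" for n
      using A[of n] borel_measurable_integrable[OF \<rho>(1)] by measurable
  qed simp
  then have "(\<lambda>n. e / 2 + C * (LINT x:A n|M. \<rho> x)) \<longlonglongrightarrow> e / 2 + C * 0"
    unfolding set_lebesgue_integral_def by (intro tendsto_intros) simp
  from order_tendstoD(2)[OF this, of e]
  have "eventually (\<lambda>n. e / 2 + C * (LINT x:A n|M. \<rho> x) < e) sequentially"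
    using \<open>0 < e\<close> by simp
  then obtain N where "\<And>n. n \<ge> N \<Longrightarrow> e / 2 + C * (LINT x:A n|M. \<rho> x) < e"
    unfolding eventually_sequentially by auto
  then show "\<exists>N. \<forall>n\<ge>N. norm (\<nu> (A n) - 0) < e"
    using C(2)[OF A] by (intro exI[of _ N]) (auto intro: le_less_trans)
qed

text \<open>The upper variation, that is, the positive part of the Jordan decomposition.
  \<open>ennreal\<close> cuts negative values to 0, which leaves the supremum unchanged because the
  empty set contributes 0 anyway.\<close>

definition pos_part :: "'a set \<Rightarrow> ennreal" where
  "pos_part A = (SUP B\<in>{B \<in> sets M. B \<subseteq> A}. ennreal (\<nu> B))"

lemma pos_part_upper: "B \<in> sets M \<Longrightarrow> B \<subseteq> A \<Longrightarrow> ennreal (\<nu> B) \<le> pos_part A"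
  unfolding pos_part_def by (rule SUP_upper) auto

lemma pos_part_mono: "A \<subseteq> A' \<Longrightarrow> pos_part A \<le> pos_part A'"
  unfolding pos_part_def by (rule SUP_subset_mono) auto

lemma pos_part_finite: "pos_part A \<noteq> \<infinity>"
proof -
  obtain C where C: "0 \<le> C" "\<And>A. A \<in> sets M \<Longrightarrow> \<bar>\<nu> A\<bar> \<le> 1 + C * (LINT x:A|M. \<rho> x)"
    using ac[of 1] by auto
  have "pos_part A \<le> ennreal (1 + C * (LINT x|M. \<rho> x))"
    unfolding pos_part_def
  proof (rule SUP_least, rule ennreal_leI)
    fix B assume "B \<in> {B \<in> sets M. B \<subseteq> A}"
    then have B: "B \<in> sets M" by simp
    have "(LINT x:B|M. \<rho> x) \<le> (LINT x|M. \<rho> x)"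
      unfolding set_lebesgue_integral_def using B \<rho>
      by (intro integral_mono integrable_mult_indicator) (auto simp: indicator_def)
    then have "C * (LINT x:B|M. \<rho> x) \<le> C * (LINT x|M. \<rho> x)" using C(1) by (rule mult_left_mono)
    then show "\<nu> B \<le> 1 + C * (LINT x|M. \<rho> x)" using C(2)[OF B] by simp
  qed
  also have "\<dots> < \<infinity>" by simp
  finally show ?thesis by simp
qed

lemma pos_part_superadd:
  assumes "A \<inter> B = {}"
  shows "pos_part A + pos_part B \<le> pos_part (A \<union> B)"
proof -
  let ?P = "\<lambda>A. {B \<in> sets M. B \<subseteq> A}"
  have 1: "ennreal (\<nu> X) + ennreal (\<nu> Y) \<le> pos_part (A \<union> B)" if "X \<in> ?P A" "Y \<in> ?P B" for X Y
  proof -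
    \<comment> \<open>Addition in \<open>ennreal\<close> agrees with real addition for nonnegative
      summands, so a set of negative value is replaced by the empty set, which has the same image
      under \<open>ennreal\<close>.\<close>
    define X' where "X' = (if \<nu> X < 0 then {} else X)"
    define Y' where "Y' = (if \<nu> Y < 0 then {} else Y)"
    have "X' \<in> sets M" "Y' \<in> sets M" "X' \<inter> Y' = {}" "X' \<union> Y' \<subseteq> A \<union> B"
      using that assms by (auto simp: X'_def Y'_def)
    then have "ennreal (\<nu> X' + \<nu> Y') \<le> pos_part (A \<union> B)"
      using pos_part_upper[of "X' \<union> Y'"] add[of X' Y'] by auto
    moreover have "ennreal (\<nu> X) = ennreal (\<nu> X')" "ennreal (\<nu> Y) = ennreal (\<nu> Y')" "0 \<le> \<nu> X'" "0 \<le> \<nu> Y'"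
      by (auto simp: X'_def Y'_def empty ennreal_neg)
    ultimately show ?thesis by simp
  qed
  have 2: "pos_part A + ennreal (\<nu> Y) \<le> pos_part (A \<union> B)" if "Y \<in> ?P B" for Y
    unfolding pos_part_def[of A] using 1[OF _ that]
    by (subst ennreal_SUP_add_left[symmetric]) (auto intro!: SUP_least)
  show ?thesis
    unfolding pos_part_def[of B] using 2
    by (subst add.commute, subst ennreal_SUP_add_left[symmetric]) (auto intro!: SUP_least simp: add.commute)
qed

text \<open>One inequality is finite superadditivity in the limit. For the other, a set
  \<open>B\<close> is split along the \<open>A i\<close>; the value of the remainder
  \<open>T n\<close> tends to 0 because the remainders decrease to the empty set.\<close>

lemma pos_part_countably_additive: "countably_additive (sets M) pos_part"
proof (rule countably_additiveI)
  fix A :: "nat \<Rightarrow> 'a set"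
  assume A: "range A \<subseteq> sets M" and dis: "disjoint_family A" and U: "(\<Union>i. A i) \<in> sets M"
  have As: "A i \<in> sets M" for i using A by auto
  have disj: "A i \<inter> A n = {}" if "i < n" for i n
    using dis that by (simp add: disjoint_family_on_def)
  have "(\<Sum>i<n. pos_part (A i)) \<le> pos_part (\<Union>i<n. A i)" for n
  proof (induction n)
    case 0
    show ?case by simp
  next
    case (Suc n)
    have "(\<Union>i<n. A i) \<inter> A n = {}"
      using disj by auto
    then have "pos_part (\<Union>i<n. A i) + pos_part (A n) \<le> pos_part (\<Union>i<Suc n. A i)"
      using pos_part_superadd[of "\<Union>i<n. A i" "A n"] by (simp add: lessThan_Suc Un_commute)
    then show ?case using Suc by (auto intro: order_trans add_right_mono)
  qed
  then have "(\<Sum>i<n. pos_part (A i)) \<le> pos_part (\<Union>i. A i)" for n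
    by (rule order_trans) (intro pos_part_mono, auto)
  then have le: "(\<Sum>i. pos_part (A i)) \<le> pos_part (\<Union>i. A i)"
    by (intro suminf_le_const) auto
  have ge: "pos_part (\<Union>i. A i) \<le> (\<Sum>i. pos_part (A i))"
    unfolding pos_part_def[of "\<Union>i. A i"]
  proof (rule SUP_least)
    fix B assume "B \<in> {B \<in> sets M. B \<subseteq> (\<Union>i. A i)}"
    then have B: "B \<in> sets M" "B \<subseteq> (\<Union>i. A i)" by auto
    define T where "T n = B - (\<Union>i<n. A i)" for n
    have Ts: "T n \<in> sets M" for n using B As by (auto simp: T_def)
    have dec: "decseq T" by (auto simp: T_def decseq_def)
    have "(\<Inter>n. T n) = {}" using B(2) by (auto simp: T_def)
    then have lim: "(\<lambda>n. \<nu> (T n)) \<longlonglongrightarrow> 0" by (rule tendsto_decreasing[OF Ts dec])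
    have eq: "\<nu> B = (\<Sum>i<n. \<nu> (B \<inter> A i)) + \<nu> (T n)" for n
    proof (induction n)
      case 0
      show ?case by (simp add: T_def)
    next
      case (Suc n)
      have "(\<Union>i<n. A i) \<inter> A n = {}" using disj by auto
      moreover have "(\<Union>i<Suc n. A i) = A n \<union> (\<Union>i<n. A i)" by (simp add: lessThan_Suc)
      ultimately have "T n = (B \<inter> A n) \<union> T (Suc n)"
        unfolding T_def by blast
      moreover have "(B \<inter> A n) \<inter> T (Suc n) = {}" by (auto simp: T_def)
      ultimately have "\<nu> (T n) = \<nu> (B \<inter> A n) + \<nu> (T (Suc n))"
        using B(1) As Ts add[of "B \<inter> A n" "T (Suc n)"] by simp
      then show ?case using Suc by simp
    qed
    have bound: "ennreal (\<nu> B) \<le> (\<Sum>i. pos_part (A i)) + ennreal (\<nu> (T n))" for n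
    proof -
      have "ennreal (\<nu> B) \<le> (\<Sum>i<n. ennreal (\<nu> (B \<inter> A i))) + ennreal (\<nu> (T n))"
      proof -
        have "\<nu> B \<le> (\<Sum>i<n. max 0 (\<nu> (B \<inter> A i))) + max 0 (\<nu> (T n))"
          unfolding eq[of n] by (intro add_mono sum_mono) auto
        then have "ennreal (\<nu> B) \<le> ennreal ((\<Sum>i<n. max 0 (\<nu> (B \<inter> A i))) + max 0 (\<nu> (T n)))"
          by (rule ennreal_leI)
        also have "\<dots> = (\<Sum>i<n. ennreal (max 0 (\<nu> (B \<inter> A i)))) + ennreal (max 0 (\<nu> (T n)))"
          by (subst sum_ennreal) (simp_all only: ennreal_plus sum_nonneg max.cobounded1)
        finally show ?thesis by simp
      qed
      also have "(\<Sum>i<n. ennreal (\<nu> (B \<inter> A i))) \<le> (\<Sum>i<n. pos_part (A i))"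
        using B As by (intro sum_mono pos_part_upper) auto
      also have "\<dots> \<le> (\<Sum>i. pos_part (A i))" by (rule sum_le_suminf) auto
      finally show ?thesis by (simp add: add_right_mono)
    qed
    have "(\<lambda>n. (\<Sum>i. pos_part (A i)) + ennreal (\<nu> (T n))) \<longlonglongrightarrow> (\<Sum>i. pos_part (A i)) + ennreal 0"
      by (intro tendsto_add tendsto_const tendsto_ennrealI lim)
    from LIMSEQ_le_const[OF this] bound show "ennreal (\<nu> B) \<le> (\<Sum>i. pos_part (A i))" by auto
  qed
  from le ge show "(\<Sum>i. pos_part (A i)) = pos_part (\<Union>i. A i)" by (rule antisym)
qed

text \<open>The last two clauses say that the integral of \<open>h\<close> over \<open>A\<close> is
  the supremum of \<open>\<nu>\<close> over the measurable subsets of \<open>A\<close>. In this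
  real-valued form it is used for \<open>\<nu>\<close> and for \<open>- \<nu>\<close> alike.\<close>

lemma pos_part_density:
  obtains h where "integrable M h" "\<And>x. 0 \<le> h x"
    "\<And>A B. \<lbrakk>A \<in> sets M; B \<in> sets M; B \<subseteq> A\<rbrakk> \<Longrightarrow> \<nu> B \<le> (LINT x:A|M. h x)"
    "\<And>A c. \<lbrakk>A \<in> sets M; \<And>B. \<lbrakk>B \<in> sets M; B \<subseteq> A\<rbrakk> \<Longrightarrow> \<nu> B \<le> c\<rbrakk> \<Longrightarrow> (LINT x:A|M. h x) \<le> c"
proof -
  define N where "N = measure_of (space M) (sets M) pos_part"
  have pos_empty: "pos_part {} = 0"
  proof -
    have "{B \<in> sets M. B \<subseteq> {}} = {{}}" by auto
    then show ?thesis by (simp add: pos_part_def empty)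
  qed
  have sN: "sets N = sets M" unfolding N_def by simp
  have eN: "emeasure N A = pos_part A" if "A \<in> sets M" for A
    using that pos_empty pos_part_countably_additive
    by (intro emeasure_measure_of[OF N_def]) (auto simp: sets.space_closed positive_def sN)
  have "absolutely_continuous M N"
    unfolding absolutely_continuous_def
  proof
    fix A assume A: "A \<in> null_sets M"
    have "pos_part A \<le> 0" unfolding pos_part_def
    proof (rule SUP_least)
      fix B assume "B \<in> {B \<in> sets M. B \<subseteq> A}"
      then have "B \<in> null_sets M" using A by (auto intro: null_sets_subset)
      then show "ennreal (\<nu> B) \<le> 0" by (simp add: null)
    qed
    then show "A \<in> null_sets N" using A by (auto simp: null_sets_def eN sN)
  qed
  then obtain h where h [measurable]: "h \<in> borel_measurable M" and d: "density M h = N"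
    using Radon_Nikodym sN by blast
  have hA: "(\<integral>\<^sup>+x. h x * indicator A x \<partial>M) = pos_part A" if "A \<in> sets M" for A
    using that by (simp add: eN[symmetric] d[symmetric] emeasure_density)
  have fin: "(\<integral>\<^sup>+x. h x \<partial>M) \<noteq> \<infinity>"
    using hA[of "space M"] pos_part_finite[of "space M"] by (simp cong: nn_integral_cong)
  then have "AE x in M. h x \<noteq> \<infinity>" by (intro nn_integral_noteq_infinite) auto
  then have AEh: "AE x in M. ennreal (enn2real (h x)) = h x"
    by eventually_elim (simp add: less_top)
  have int: "integrable M (\<lambda>x. enn2real (h x))"
  proof (rule integrableI_bounded)
    have "(\<integral>\<^sup>+x. ennreal (norm (enn2real (h x))) \<partial>M) = (\<integral>\<^sup>+x. h x \<partial>M)"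
      using AEh by (intro nn_integral_cong_AE) auto
    then show "(\<integral>\<^sup>+x. ennreal (norm (enn2real (h x))) \<partial>M) < \<infinity>" using fin by (simp add: less_top)
  qed measurable
  have eq: "ennreal (LINT x:A|M. enn2real (h x)) = pos_part A" if A: "A \<in> sets M" for A
  proof -
    have "ennreal (LINT x:A|M. enn2real (h x)) = (\<integral>\<^sup>+x. ennreal (indicator A x *\<^sub>R enn2real (h x)) \<partial>M)"
      unfolding set_lebesgue_integral_def using int A
      by (intro nn_integral_eq_integral[symmetric] integrable_mult_indicator) auto
    also have "\<dots> = (\<integral>\<^sup>+x. h x * indicator A x \<partial>M)"
      using AEh by (intro nn_integral_cong_AE) (auto elim!: eventually_mono simp: indicator_def)
    finally show ?thesis by (simp add: hA A)
  qed
  have nn: "0 \<le> (LINT x:A|M. enn2real (h x))" for A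
    unfolding set_lebesgue_integral_def by (intro integral_nonneg_AE) auto
  show ?thesis
  proof (rule that[OF int])
    fix A B assume "A \<in> sets M" "B \<in> sets M" "B \<subseteq> A"
    then have "ennreal (\<nu> B) \<le> ennreal (LINT x:A|M. enn2real (h x))"
      by (simp add: eq pos_part_upper)
    then show "\<nu> B \<le> (LINT x:A|M. enn2real (h x))"
      using nn[of A] by (simp add: ennreal_le_iff)
  next
    fix A c assume A: "A \<in> sets M" and c: "\<And>B. \<lbrakk>B \<in> sets M; B \<subseteq> A\<rbrakk> \<Longrightarrow> \<nu> B \<le> c"
    have "0 \<le> c" using c[of "{}"] by (simp add: empty)
    have "pos_part A \<le> ennreal c"
      unfolding pos_part_def using c by (intro SUP_least ennreal_leI) auto
    then show "(LINT x:A|M. enn2real (h x)) \<le> c"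
      using \<open>0 \<le> c\<close> by (simp add: eq[OF A, symmetric])
  qed auto
qed

lemma uminus: "ac_set_function M (\<lambda>A. - \<nu> A) \<rho>"
  by unfold_locales (use add \<rho> ac in auto)

text \<open>Jordan decomposition without a Hahn set. Because
  \<open>\<nu> B = \<nu> A - \<nu> (A - B)\<close>, an upper bound for \<open>- \<nu>\<close> on
  subsets of \<open>A\<close> gives one for \<open>\<nu>\<close>, and conversely. Both integrals are
  least upper bounds, so their difference is \<open>\<nu> A\<close>.\<close>

lemma Radon_Nikodym_signed:
  obtains h where "integrable M h" "\<And>A. A \<in> sets M \<Longrightarrow> \<nu> A = (LINT x:A|M. h x)"
proof -
  obtain h where h: "integrable M h"
    "\<And>A B. \<lbrakk>A \<in> sets M; B \<in> sets M; B \<subseteq> A\<rbrakk> \<Longrightarrow> \<nu> B \<le> (LINT x:A|M. h x)"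
    "\<And>A c. \<lbrakk>A \<in> sets M; \<And>B. \<lbrakk>B \<in> sets M; B \<subseteq> A\<rbrakk> \<Longrightarrow> \<nu> B \<le> c\<rbrakk> \<Longrightarrow> (LINT x:A|M. h x) \<le> c"
    by (rule pos_part_density) blast
  interpret neg: ac_set_function M "\<lambda>A. - \<nu> A" \<rho> by (rule uminus)
  obtain k where k: "integrable M k"
    "\<And>A B. \<lbrakk>A \<in> sets M; B \<in> sets M; B \<subseteq> A\<rbrakk> \<Longrightarrow> - \<nu> B \<le> (LINT x:A|M. k x)"
    "\<And>A c. \<lbrakk>A \<in> sets M; \<And>B. \<lbrakk>B \<in> sets M; B \<subseteq> A\<rbrakk> \<Longrightarrow> - \<nu> B \<le> c\<rbrakk> \<Longrightarrow> (LINT x:A|M. k x) \<le> c"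
    by (rule neg.pos_part_density) blast
  show ?thesis
  proof
    show "integrable M (\<lambda>x. h x - k x)" using h(1) k(1) by simp
    fix A assume A: "A \<in> sets M"
    have split: "\<nu> A = \<nu> B + \<nu> (A - B)" if "B \<in> sets M" "B \<subseteq> A" for B
      using add[of B "A - B"] that A by (simp add: Un_absorb1)
    have "(LINT x:A|M. h x) \<le> \<nu> A + (LINT x:A|M. k x)"
    proof (rule h(3)[OF A])
      fix B assume "B \<in> sets M" "B \<subseteq> A"
      then show "\<nu> B \<le> \<nu> A + (LINT x:A|M. k x)"
        using k(2)[of A "A - B"] split[of B] A by auto
    qed
    moreover have "(LINT x:A|M. k x) \<le> (LINT x:A|M. h x) - \<nu> A"
    proof (rule k(3)[OF A])
      fix B assume "B \<in> sets M" "B \<subseteq> A"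
      then show "- \<nu> B \<le> (LINT x:A|M. h x) - \<nu> A"
        using h(2)[of A "A - B"] split[of B] A by auto
    qed
    moreover have "(LINT x:A|M. h x - k x) = (LINT x:A|M. h x) - (LINT x:A|M. k x)"
      using h(1) k(1) A by (intro set_integral_diff) (simp_all add: set_integrable_def integrable_mult_indicator del: real_scaleR_def)
    ultimately show "\<nu> A = (LINT x:A|M. h x - k x)" by simp
  qed
qed

end

section \<open>Conditional \<open>L\<^sup>p\<close>-modules\<close>

context random_normed_module
begin

definition scl :: "('w \<Rightarrow> 'k) \<Rightarrow> 's \<Rightarrow> 's" where
  "scl a x = L0_class M a \<odot> x"

text \<open>The absolute value makes this representative of the norm nonnegative everywhere instead
  of almost everywhere.\<close>

definition nm :: "'s \<Rightarrow> 'w \<Rightarrow> real" where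
  "nm x w = \<bar>L0_rep (rnorm S x) w\<bar>"

lemma nm_nonneg [simp]: "0 \<le> nm x w"
  by (simp add: nm_def)

lemma rnorm_L0: "x \<in> carrier S \<Longrightarrow> rnorm S x \<in> L0 M"
  using rnorm_closed by (auto simp: L0_nonneg_def)

lemma nm_measurable [measurable]: "x \<in> carrier S \<Longrightarrow> nm x \<in> borel_measurable M"
  unfolding nm_def using L0_rep_measurable[OF rnorm_L0] by measurable

lemma AE_nm: "x \<in> carrier S \<Longrightarrow> AE w in M. L0_rep (rnorm S x) w = nm x w"
  using rnorm_closed[of x] by (auto simp: L0_nonneg_def nm_def elim!: eventually_mono)

lemma rnorm_eq: "x \<in> carrier S \<Longrightarrow> rnorm S x = L0_class M (nm x)"
  using L0_class_rep[OF rnorm_L0] L0_class_cong[OF AE_nm, of x] L0_rep_measurable[OF rnorm_L0] by auto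

lemma scl_closed [simp]: "\<lbrakk>a \<in> borel_measurable M; x \<in> carrier S\<rbrakk> \<Longrightarrow> scl a x \<in> carrier S"
  unfolding scl_def by (intro smult_closed) (simp_all add: L0_ring_carrier L0_class_in_L0)

lemma scl_scl: "\<lbrakk>a \<in> borel_measurable M; b \<in> borel_measurable M; x \<in> carrier S\<rbrakk> \<Longrightarrow>
    scl a (scl b x) = scl (\<lambda>w. a w * b w) x"
  unfolding scl_def by (simp add: smult_assoc1[symmetric] L0_ring_carrier L0_class_in_L0 L0_ring_mult_class)

lemma scl_add_left: "\<lbrakk>a \<in> borel_measurable M; b \<in> borel_measurable M; x \<in> carrier S\<rbrakk> \<Longrightarrow>
    scl (\<lambda>w. a w + b w) x = scl a x \<oplus> scl b x"
  unfolding scl_def by (simp add: smult_l_distr[symmetric] L0_ring_carrier L0_class_in_L0 L0_ring_add_class)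

lemma scl_add_right: "\<lbrakk>a \<in> borel_measurable M; x \<in> carrier S; y \<in> carrier S\<rbrakk> \<Longrightarrow>
    scl a (x \<oplus> y) = scl a x \<oplus> scl a y"
  unfolding scl_def by (simp add: smult_r_distr L0_ring_carrier L0_class_in_L0)

lemma scl_one: "x \<in> carrier S \<Longrightarrow> scl (\<lambda>_. 1) x = x"
  unfolding scl_def using smult_one by (simp add: L0_ring_one)

lemma nm_cong_class:
  assumes "x \<in> carrier S" "rnorm S x = L0_class M f" "f \<in> borel_measurable M"
  shows "AE w in M. nm x w = \<bar>f w\<bar>"
  using L0_rep_class[OF assms(3)] unfolding assms(2)[symmetric]
  by eventually_elim (simp add: nm_def)

lemma nm_scl:
  assumes [measurable]: "a \<in> borel_measurable M" "x \<in> carrier S"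
  shows "AE w in M. nm (scl a x) w = norm (a w) * nm x w"
proof -
  have a: "L0_class M a \<in> L0 M" by (simp add: L0_class_in_L0)
  have m [measurable]: "L0_rep (L0_class M a) \<in> borel_measurable M"
    by (rule L0_rep_measurable[OF a])
  have "L0_map M norm (L0_class M a) = L0_class M (\<lambda>w. norm (a w))"
    unfolding L0_map_def using L0_rep_class[OF assms(1)]
    by (intro L0_class_cong) (auto elim!: eventually_mono)
  then have "rnorm S (scl a x) = L0_class M (\<lambda>w. norm (a w) * nm x w)"
    unfolding scl_def rnorm_smult[OF a assms(2)] rnorm_eq[OF assms(2)]
    by (simp add: L0_ring_mult_class)
  from nm_cong_class[OF scl_closed[OF assms] this] show ?thesis by (simp add: abs_mult)
qed

lemma nm_add:
  assumes [measurable]: "x \<in> carrier S" "y \<in> carrier S"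
  shows "AE w in M. nm (x \<oplus> y) w \<le> nm x w + nm y w"
proof -
  have xy: "x \<oplus> y \<in> carrier S" by (simp add: assms)
  have "AE w in M. L0_rep (rnorm S (x \<oplus> y)) w \<le> L0_rep (L0_class M (\<lambda>w. nm x w + nm y w)) w"
    using rnorm_triangle[OF assms]
    unfolding rnorm_eq[OF assms(1)] rnorm_eq[OF assms(2)] L0_le_def
    by (simp add: L0_ring_add_class)
  moreover have "AE w in M. L0_rep (L0_class M (\<lambda>w. nm x w + nm y w)) w = nm x w + nm y w"
    by (rule L0_rep_class) measurable
  ultimately show ?thesis using AE_nm[OF xy] by eventually_elim simp
qed

end

locale rn_module_subalgebra = random_normed_module M S + prob_subalgebra M F
  for M :: "'w measure" and F and S :: "('w, 'k::{real_normed_field, euclidean_space}, 's) rn_module" (structure)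

locale cond_Lp_module = rn_module_subalgebra M F S
  for M :: "'w measure" and F and S :: "('w, 'k::{real_normed_field, euclidean_space}, 's) rn_module" (structure) +
  fixes p :: real
  assumes p: "1 \<le> p"
begin

definition cpow :: "'s \<Rightarrow> 'w \<Rightarrow> ennreal" where
  "cpow x = nnE (\<lambda>v. ennreal (nm x v powr p))"

text \<open>\<open>enn2real\<close> gives 0 where \<open>cpow\<close> is infinite, so this is the
  conditional norm only on \<open>Lp\<close>; in exchange it is real-valued on all of
  \<open>S\<close>.\<close>

definition Lp_norm :: "'s \<Rightarrow> 'w \<Rightarrow> real" where
  "Lp_norm x w = enn2real (cpow x w) powr (1 / p)"

definition Lp :: "'s set" where
  "Lp = {x \<in> carrier S. AE w in M. cpow x w < \<infinity>}"

lemma Lp_carrier: "x \<in> Lp \<Longrightarrow> x \<in> carrier S"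
  by (simp add: Lp_def)

lemma cpow_measurable [measurable]: "cpow x \<in> borel_measurable F"
  unfolding cpow_def by measurable

lemma Lp_norm_measurable [measurable]: "Lp_norm x \<in> borel_measurable F"
  unfolding Lp_norm_def by measurable

lemma Lp_norm_nonneg [simp]: "0 \<le> Lp_norm x w"
  by (simp add: Lp_norm_def)

lemma cpow_eq:
  assumes "x \<in> Lp"
  shows "AE w in M. cpow x w = ennreal (Lp_norm x w powr p)"
proof -
  have "AE w in M. cpow x w < \<infinity>" using assms by (simp add: Lp_def)
  then show ?thesis
    by eventually_elim (use p in \<open>simp add: Lp_norm_def powr_powr\<close>)
qed

lemma Lp_norm_eqI: "cpow x w = ennreal (t powr p) \<Longrightarrow> 0 \<le> t \<Longrightarrow> Lp_norm x w = t"
  using p by (simp add: Lp_norm_def powr_powr)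

lemma Lp_norm_leI: "cpow x w \<le> ennreal (t powr p) \<Longrightarrow> 0 \<le> t \<Longrightarrow> Lp_norm x w \<le> t"
proof -
  assume a: "cpow x w \<le> ennreal (t powr p)" and t: "0 \<le> t"
  have "enn2real (cpow x w) \<le> t powr p"
    using enn2real_mono[OF a] by simp
  then have "enn2real (cpow x w) powr (1 / p) \<le> (t powr p) powr (1 / p)"
    using p by (intro powr_mono2) auto
  then show ?thesis using p t by (simp add: Lp_norm_def powr_powr)
qed

lemma cpow_mono:
  assumes [measurable]: "x \<in> carrier S" "y \<in> carrier S" and "AE w in M. nm x w \<le> nm y w"
  shows "AE w in M. cpow x w \<le> cpow y w"
  unfolding cpow_def
proof (rule nn_cond_exp_mono)
  show "AE w in M. ennreal (nm x w powr p) \<le> ennreal (nm y w powr p)"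
    using assms(3) by eventually_elim (use p in \<open>auto intro!: ennreal_leI powr_mono2\<close>)
qed measurable

lemma Lp_dominated:
  assumes "x \<in> carrier S" "y \<in> Lp" "AE w in M. nm x w \<le> nm y w"
  shows "x \<in> Lp" "AE w in M. Lp_norm x w \<le> Lp_norm y w"
proof -
  have c: "AE w in M. cpow x w \<le> cpow y w"
    using assms by (intro cpow_mono) (auto simp: Lp_carrier)
  have f: "AE w in M. cpow y w < \<infinity>" using assms(2) by (simp add: Lp_def)
  have "AE w in M. cpow x w < \<infinity>" using c f by eventually_elim (rule le_less_trans)
  then show "x \<in> Lp" using assms(1) by (simp add: Lp_def)
  show "AE w in M. Lp_norm x w \<le> Lp_norm y w"
    using c cpow_eq[OF assms(2)] by eventually_elim (auto intro: Lp_norm_leI)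
qed

lemma cpow_scl:
  assumes [measurable]: "a \<in> borel_measurable F" "x \<in> carrier S"
  shows "AE w in M. cpow (scl a x) w = ennreal (norm (a w) powr p) * cpow x w"
proof -
  have [measurable]: "scl a x \<in> carrier S" using assms F_measurable by simp
  have "AE w in M. cpow (scl a x) w = nnE (\<lambda>v. ennreal (norm (a v) powr p * nm x v powr p)) w"
    unfolding cpow_def
  proof (rule nn_cond_exp_cong)
    show "AE w in M. ennreal (nm (scl a x) w powr p) = ennreal (norm (a w) powr p * nm x w powr p)"
      using nm_scl[OF F_measurable[OF assms(1)] assms(2)] by eventually_elim (simp add: powr_mult)
  qed measurable
  moreover have "AE w in M. nnE (\<lambda>v. ennreal (norm (a v) powr p * nm x v powr p)) w
      = ennreal (norm (a w) powr p) * cpow x w"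
    unfolding cpow_def by (rule nn_cond_exp_F_mult) auto
  ultimately show ?thesis by eventually_elim simp
qed

lemma Lp_F_scl:
  assumes "a \<in> borel_measurable F" "x \<in> Lp"
  shows "scl a x \<in> Lp" "AE w in M. Lp_norm (scl a x) w = norm (a w) * Lp_norm x w"
proof -
  have c: "AE w in M. cpow (scl a x) w = ennreal ((norm (a w) * Lp_norm x w) powr p)"
    using cpow_scl[OF assms(1) Lp_carrier[OF assms(2)]] cpow_eq[OF assms(2)]
    by eventually_elim (simp add: powr_mult ennreal_mult')
  then have "AE w in M. cpow (scl a x) w < \<infinity>" by eventually_elim simp
  then show "scl a x \<in> Lp" using assms by (simp add: Lp_def F_measurable)
  show "AE w in M. Lp_norm (scl a x) w = norm (a w) * Lp_norm x w"
    using c by eventually_elim (rule Lp_norm_eqI, auto)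
qed

text \<open>\<open>a\<close> is only \<open>M\<close>-measurable and cannot be taken out of the
  conditional norm, so \<open>scl a x\<close> is compared with the constant multiple by
  \<open>of_real c\<close>.\<close>

lemma Lp_bounded_scl:
  assumes a: "a \<in> borel_measurable M" and x: "x \<in> Lp" and b: "AE w in M. norm (a w) \<le> c"
  shows "scl a x \<in> Lp" "AE w in M. Lp_norm (scl a x) w \<le> \<bar>c\<bar> * Lp_norm x w"
proof -
  note x' = Lp_carrier[OF x]
  have y: "scl (\<lambda>_. of_real c) x \<in> Lp" and py: "AE w in M. Lp_norm (scl (\<lambda>_. of_real c) x) w = norm (of_real c :: 'k) * Lp_norm x w"
    using Lp_F_scl[OF _ x, of "\<lambda>_. of_real c"] by auto
  have "AE w in M. nm (scl a x) w \<le> nm (scl (\<lambda>_. of_real c) x) w"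
    using nm_scl[OF a x'] nm_scl[of "\<lambda>_. of_real c", OF _ x', simplified] b
    by eventually_elim (auto intro!: mult_right_mono)
  from Lp_dominated[OF scl_closed[OF a x'] y this] py
  show "scl a x \<in> Lp" "AE w in M. Lp_norm (scl a x) w \<le> \<bar>c\<bar> * Lp_norm x w"
    by (auto elim: AE_mp[rotated])
qed

lemma Lp_bounded:
  assumes [measurable]: "x \<in> carrier S" and "AE w in M. nm x w \<le> 1"
  shows "x \<in> Lp"
proof -
  have "AE w in M. cpow x w \<le> nnE (\<lambda>_. 1) w"
    unfolding cpow_def
  proof (rule nn_cond_exp_mono)
    show "AE w in M. ennreal (nm x w powr p) \<le> 1"
      using assms(2)
    proof eventually_elim
      case (elim w)
      have "nm x w powr p \<le> 1 powr p" using elim p by (intro powr_mono2) auto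
      then show ?case by (simp add: ennreal_le_1)
    qed
  qed measurable
  moreover have "AE w in M. 1 = nnE (\<lambda>_. 1) w" by (rule nn_cond_exp_F_meas) simp
  ultimately have "AE w in M. cpow x w < \<infinity>"
    by eventually_elim (auto simp: ennreal_one_less_top intro: le_less_trans)
  then show ?thesis using assms(1) by (simp add: Lp_def)
qed

text \<open>Only finiteness is claimed, so the crude bound
  \<open>(s + t) powr p \<le> 2 powr p * (s powr p + t powr p)\<close> is enough.\<close>

lemma Lp_add:
  assumes x: "x \<in> Lp" and y: "y \<in> Lp"
  shows "x \<oplus> y \<in> Lp"
proof -
  have c [measurable]: "x \<in> carrier S" "y \<in> carrier S" "x \<oplus> y \<in> carrier S"
    using x y by (auto simp: Lp_carrier)
  let ?x = "\<lambda>w. ennreal (nm x w powr p)" and ?y = "\<lambda>w. ennreal (nm y w powr p)"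
  have "AE w in M. cpow (x \<oplus> y) w \<le> nnE (\<lambda>w. ennreal (2 powr p) * (?x w + ?y w)) w"
    unfolding cpow_def
  proof (rule nn_cond_exp_mono)
    show "AE w in M. ennreal (nm (x \<oplus> y) w powr p) \<le> ennreal (2 powr p) * (?x w + ?y w)"
      using nm_add[OF c(1,2)]
    proof eventually_elim
      case (elim w)
      let ?m = "max (nm x w) (nm y w)"
      have "nm (x \<oplus> y) w powr p \<le> (2 * ?m) powr p"
        using elim p by (intro powr_mono2) auto
      also have "\<dots> = 2 powr p * ?m powr p" by (simp add: powr_mult max_def)
      also have "\<dots> \<le> 2 powr p * (nm x w powr p + nm y w powr p)"
        by (intro mult_left_mono) (auto simp: max_def)
      finally show ?case
        by (simp add: ennreal_mult'[symmetric] ennreal_plus[symmetric] ennreal_leI del: ennreal_plus)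
    qed
  qed measurable
  moreover have "AE w in M. ennreal (2 powr p) * nnE (\<lambda>w. ?x w + ?y w) w
      = nnE (\<lambda>w. ennreal (2 powr p) * (?x w + ?y w)) w"
    by (rule nn_cond_exp_prod) measurable
  moreover have "AE w in M. cpow x w + cpow y w = nnE (\<lambda>w. ?x w + ?y w) w"
    unfolding cpow_def by (rule nn_cond_exp_sum) measurable
  moreover have "AE w in M. cpow x w < \<infinity>" "AE w in M. cpow y w < \<infinity>"
    using x y by (auto simp: Lp_def)
  ultimately have "AE w in M. cpow (x \<oplus> y) w < \<infinity>"
  proof eventually_elim
    case (elim w)
    have "ennreal (2 powr p) * (cpow x w + cpow y w) < \<infinity>"
      using elim(4,5) by (simp add: ennreal_mult_less_top)
    then show ?case using elim(1-3) by (auto intro: le_less_trans)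
  qed
  then show ?thesis using c by (simp add: Lp_def)
qed

end

section \<open>The set functions attached to a functional, and their densities\<close>

lemma powr_eps_bound:
  fixes t e p :: real
  assumes "0 \<le> t" "0 < e" "1 \<le> p"
  shows "t \<le> e + e powr (1 - p) * t powr p"
proof (cases "t \<le> e")
  case True
  then show ?thesis by (simp add: add_increasing2)
next
  case False
  then have "t = t powr (1 - p) * t powr p"
    using assms by (simp add: powr_add[symmetric])
  also have "\<dots> \<le> e powr (1 - p) * t powr p"
    using assms False by (intro mult_right_mono powr_mono2') auto
  finally show ?thesis using assms by simp
qed

text \<open>A bounded functional on \<open>Lp\<close> seen through representatives. Each law holds
  outside a null set that may depend on its arguments, so only countably many instances can be used
  at once.\<close>

locale Lp_functional = cond_Lp_module M F S p
  for M :: "'w measure" and F and S :: "('w, 'k::{real_normed_field, euclidean_space}, 's) rn_module" (structure)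
    and p :: real +
  fixes \<phi> :: "'s \<Rightarrow> 'w \<Rightarrow> 'k" and \<eta> :: "'w \<Rightarrow> real"
  assumes \<phi>_measurable [measurable]: "g \<in> Lp \<Longrightarrow> \<phi> g \<in> borel_measurable F"
    and \<phi>_add: "\<lbrakk>g \<in> Lp; h \<in> Lp\<rbrakk> \<Longrightarrow> AE w in M. \<phi> (g \<oplus> h) w = \<phi> g w + \<phi> h w"
    and \<phi>_scl: "\<lbrakk>a \<in> borel_measurable F; g \<in> Lp\<rbrakk> \<Longrightarrow> AE w in M. \<phi> (scl a g) w = a w * \<phi> g w"
    and \<eta>_measurable [measurable]: "\<eta> \<in> borel_measurable F" and \<eta>_nonneg: "\<And>w. 0 \<le> \<eta> w"
    and \<phi>_bound: "g \<in> Lp \<Longrightarrow> AE w in M. norm (\<phi> g w) \<le> \<eta> w * Lp_norm g w"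
begin

lemma indicator_scl_Lp:
  assumes "A \<in> sets M" "g \<in> Lp"
  shows "scl (indicator A) g \<in> Lp"
  using assms by (intro Lp_bounded_scl[where c = 1]) (auto simp: indicator_def)

definition wt :: "'s \<Rightarrow> 'w \<Rightarrow> real" where
  "wt g v = 1 / ((1 + \<eta> v) * (1 + Lp_norm g v))"

lemma wt_measurable [measurable]: "wt g \<in> borel_measurable F"
  unfolding wt_def by measurable

lemma wt_pos: "0 < wt g v"
  unfolding wt_def using \<eta>_nonneg[of v] Lp_norm_nonneg[of g v]
  by (intro divide_pos_pos mult_pos_pos add_pos_nonneg) auto

lemma wt_bound:
  assumes "h \<in> Lp"
  shows "AE v in M. wt g v * norm (\<phi> h v) \<le> Lp_norm h v / (1 + Lp_norm g v)"
  using \<phi>_bound[OF assms]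
proof eventually_elim
  case (elim v)
  have "wt g v * norm (\<phi> h v) \<le> wt g v * (\<eta> v * Lp_norm h v)"
    using elim wt_pos[of g v] by (intro mult_left_mono) auto
  also have "\<dots> = (\<eta> v / (1 + \<eta> v)) * (Lp_norm h v / (1 + Lp_norm g v))"
    by (simp add: wt_def)
  also have "\<dots> \<le> 1 * (Lp_norm h v / (1 + Lp_norm g v))"
    using \<eta>_nonneg[of v] by (intro mult_right_mono) (auto simp: divide_le_eq add_pos_nonneg)
  finally show ?case by simp
qed

text \<open>The \<open>F\<close>-measurable normalisation gives \<open>rho g\<close> a conditional
  expectation of at most 1 for \<open>g\<close> in \<open>Lp\<close>. Hence it is integrable even
  when \<open>nm g powr p\<close> is not.\<close>

definition rho :: "'s \<Rightarrow> 'w \<Rightarrow> real" where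
  "rho g v = (1 / (1 + Lp_norm g v)) powr p * nm g v powr p"

lemma rho_nonneg: "0 \<le> rho g v" by (simp add: rho_def)

text \<open>\<open>nm (scl (indicator A) g) powr p\<close> is \<open>nm g powr p\<close> cut to
  \<open>A\<close>. The integral of \<open>rho g\<close> over \<open>A\<close> is therefore that of
  the \<open>p\<close>-th power of the ratio which bounds the integrand of
  \<open>nu\<close>.\<close>

lemma nn_integral_rho:
  assumes g: "g \<in> Lp" and [measurable]: "A \<in> sets M"
  shows "(\<integral>\<^sup>+v. ennreal (indicator A v * rho g v) \<partial>M) = (\<integral>\<^sup>+v. ennreal ((Lp_norm (scl (indicator A) g) v / (1 + Lp_norm g v)) powr p) \<partial>M)"
proof -
  note [measurable] = Lp_carrier[OF g]
  let ?h = "scl (indicator A) g"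
  have h: "?h \<in> Lp" by (rule indicator_scl_Lp) (auto simp: g)
  note [measurable] = Lp_carrier[OF h]
  have "(\<integral>\<^sup>+v. ennreal (indicator A v * rho g v) \<partial>M) = (\<integral>\<^sup>+v. ennreal ((1 / (1 + Lp_norm g v)) powr p) * ennreal (nm ?h v powr p) \<partial>M)"
  proof (rule nn_integral_cong_AE)
    have [measurable]: "(indicator A :: 'w \<Rightarrow> 'k) \<in> borel_measurable M" by measurable
    show "AE v in M. ennreal (indicator A v * rho g v) = ennreal ((1 / (1 + Lp_norm g v)) powr p) * ennreal (nm ?h v powr p)"
      using nm_scl[OF \<open>(indicator A :: 'w \<Rightarrow> 'k) \<in> borel_measurable M\<close> Lp_carrier[OF g]]
    proof eventually_elim
      case (elim v)
      then show ?case
        by (cases "v \<in> A") (simp_all add: rho_def ennreal_mult')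
    qed
  qed
  also have "\<dots> = (\<integral>\<^sup>+v. ennreal ((1 / (1 + Lp_norm g v)) powr p) * cpow ?h v \<partial>M)"
    unfolding cpow_def by (rule nn_cond_exp_intg[symmetric]) measurable
  also have "\<dots> = (\<integral>\<^sup>+v. ennreal ((Lp_norm ?h v / (1 + Lp_norm g v)) powr p) \<partial>M)"
  proof (rule nn_integral_cong_AE)
    show "AE v in M. ennreal ((1 / (1 + Lp_norm g v)) powr p) * cpow ?h v = ennreal ((Lp_norm ?h v / (1 + Lp_norm g v)) powr p)"
      using cpow_eq[OF h]
      by eventually_elim (simp add: ennreal_mult'[symmetric] powr_mult[symmetric] add_nonneg_nonneg)
  qed
  finally show ?thesis .
qed

lemma Lp_norm_ratio_le_1:
  assumes g: "g \<in> Lp" and [measurable]: "A \<in> sets M"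
  shows "AE v in M. Lp_norm (scl (indicator A) g) v / (1 + Lp_norm g v) \<le> 1"
proof -
  have "AE v in M. Lp_norm (scl (indicator A) g) v \<le> \<bar>1\<bar> * Lp_norm g v"
    by (rule Lp_bounded_scl) (auto simp: g indicator_def)
  then show ?thesis
    by eventually_elim (simp add: divide_le_eq add_pos_nonneg)
qed

lemma integrable_rho:
  assumes g: "g \<in> Lp"
  shows "integrable M (rho g)"
proof (rule integrableI_bounded)
  note [measurable] = Lp_carrier[OF g]
  show "rho g \<in> borel_measurable M" unfolding rho_def by measurable
  have "(\<integral>\<^sup>+v. ennreal (norm (rho g v)) \<partial>M) = (\<integral>\<^sup>+v. ennreal (indicator (space M) v * rho g v) \<partial>M)"
    by (intro nn_integral_cong) (auto simp: rho_nonneg)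
  also have "\<dots> = (\<integral>\<^sup>+v. ennreal ((Lp_norm (scl (indicator (space M)) g) v / (1 + Lp_norm g v)) powr p) \<partial>M)"
    by (rule nn_integral_rho[OF g]) simp
  also have "\<dots> \<le> (\<integral>\<^sup>+v. 1 \<partial>M)"
  proof (rule nn_integral_mono_AE)
    show "AE v in M. ennreal ((Lp_norm (scl (indicator (space M)) g) v / (1 + Lp_norm g v)) powr p) \<le> 1"
      using Lp_norm_ratio_le_1[OF g, of "space M", simplified]
    proof eventually_elim
      case (elim v)
      then have "(Lp_norm (scl (indicator (space M)) g) v / (1 + Lp_norm g v)) powr p \<le> 1 powr p"
        using p by (intro powr_mono2) (auto intro!: divide_nonneg_nonneg add_nonneg_nonneg)
      then show ?case by (simp add: ennreal_le_1)
    qed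
  qed
  also have "\<dots> < \<infinity>" by (simp add: emeasure_space_1)
  finally show "(\<integral>\<^sup>+v. ennreal (norm (rho g v)) \<partial>M) < \<infinity>" .
qed

definition nu :: "'s \<Rightarrow> 'k \<Rightarrow> 'w set \<Rightarrow> real" where
  "nu g b A = (LINT v|M. wt g v * (\<phi> (scl (indicator A) g) v \<bullet> b))"

lemma nu_integrand:
  assumes g: "g \<in> Lp" and [measurable]: "A \<in> sets M" and b: "b \<in> Basis"
  shows "AE v in M. \<bar>wt g v * (\<phi> (scl (indicator A) g) v \<bullet> b)\<bar> \<le> Lp_norm (scl (indicator A) g) v / (1 + Lp_norm g v)"
    and "integrable M (\<lambda>v. wt g v * (\<phi> (scl (indicator A) g) v \<bullet> b))"
proof -
  let ?h = "scl (indicator A) g"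
  have h: "?h \<in> Lp" by (rule indicator_scl_Lp) (auto simp: g)
  note [measurable] = \<phi>_measurable[OF h]
  show *: "AE v in M. \<bar>wt g v * (\<phi> ?h v \<bullet> b)\<bar> \<le> Lp_norm ?h v / (1 + Lp_norm g v)"
    using wt_bound[OF h, of g]
  proof eventually_elim
    case (elim v)
    have "\<bar>wt g v * (\<phi> ?h v \<bullet> b)\<bar> = wt g v * \<bar>\<phi> ?h v \<bullet> b\<bar>"
      using wt_pos[of g v] by (simp add: abs_mult)
    also have "\<dots> \<le> wt g v * norm (\<phi> ?h v)"
      using wt_pos[of g v] b by (intro mult_left_mono Basis_le_norm) auto
    finally show ?case using elim by simp
  qed
  have "AE v in M. norm (wt g v * (\<phi> ?h v \<bullet> b)) \<le> 1"
    using * Lp_norm_ratio_le_1[OF g \<open>A \<in> sets M\<close>] by eventually_elim simp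
  then show "integrable M (\<lambda>v. wt g v * (\<phi> ?h v \<bullet> b))"
    by (rule integrable_const_bound) measurable
qed

lemma nu_ac: 
  assumes g: "g \<in> Lp" and b: "b \<in> Basis"
  shows "ac_set_function M (nu g b) (rho g)"
proof
  note gc = Lp_carrier[OF g]
  show "integrable M (rho g)" by (rule integrable_rho[OF g])
  show "0 \<le> rho g v" for v by (rule rho_nonneg)
  fix A B assume A [measurable]: "A \<in> sets M" and B [measurable]: "B \<in> sets M" and d: "A \<inter> B = {}"
  have "scl (indicator (A \<union> B)) g = scl (indicator A) g \<oplus> scl (indicator B) g"
  proof -
    have "(indicator (A \<union> B) :: 'w \<Rightarrow> 'k) = (\<lambda>v. indicator A v + indicator B v)"
      using d by (auto simp: indicator_def fun_eq_iff)
    then show ?thesis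
      using scl_add_left[OF _ _ gc, of "indicator A" "indicator B"] by simp
  qed
  then have "AE v in M. \<phi> (scl (indicator (A \<union> B)) g) v = \<phi> (scl (indicator A) g) v + \<phi> (scl (indicator B) g) v"
    using \<phi>_add[OF indicator_scl_Lp[OF A g] indicator_scl_Lp[OF B g]] by simp
  then have ae: "AE v in M. wt g v * (\<phi> (scl (indicator (A \<union> B)) g) v \<bullet> b) =
      wt g v * (\<phi> (scl (indicator A) g) v \<bullet> b) + wt g v * (\<phi> (scl (indicator B) g) v \<bullet> b)"
    by eventually_elim (simp add: inner_add_left distrib_left)
  have "nu g b (A \<union> B) = (LINT v|M. wt g v * (\<phi> (scl (indicator A) g) v \<bullet> b) + wt g v * (\<phi> (scl (indicator B) g) v \<bullet> b))"
    unfolding nu_def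
    by (intro integral_cong_AE[OF _ _ ae] borel_measurable_add borel_measurable_integrable nu_integrand(2) g b)
      (simp_all add: A B)
  then show "nu g b (A \<union> B) = nu g b A + nu g b B"
    unfolding nu_def using nu_integrand(2)[OF g _ b] by simp
next
  fix e :: real assume e: "0 < e"
  \<comment> \<open>The constant comes from \<open>powr_eps_bound\<close>, which trades the ratio
    \<open>?P\<close> for its \<open>p\<close>-th power at the cost of \<open>e\<close>; the
    integral of that power is the integral of \<open>rho g\<close> over \<open>A\<close>.\<close>
  show "\<exists>C\<ge>0. \<forall>A\<in>sets M. \<bar>nu g b A\<bar> \<le> e + C * (LINT x:A|M. rho g x)"
  proof (intro exI[of _ "e powr (1 - p)"] conjI ballI)
    fix A assume A [measurable]: "A \<in> sets M"
    let ?P = "\<lambda>v. Lp_norm (scl (indicator A) g) v / (1 + Lp_norm g v)"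
    have P0: "0 \<le> ?P v" for v by (auto intro!: divide_nonneg_nonneg add_nonneg_nonneg)
    have iA: "integrable M (\<lambda>v. indicator A v * rho g v)"
      using integrable_mult_indicator[OF A integrable_rho[OF g]] by simp
    have nnP: "(\<integral>\<^sup>+v. ennreal (?P v powr p) \<partial>M) = ennreal (LINT v|M. indicator A v * rho g v)"
      unfolding nn_integral_rho[OF g A, symmetric]
      by (rule nn_integral_eq_integral[OF iA]) (auto simp: rho_nonneg)
    have iP: "integrable M (\<lambda>v. ?P v powr p)"
      by (rule integrableI_bounded) (auto simp: nnP)
    have "\<bar>nu g b A\<bar> \<le> (LINT v|M. \<bar>wt g v * (\<phi> (scl (indicator A) g) v \<bullet> b)\<bar>)"
      unfolding nu_def by (rule integral_abs_bound)
    also have "\<dots> \<le> (LINT v|M. e + e powr (1 - p) * ?P v powr p)"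
    proof (rule integral_mono_AE)
      show "AE v in M. \<bar>wt g v * (\<phi> (scl (indicator A) g) v \<bullet> b)\<bar> \<le> e + e powr (1 - p) * ?P v powr p"
        using nu_integrand(1)[OF g A b]
      proof eventually_elim
        case (elim v)
        with powr_eps_bound[OF P0 e p, of v] show ?case by linarith
      qed
    qed (use nu_integrand(2)[OF g A b] iP in auto)
    also have "\<dots> = e + e powr (1 - p) * (LINT v|M. ?P v powr p)"
      using iP by (simp add: prob_space)
    also have "(LINT v|M. ?P v powr p) = (LINT x:A|M. rho g x)"
      unfolding set_lebesgue_integral_def
      using nnP nn_integral_eq_integral[OF iP]
      by (simp add: rho_nonneg integral_nonneg_AE)
    finally show "\<bar>nu g b A\<bar> \<le> e + e powr (1 - p) * (LINT x:A|M. rho g x)" .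
  qed simp
qed

text \<open>The Radon-Nikodym densities of the coordinates combine to a density \<open>Y0\<close> of
  the weighted functional. Dividing by the \<open>F\<close>-measurable weight removes it, at the
  price of mere conditional integrability.\<close>

lemma density_exists:
  assumes g: "g \<in> Lp"
  obtains Y where "cond_integrable Y"
    "\<And>A. A \<in> sets M \<Longrightarrow> AE v in M. condE (\<lambda>v. indicator A v *\<^sub>R Y v) v = \<phi> (scl (indicator A) g) v"
proof -
  note gc = Lp_carrier[OF g]
  have "\<exists>h. integrable M h \<and> (\<forall>A\<in>sets M. nu g b A = (LINT x:A|M. h x))" if "b \<in> Basis" for b
    using ac_set_function.Radon_Nikodym_signed[OF nu_ac[OF g that]] by metis
  then obtain h where h: "\<And>b. b \<in> Basis \<Longrightarrow> integrable M (h b)"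
    "\<And>b A. b \<in> Basis \<Longrightarrow> A \<in> sets M \<Longrightarrow> nu g b A = (LINT x:A|M. h b x)"
    by metis
  define Y0 :: "'w \<Rightarrow> 'k" where "Y0 v = (\<Sum>b\<in>Basis. h b v *\<^sub>R b)" for v
  have Y0: "integrable M Y0"
    unfolding Y0_def using h(1) by (intro Bochner_Integration.integrable_sum integrable_scaleR_left)
  have Y0b: "Y0 v \<bullet> b = h b v" if "b \<in> Basis" for b v
    using that by (simp add: Y0_def inner_sum_left inner_Basis if_distrib cong: if_cong)
  have ce: "AE v in M. condE (\<lambda>v. indicator A v *\<^sub>R Y0 v) v = of_real (wt g v) * \<phi> (scl (indicator A) g) v"
    if A [measurable]: "A \<in> sets M" for A
  proof (rule cond_exp_eqI)
    fix b :: 'k assume b: "b \<in> Basis"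
    have "AE v in M. realE (\<lambda>v. indicator A v * h b v) v = wt g v * (\<phi> (scl (indicator A) g) v \<bullet> b)"
    proof (rule real_cond_exp_charact)
      show "integrable M (\<lambda>v. indicator A v * h b v)"
        using integrable_mult_indicator[OF A h(1)[OF b]] by simp
      show "integrable M (\<lambda>v. wt g v * (\<phi> (scl (indicator A) g) v \<bullet> b))"
        by (rule nu_integrand(2)[OF g A b])
      show "(\<lambda>v. wt g v * (\<phi> (scl (indicator A) g) v \<bullet> b)) \<in> borel_measurable F"
        using \<phi>_measurable[OF indicator_scl_Lp[OF A g]] by measurable
      fix C assume C: "C \<in> sets F"
      then have [measurable]: "C \<in> sets F" "C \<in> sets M" by measurable
      have "(LINT v:C|M. indicator A v * h b v) = (LINT v:(C \<inter> A)|M. h b v)"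
        unfolding set_lebesgue_integral_def by (intro Bochner_Integration.integral_cong) (auto simp: indicator_def)
      also have "\<dots> = nu g b (C \<inter> A)" using h(2)[OF b, of "C \<inter> A"] by simp
      also have "\<dots> = (LINT v:C|M. wt g v * (\<phi> (scl (indicator A) g) v \<bullet> b))"
        unfolding nu_def set_lebesgue_integral_def
      proof (rule integral_cong_AE)
        \<comment> \<open>Homogeneity of \<open>\<phi>\<close> for the scalar
          \<open>indicator C\<close>, with \<open>C\<close> in \<open>F\<close>, localises the
          identity of integrals to \<open>C\<close> and so makes it one of conditional
          expectations.\<close>
        have "scl (indicator (C \<inter> A)) g = scl (indicator C) (scl (indicator A) g)"
        proof -
          have "(indicator (C \<inter> A) :: 'w \<Rightarrow> 'k) = (\<lambda>v. indicator C v * indicator A v)"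
            by (auto simp: indicator_def fun_eq_iff)
          then show ?thesis by (simp add: scl_scl gc)
        qed
        then have "AE v in M. \<phi> (scl (indicator (C \<inter> A)) g) v = indicator C v * \<phi> (scl (indicator A) g) v"
          using \<phi>_scl[OF _ indicator_scl_Lp[OF A g], of "indicator C"] by simp
        then show "AE v in M. wt g v * (\<phi> (scl (indicator (C \<inter> A)) g) v \<bullet> b) = indicat_real C v *\<^sub>R (wt g v * (\<phi> (scl (indicator A) g) v \<bullet> b))"
          by eventually_elim (auto simp: indicator_def)
        show "(\<lambda>v. wt g v * (\<phi> (scl (indicator (C \<inter> A)) g) v \<bullet> b)) \<in> borel_measurable M"
          using nu_integrand(2)[OF g _ b, of "C \<inter> A"] by simp
        show "(\<lambda>v. indicat_real C v *\<^sub>R (wt g v * (\<phi> (scl (indicator A) g) v \<bullet> b))) \<in> borel_measurable M"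
          using nu_integrand(2)[OF g A b] by (intro borel_measurable_scaleR) auto
      qed
      finally show "(LINT v:C|M. indicator A v * h b v) = (LINT v:C|M. wt g v * (\<phi> (scl (indicator A) g) v \<bullet> b))" .
    qed
    then show "AE v in M. realE (\<lambda>v. (indicat_real A v *\<^sub>R Y0 v) \<bullet> b) v = (of_real (wt g v) * \<phi> (scl (indicator A) g) v) \<bullet> b"
      by (simp add: Y0b b scaleR_conv_of_real[symmetric])
  qed
  have mi: "(\<lambda>v. of_real (1 / wt g v) :: 'k) \<in> borel_measurable F" by measurable
  show ?thesis
  proof
    show "cond_integrable (\<lambda>v. of_real (1 / wt g v) * Y0 v)"
      by (rule cond_integrable_F_mult[OF integrable_cond_integrable[OF Y0] mi])
    fix A assume A: "A \<in> sets M"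
    have i: "cond_integrable (\<lambda>v. indicator A v *\<^sub>R Y0 v)"
      by (intro integrable_cond_integrable integrable_mult_indicator A Y0)
    have "AE v in M. condE (\<lambda>v. of_real (1 / wt g v) * (indicator A v *\<^sub>R Y0 v)) v
      = of_real (1 / wt g v) * condE (\<lambda>v. indicator A v *\<^sub>R Y0 v) v"
      by (rule cond_exp_mult[OF i mi])
    with ce[OF A] show "AE v in M. condE (\<lambda>v. indicator A v *\<^sub>R (of_real (1 / wt g v) * Y0 v)) v = \<phi> (scl (indicator A) g) v"
    proof eventually_elim
      case (elim v)
      then show ?case using wt_pos[of g v] by (simp add: less_imp_neq[symmetric])
    qed
  qed
qed

end

section \<open>Representation of bounded functionals\<close>

context prob_subalgebra
begin

lemma cond_integrable_bounded_mult:
  fixes h :: "'w \<Rightarrow> 'b::{real_normed_field, euclidean_space}"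
  assumes h: "cond_integrable h" and [measurable]: "a \<in> borel_measurable M" and b: "AE w in M. norm (a w) \<le> c"
  shows "cond_integrable (\<lambda>w. a w * h w)"
proof (rule cond_integrable_dominated)
  note [measurable] = cond_integrable_measurable[OF h]
  show "cond_integrable (\<lambda>w. of_real \<bar>c\<bar> * h w)" by (rule cond_integrable_F_mult[OF h]) simp
  show "AE w in M. norm (a w * h w) \<le> norm (of_real \<bar>c\<bar> * h w)"
    using b by eventually_elim (auto simp: norm_mult intro!: mult_right_mono)
  show "(\<lambda>w. a w * h w) \<in> borel_measurable M" by measurable
qed

lemma cond_exp_bounded_mult_le:
  fixes h :: "'w \<Rightarrow> 'b::{real_normed_field, euclidean_space}"
  assumes h: "cond_integrable h" and [measurable]: "a \<in> borel_measurable M"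
    and b: "AE w in M. norm (a w) \<le> c" and c: "0 \<le> c"
  shows "AE w in M. norm (condE (\<lambda>w. a w * h w) w) \<le> c * enn2real (nnE (\<lambda>w. ennreal (norm (h w))) w)"
proof -
  note [measurable] = cond_integrable_measurable[OF h]
  have "AE w in M. nnE (\<lambda>w. ennreal (norm (a w * h w))) w \<le> nnE (\<lambda>w. ennreal (c * norm (h w))) w"
  proof (rule nn_cond_exp_mono)
    show "AE w in M. ennreal (norm (a w * h w)) \<le> ennreal (c * norm (h w))"
      using b by eventually_elim (auto simp: norm_mult intro!: ennreal_leI mult_right_mono)
  qed measurable
  moreover have "AE w in M. nnE (\<lambda>w. ennreal (c * norm (h w))) w = ennreal c * nnE (\<lambda>w. ennreal (norm (h w))) w"
    by (rule nn_cond_exp_F_mult) (auto simp: c)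
  moreover have "AE w in M. nnE (\<lambda>w. ennreal (norm (h w))) w < \<infinity>"
    using h by (simp add: cond_integrable_def)
  moreover have "AE w in M. ennreal (norm (condE (\<lambda>w. a w * h w) w)) \<le> nnE (\<lambda>w. ennreal (norm (a w * h w))) w"
    by (rule cond_exp_norm_le[OF cond_integrable_bounded_mult[OF h _ b]]) measurable
  ultimately show ?thesis
  proof eventually_elim
    case (elim w)
    let ?r = "enn2real (nnE (\<lambda>w. ennreal (norm (h w))) w)"
    have "nnE (\<lambda>w. ennreal (norm (h w))) w = ennreal ?r" using elim(3) by simp
    with elim have "ennreal (norm (condE (\<lambda>w. a w * h w) w)) \<le> ennreal c * ennreal ?r" by simp
    also have "\<dots> = ennreal (c * ?r)" using c by (simp add: ennreal_mult')
    finally show ?case using c by (simp add: ennreal_le_iff)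
  qed
qed

end

context Lp_functional
begin

definition is_density :: "'s \<Rightarrow> ('w \<Rightarrow> 'k) \<Rightarrow> bool" where
  "is_density g Y \<longleftrightarrow> cond_integrable Y \<and>
    (\<forall>A\<in>sets M. AE v in M. condE (\<lambda>v. indicator A v *\<^sub>R Y v) v = \<phi> (scl (indicator A) g) v)"

text \<open>The bounded multipliers for which the density identity, given for indicators, persists.
  They are closed under sums, constant multiples and uniform limits, so every bounded measurable
  function is among them.\<close>

definition represents :: "'s \<Rightarrow> ('w \<Rightarrow> 'k) \<Rightarrow> ('w \<Rightarrow> 'k) \<Rightarrow> bool" where
  "represents g Y a \<longleftrightarrow> a \<in> borel_measurable M \<and> (\<exists>c. AE w in M. norm (a w) \<le> c) \<and>
    (AE w in M. condE (\<lambda>w. a w * Y w) w = \<phi> (scl a g) w)"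

context
  fixes g Y assumes g: "g \<in> Lp" and Y: "is_density g Y"
begin

lemma density_ci: "cond_integrable Y"
  using Y by (simp add: is_density_def)

lemma represents_indicator:
  assumes "A \<in> sets M"
  shows "represents g Y (indicator A)"
proof -
  have "(\<lambda>v. indicator A v *\<^sub>R Y v) = (\<lambda>v. indicator A v * Y v)"
    by (auto simp: indicator_def fun_eq_iff)
  then have "AE w in M. condE (\<lambda>w. indicator A w * Y w) w = \<phi> (scl (indicator A) g) w"
    using Y assms unfolding is_density_def by metis
  moreover have "\<exists>c. AE w in M. norm (indicator A w :: 'k) \<le> c"
    by (rule exI[of _ 1]) (auto simp: indicator_def)
  ultimately show ?thesis using assms unfolding represents_def by simp
qed

lemma represents_add:
  assumes "represents g Y a" "represents g Y b"
  shows "represents g Y (\<lambda>w. a w + b w)"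
proof -
  have [measurable]: "a \<in> borel_measurable M" "b \<in> borel_measurable M"
    using assms by (auto simp: represents_def)
  obtain c d where c: "AE w in M. norm (a w) \<le> c" and d: "AE w in M. norm (b w) \<le> d"
    using assms by (auto simp: represents_def)
  have "AE w in M. norm (a w + b w) \<le> c + d"
    using c d by eventually_elim (auto intro: norm_triangle_le)
  moreover have "AE w in M. condE (\<lambda>w. (a w + b w) * Y w) w = \<phi> (scl (\<lambda>w. a w + b w) g) w"
  proof -
    have "AE w in M. condE (\<lambda>w. a w * Y w + b w * Y w) w = condE (\<lambda>w. a w * Y w) w + condE (\<lambda>w. b w * Y w) w"
      by (intro cond_exp_add cond_integrable_bounded_mult[OF density_ci _ c] cond_integrable_bounded_mult[OF density_ci _ d]) measurable
    moreover have "AE w in M. \<phi> (scl a g \<oplus> scl b g) w = \<phi> (scl a g) w + \<phi> (scl b g) w"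
      by (intro \<phi>_add Lp_bounded_scl(1)[OF _ g c] Lp_bounded_scl(1)[OF _ g d]) measurable
    moreover have "AE w in M. condE (\<lambda>w. a w * Y w) w = \<phi> (scl a g) w"
      "AE w in M. condE (\<lambda>w. b w * Y w) w = \<phi> (scl b g) w"
      using assms by (auto simp: represents_def)
    ultimately show ?thesis
      unfolding distrib_right scl_add_left[OF \<open>a \<in> borel_measurable M\<close> \<open>b \<in> borel_measurable M\<close> Lp_carrier[OF g]]
      by eventually_elim simp
  qed
  ultimately show ?thesis unfolding represents_def by (auto simp del: distrib_right)
qed

lemma represents_cmult:
  assumes "represents g Y a"
  shows "represents g Y (\<lambda>w. k * a w)"
proof -
  have [measurable]: "a \<in> borel_measurable M" using assms by (auto simp: represents_def)
  obtain c where c: "AE w in M. norm (a w) \<le> c" using assms by (auto simp: represents_def)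
  have "AE w in M. norm (k * a w) \<le> norm k * c"
    using c by eventually_elim (auto simp: norm_mult intro: mult_left_mono)
  moreover have "AE w in M. condE (\<lambda>w. (k * a w) * Y w) w = \<phi> (scl (\<lambda>w. k * a w) g) w"
  proof -
    have "AE w in M. condE (\<lambda>w. k * (a w * Y w)) w = k * condE (\<lambda>w. a w * Y w) w"
      by (intro cond_exp_mult cond_integrable_bounded_mult[OF density_ci _ c]) measurable
    moreover have "AE w in M. \<phi> (scl (\<lambda>_. k) (scl a g)) w = k * \<phi> (scl a g) w"
      by (intro \<phi>_scl Lp_bounded_scl(1)[OF _ g c]) measurable
    moreover have "AE w in M. condE (\<lambda>w. a w * Y w) w = \<phi> (scl a g) w"
      using assms by (auto simp: represents_def)
    moreover have "scl (\<lambda>w. k * a w) g = scl (\<lambda>_. k) (scl a g)"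
      by (simp add: scl_scl Lp_carrier[OF g])
    ultimately show ?thesis
      by (elim AE_mp) (simp add: mult.assoc)
  qed
  ultimately show ?thesis unfolding represents_def by auto
qed

lemma represents_sum:
  assumes "finite I" "\<And>i. i \<in> I \<Longrightarrow> represents g Y (a i)"
  shows "represents g Y (\<lambda>w. \<Sum>i\<in>I. a i w)"
  using assms
proof induction
  case empty
  have "(\<lambda>w. 0) = (indicator {} :: 'w \<Rightarrow> 'k)" by auto
  then show ?case using represents_indicator[of "{}"] by simp
next
  case (insert i I)
  then show ?case by (simp add: represents_add)
qed

text \<open>Replacing \<open>an n\<close> by \<open>a\<close> changes the conditional expectation by
  at most \<open>1 / (n + 1)\<close> times that of \<open>norm (Y w)\<close>, and
  \<open>\<phi>\<close> by at most \<open>1 / (n + 1)\<close> times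
  \<open>\<eta> w * Lp_norm g w\<close>.\<close>

lemma represents_limit:
  assumes an: "\<And>n. represents g Y (an n)" and a [measurable]: "a \<in> borel_measurable M"
    and lim: "\<And>n. AE w in M. norm (a w - an n w) \<le> 1 / real (Suc n)"
  shows "represents g Y a"
proof -
  have [measurable]: "an n \<in> borel_measurable M" for n using an by (auto simp: represents_def)
  obtain c where c: "AE w in M. norm (an 0 w) \<le> c" using an[of 0] by (auto simp: represents_def)
  have bd: "AE w in M. norm (a w) \<le> c + 1"
    using c lim[of 0]
  proof eventually_elim
    case (elim w)
    have "norm (a w) \<le> norm (an 0 w) + norm (a w - an 0 w)"
      using norm_triangle_ineq[of "an 0 w" "a w - an 0 w"] by simp
    with elim show ?case by simp
  qed
  let ?N = "\<lambda>w. enn2real (nnE (\<lambda>w. ennreal (norm (Y w))) w)"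
  have "AE w in M. norm (condE (\<lambda>w. a w * Y w) w - \<phi> (scl a g) w) \<le> 1 / real (Suc n) * (?N w + \<eta> w * Lp_norm g w)" for n
  proof -
    define d where "d w = a w - an n w" for w
    have [measurable]: "d \<in> borel_measurable M" unfolding d_def by measurable
    have d: "AE w in M. norm (d w) \<le> 1 / real (Suc n)" using lim[of n] by (simp add: d_def)
    obtain c' where c': "AE w in M. norm (an n w) \<le> c'" using an[of n] by (auto simp: represents_def)
    have "AE w in M. condE (\<lambda>w. an n w * Y w + d w * Y w) w = condE (\<lambda>w. an n w * Y w) w + condE (\<lambda>w. d w * Y w) w"
      by (intro cond_exp_add cond_integrable_bounded_mult[OF density_ci _ c'] cond_integrable_bounded_mult[OF density_ci _ d]) measurable
    moreover have "(\<lambda>w. an n w * Y w + d w * Y w) = (\<lambda>w. a w * Y w)"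
      by (simp add: d_def algebra_simps)
    moreover have dL: "scl d g \<in> Lp" by (rule Lp_bounded_scl(1)[OF _ g d]) measurable
    then have "AE w in M. \<phi> (scl (an n) g \<oplus> scl d g) w = \<phi> (scl (an n) g) w + \<phi> (scl d g) w"
      by (intro \<phi>_add Lp_bounded_scl(1)[OF _ g c']) measurable
    moreover have "scl (an n) g \<oplus> scl d g = scl a g"
      by (simp add: scl_add_left[symmetric] Lp_carrier[OF g] d_def)
    moreover have "AE w in M. condE (\<lambda>w. an n w * Y w) w = \<phi> (scl (an n) g) w"
      using an[of n] by (auto simp: represents_def)
    moreover have "AE w in M. norm (\<phi> (scl d g) w) \<le> \<eta> w * Lp_norm (scl d g) w"
      by (rule \<phi>_bound[OF dL])
    moreover have "AE w in M. Lp_norm (scl d g) w \<le> \<bar>1 / real (Suc n)\<bar> * Lp_norm g w"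
      by (rule Lp_bounded_scl(2)[OF _ g d]) measurable
    moreover have "AE w in M. norm (condE (\<lambda>w. d w * Y w) w) \<le> 1 / real (Suc n) * ?N w"
      by (rule cond_exp_bounded_mult_le[OF density_ci _ d]) auto
    ultimately show ?thesis
    proof (elim AE_mp, intro AE_I2 impI, goal_cases)
      case (1 w)
      have "condE (\<lambda>w. a w * Y w) w - \<phi> (scl a g) w = condE (\<lambda>w. d w * Y w) w - \<phi> (scl d g) w"
        using 1 by simp
      also have "norm \<dots> \<le> norm (condE (\<lambda>w. d w * Y w) w) + norm (\<phi> (scl d g) w)"
        by (rule norm_triangle_ineq4)
      also have "norm (\<phi> (scl d g) w) \<le> \<eta> w * (1 / real (Suc n) * Lp_norm g w)"
      proof -
        have "norm (\<phi> (scl d g) w) \<le> \<eta> w * Lp_norm (scl d g) w" using 1 by blast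
        also have "Lp_norm (scl d g) w \<le> 1 / real (Suc n) * Lp_norm g w" using 1 by simp
        finally show ?thesis using \<eta>_nonneg[of w] by (simp add: mult_left_mono)
      qed
      also have "norm (condE (\<lambda>w. d w * Y w) w) \<le> 1 / real (Suc n) * ?N w" using 1 by simp
      finally show ?case by (simp add: algebra_simps add_divide_distrib)
    qed
  qed
  then have "AE w in M. \<forall>n. norm (condE (\<lambda>w. a w * Y w) w - \<phi> (scl a g) w) \<le> 1 / real (Suc n) * (?N w + \<eta> w * Lp_norm g w)"
    by (simp add: AE_all_countable)
  then have "AE w in M. condE (\<lambda>w. a w * Y w) w = \<phi> (scl a g) w"
  proof eventually_elim
    case (elim w)
    have "(\<lambda>n. 1 / real (Suc n) * (?N w + \<eta> w * Lp_norm g w)) \<longlonglongrightarrow> 0 * (?N w + \<eta> w * Lp_norm g w)"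
      by (intro tendsto_intros LIMSEQ_Suc[OF lim_1_over_n])
    from LIMSEQ_le_const[OF this] elim
    have "norm (condE (\<lambda>w. a w * Y w) w - \<phi> (scl a g) w) \<le> 0 * (?N w + \<eta> w * Lp_norm g w)" by blast
    then show ?case by simp
  qed
  with bd show ?thesis by (auto simp: represents_def a)
qed

lemma represents_real:
  assumes \<alpha> [measurable]: "\<alpha> \<in> borel_measurable M" and c: "\<And>w. \<bar>\<alpha> w\<bar> \<le> c"
  shows "represents g Y (\<lambda>w. of_real (\<alpha> w))"
proof (rule represents_limit)
  define A where "A n k = {w \<in> space M. \<lfloor>real (Suc n) * \<alpha> w\<rfloor> = k}" for n k
  \<comment> \<open>A floor may lie up to 1 below a number that is itself as low as
    \<open>- (n + 1) c\<close>; the extra 1 makes the finite range cover it.\<close>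
  define K where "K n = \<lceil>real (Suc n) * c\<rceil> + 1" for n
  define an :: "nat \<Rightarrow> 'w \<Rightarrow> 'k" where
    "an n w = (\<Sum>k\<in>{- K n..K n}. of_real (real_of_int k / real (Suc n)) * indicator (A n k) w)" for n w
  have [measurable]: "A n k \<in> sets M" for n k unfolding A_def by measurable
  show "represents g Y (an n)" for n
    unfolding an_def by (intro represents_sum represents_cmult represents_indicator) auto
  show "(\<lambda>w. of_real (\<alpha> w) :: 'k) \<in> borel_measurable M" by measurable
  show "AE w in M. norm (of_real (\<alpha> w) - an n w) \<le> 1 / real (Suc n)" for n
  proof (rule AE_I2)
    fix w assume w: "w \<in> space M"
    let ?k = "\<lfloor>real (Suc n) * \<alpha> w\<rfloor>"
    have "\<bar>real (Suc n) * \<alpha> w\<bar> \<le> real (Suc n) * c"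
      unfolding abs_mult using c[of w] by (intro mult_mono) auto
    then have k: "?k \<in> {- K n..K n}" unfolding K_def by (simp, linarith)
    have "an n w = (\<Sum>k\<in>{- K n..K n}. if k = ?k then of_real (real_of_int k / real (Suc n)) else 0)"
      unfolding an_def using w by (intro sum.cong) (auto simp: A_def indicator_def)
    also have "\<dots> = of_real (real_of_int ?k / real (Suc n))" using k by simp
    finally have "norm (of_real (\<alpha> w) - an n w) = \<bar>\<alpha> w - real_of_int ?k / real (Suc n)\<bar>"
      by (simp only: norm_of_real of_real_diff[symmetric])
    also have "\<dots> = \<bar>real (Suc n) * \<alpha> w - real_of_int ?k\<bar> / real (Suc n)"
    proof -
      have "\<alpha> w - real_of_int ?k / real (Suc n) = (real (Suc n) * \<alpha> w - real_of_int ?k) / real (Suc n)"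
        by (simp add: diff_divide_distrib del: of_nat_Suc)
      then show ?thesis by (simp only: abs_divide abs_of_nat)
    qed
    also have "\<dots> \<le> 1 / real (Suc n)"
      by (intro divide_right_mono) linarith+
    finally show "norm (of_real (\<alpha> w) - an n w) \<le> 1 / real (Suc n)" .
  qed
qed

lemma represents_bounded:
  assumes a [measurable]: "a \<in> borel_measurable M" and c: "\<And>w. norm (a w) \<le> c"
  shows "represents g Y a"
proof -
  have "a = (\<lambda>w. \<Sum>b\<in>Basis. b * of_real (a w \<bullet> b))"
    by (rule ext) (simp add: mult.commute[of _ "of_real _"] scaleR_conv_of_real[symmetric] euclidean_representation)
  moreover have "represents g Y (\<lambda>w. \<Sum>b\<in>Basis. b * of_real (a w \<bullet> b))"
    by (intro represents_sum represents_cmult represents_real[where c = c])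
      (auto intro: order_trans[OF Basis_le_norm c])
  ultimately show ?thesis by simp
qed

end

definition dens :: "'s \<Rightarrow> 'w \<Rightarrow> 'k" where
  "dens g = (SOME Y. is_density g Y)"

lemma is_density_dens:
  assumes "g \<in> Lp"
  shows "is_density g (dens g)"
proof -
  obtain Y where "is_density g Y"
    using density_exists[OF assms] unfolding is_density_def by metis
  then show ?thesis unfolding dens_def by (rule someI[of "is_density g"])
qed

lemma dens_ci: "g \<in> Lp \<Longrightarrow> cond_integrable (dens g)"
  using is_density_dens by (simp add: is_density_def)

lemma dens_measurable [measurable]: "g \<in> Lp \<Longrightarrow> dens g \<in> borel_measurable M"
  using dens_ci by (rule cond_integrable_measurable)

lemma dens_bounded:
  assumes "g \<in> Lp" "a \<in> borel_measurable M" "\<And>w. norm (a w) \<le> c"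
  shows "AE w in M. condE (\<lambda>w. a w * dens g w) w = \<phi> (scl a g) w"
  using represents_bounded[OF assms(1) is_density_dens[OF assms(1)] assms(2,3)] by (simp add: represents_def)

text \<open>Makes the choice in \<open>dens\<close> harmless: a law for \<open>dens\<close> is
  proved by checking that the expected expression is a density.\<close>

lemma dens_unique:
  assumes g: "g \<in> Lp" and Z: "is_density g Z"
  shows "AE w in M. Z w = dens g w"
proof (rule cond_exp_unique)
  show "cond_integrable Z" "cond_integrable (dens g)" using Z dens_ci[OF g] by (auto simp: is_density_def)
  fix A assume "A \<in> sets M"
  then have "AE v in M. condE (\<lambda>v. indicator A v *\<^sub>R Z v) v = \<phi> (scl (indicator A) g) v"
    "AE v in M. condE (\<lambda>v. indicator A v *\<^sub>R dens g v) v = \<phi> (scl (indicator A) g) v"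
    using Z is_density_dens[OF g] by (auto simp: is_density_def)
  then show "AE v in M. condE (\<lambda>v. indicator A v *\<^sub>R Z v) v = condE (\<lambda>v. indicator A v *\<^sub>R dens g v) v"
    by eventually_elim simp
qed

lemma dens_scl:
  assumes g: "g \<in> Lp" and [measurable]: "a \<in> borel_measurable M" and c: "\<And>w. norm (a w) \<le> c"
  shows "AE w in M. dens (scl a g) w = a w * dens g w"
proof -
  have gL: "scl a g \<in> Lp" using c by (intro Lp_bounded_scl(1)[OF _ g]) auto
  have "is_density (scl a g) (\<lambda>w. a w * dens g w)"
    unfolding is_density_def
  proof (intro conjI ballI)
    show "cond_integrable (\<lambda>w. a w * dens g w)"
      using c by (intro cond_integrable_bounded_mult[OF dens_ci[OF g]]) auto
    fix A assume [measurable]: "A \<in> sets M"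
    have "norm (indicator A w * a w) \<le> max 0 c" for w
      using c[of w] by (auto simp: indicator_def)
    from dens_bounded[OF g _ this]
    have "AE v in M. condE (\<lambda>v. (indicator A v * a v) * dens g v) v = \<phi> (scl (\<lambda>v. indicator A v * a v) g) v"
      by measurable
    moreover have "(\<lambda>v. (indicator A v * a v) * dens g v) = (\<lambda>v. indicator A v *\<^sub>R (a v * dens g v))"
      by (auto simp: indicator_def fun_eq_iff)
    ultimately show "AE v in M. condE (\<lambda>v. indicator A v *\<^sub>R (a v * dens g v)) v = \<phi> (scl (indicator A) (scl a g)) v"
      by (simp add: scl_scl Lp_carrier[OF g])
  qed
  from dens_unique[OF gL this] show ?thesis by eventually_elim simp
qed

lemma dens_add:
  assumes g: "g \<in> Lp" and h: "h \<in> Lp"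
  shows "AE w in M. dens (g \<oplus> h) w = dens g w + dens h w"
proof -
  have "is_density (g \<oplus> h) (\<lambda>w. dens g w + dens h w)"
    unfolding is_density_def
  proof (intro conjI ballI)
    show "cond_integrable (\<lambda>w. dens g w + dens h w)" by (intro cond_integrable_add dens_ci g h)
    fix A assume A [measurable]: "A \<in> sets M"
    have ci: "cond_integrable (\<lambda>v. indicator A v *\<^sub>R Z v)" if "cond_integrable Z" for Z :: "'w \<Rightarrow> 'k"
    proof (rule cond_integrable_dominated[OF that])
      show "(\<lambda>v. indicat_real A v *\<^sub>R Z v) \<in> borel_measurable M"
        using cond_integrable_measurable[OF that] by measurable
    qed (auto simp: indicator_def)
    have "AE v in M. condE (\<lambda>v. indicator A v *\<^sub>R dens g v + indicator A v *\<^sub>R dens h v) v =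
        condE (\<lambda>v. indicator A v *\<^sub>R dens g v) v + condE (\<lambda>v. indicator A v *\<^sub>R dens h v) v"
      by (intro cond_exp_add ci dens_ci g h)
    moreover have "AE v in M. condE (\<lambda>v. indicator A v *\<^sub>R dens g v) v = \<phi> (scl (indicator A) g) v"
      "AE v in M. condE (\<lambda>v. indicator A v *\<^sub>R dens h v) v = \<phi> (scl (indicator A) h) v"
      using is_density_dens[OF g] is_density_dens[OF h] by (auto simp: is_density_def)
    moreover have "AE v in M. \<phi> (scl (indicator A) g \<oplus> scl (indicator A) h) v = \<phi> (scl (indicator A) g) v + \<phi> (scl (indicator A) h) v"
      by (intro \<phi>_add indicator_scl_Lp g h) measurable
    moreover have "scl (indicator A) (g \<oplus> h) = scl (indicator A) g \<oplus> scl (indicator A) h"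
      by (simp add: scl_add_right Lp_carrier g h)
    ultimately show "AE v in M. condE (\<lambda>v. indicator A v *\<^sub>R (dens g v + dens h v)) v = \<phi> (scl (indicator A) (g \<oplus> h)) v"
      by (elim AE_mp) (simp add: scaleR_add_right)
  qed
  from dens_unique[OF Lp_add[OF g h] this] show ?thesis by eventually_elim simp
qed

section \<open>Extension of the density from \<open>Lp\<close> to all of \<open>S\<close>\<close>

definition sfac :: "'s \<Rightarrow> 'w \<Rightarrow> real" where
  "sfac x w = 1 / (1 + nm x w)"

lemma sfac_pos: "0 < sfac x w" and sfac_le_1: "sfac x w \<le> 1"
  by (auto simp: sfac_def add_pos_nonneg divide_le_eq)

lemma sfac_measurable [measurable]: "x \<in> carrier S \<Longrightarrow> sfac x \<in> borel_measurable M"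
  unfolding sfac_def by measurable

definition ext_dens :: "'s \<Rightarrow> 'w \<Rightarrow> 'k" where
  "ext_dens x w = of_real (1 / sfac x w) * dens (scl (\<lambda>w. of_real (sfac x w)) x) w"

lemma sfac_Lp:
  assumes [measurable]: "x \<in> carrier S"
  shows "scl (\<lambda>w. of_real (sfac x w)) x \<in> Lp"
proof (rule Lp_bounded)
  have m: "(\<lambda>w. of_real (sfac x w) :: 'k) \<in> borel_measurable M" by measurable
  then show "scl (\<lambda>w. of_real (sfac x w)) x \<in> carrier S" using assms by simp
  show "AE w in M. nm (scl (\<lambda>w. of_real (sfac x w)) x) w \<le> 1"
    using nm_scl[OF m assms]
  proof eventually_elim
    case (elim w)
    have "norm (of_real (sfac x w) :: 'k) = sfac x w"
      using sfac_pos[of x w] by (simp only: norm_of_real abs_of_pos)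
    then show ?case
      unfolding elim by (simp add: sfac_def divide_le_eq add_pos_nonneg)
  qed
qed

lemma ext_dens_measurable [measurable]: "x \<in> carrier S \<Longrightarrow> ext_dens x \<in> borel_measurable M"
  unfolding ext_dens_def using sfac_Lp[of x] by measurable

text \<open>\<open>dens_scl\<close>, applied in both orders to the product of the two factors, shows
  that the quotient does not depend on the normalising factor. This allows one common factor for
  several elements.\<close>

lemma ext_dens_eq:
  assumes x [measurable]: "x \<in> carrier S" and c [measurable]: "c \<in> borel_measurable M"
    and c01: "\<And>w. 0 < c w" "\<And>w. c w \<le> (1::real)" and L: "scl (\<lambda>w. of_real (c w)) x \<in> Lp"
  shows "AE w in M. ext_dens x w = of_real (1 / c w) * dens (scl (\<lambda>w. of_real (c w)) x) w"
proof -
  let ?c = "\<lambda>w. of_real (c w) :: 'k" and ?d = "\<lambda>w. of_real (sfac x w) :: 'k"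
  have m [measurable]: "?c \<in> borel_measurable M" "?d \<in> borel_measurable M" by measurable
  have bd: "norm (?c w) \<le> 1" "norm (?d w) \<le> 1" for w
    using c01[of w] sfac_pos[of x w] sfac_le_1[of x w] by auto
  have "scl ?d (scl ?c x) = scl ?c (scl ?d x)"
    by (simp add: scl_scl x mult.commute)
  moreover have "AE w in M. dens (scl ?d (scl ?c x)) w = ?d w * dens (scl ?c x) w"
    by (rule dens_scl[OF L m(2) bd(2)])
  moreover have "AE w in M. dens (scl ?c (scl ?d x)) w = ?c w * dens (scl ?d x) w"
    by (rule dens_scl[OF sfac_Lp[OF x] m(1) bd(1)])
  ultimately have "AE w in M. ?d w * dens (scl ?c x) w = ?c w * dens (scl ?d x) w"
    by (elim AE_mp) simp
  then show ?thesis
  proof eventually_elim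
    case (elim w)
    have "?c w \<noteq> 0" "?d w \<noteq> 0" using c01(1)[of w] sfac_pos[of x w] by (auto simp: less_imp_neq[symmetric])
    with elim show ?case by (simp add: ext_dens_def field_simps)
  qed
qed

lemma ext_dens_Lp:
  assumes "g \<in> Lp"
  shows "AE w in M. ext_dens g w = dens g w"
  using ext_dens_eq[OF Lp_carrier[OF assms], of "\<lambda>_. 1"] assms by (simp add: scl_one Lp_carrier)

lemma ext_dens_add:
  assumes x [measurable]: "x \<in> carrier S" and y [measurable]: "y \<in> carrier S"
  shows "AE w in M. ext_dens (x \<oplus> y) w = ext_dens x w + ext_dens y w"
proof -
  \<comment> \<open>A single factor that brings \<open>x\<close>, \<open>y\<close> and
    \<open>x \<oplus> y\<close> into the unit ball, so that additivity on \<open>Lp\<close>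
    applies.\<close>
  define c where "c w = 1 / (1 + nm x w + nm y w)" for w
  have [measurable]: "c \<in> borel_measurable M" unfolding c_def by measurable
  have pos: "0 < 1 + nm x w + nm y w" for w by (simp add: add_pos_nonneg)
  have c01: "0 < c w" "c w \<le> 1" for w
    using pos[of w] by (auto simp: c_def divide_le_eq)
  have m: "(\<lambda>w. of_real (c w) :: 'k) \<in> borel_measurable M" by measurable
  have L: "scl (\<lambda>w. of_real (c w)) z \<in> Lp" if z: "z \<in> carrier S" "AE w in M. nm z w \<le> nm x w + nm y w" for z
  proof (rule Lp_bounded)
    show "scl (\<lambda>w. of_real (c w)) z \<in> carrier S" using m z by simp
    show "AE w in M. nm (scl (\<lambda>w. of_real (c w)) z) w \<le> 1"
      using nm_scl[OF m z(1)] z(2)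
    proof eventually_elim
      case (elim w)
      then show ?case using c01(1)[of w] pos[of w] by (simp add: abs_of_pos) (simp add: c_def)
    qed
  qed
  have xL: "scl (\<lambda>w. of_real (c w)) x \<in> Lp" by (rule L[OF x]) auto
  have yL: "scl (\<lambda>w. of_real (c w)) y \<in> Lp" by (rule L[OF y]) auto
  have sL: "scl (\<lambda>w. of_real (c w)) (x \<oplus> y) \<in> Lp"
    using x y by (intro L nm_add) auto
  have "scl (\<lambda>w. of_real (c w)) (x \<oplus> y) = scl (\<lambda>w. of_real (c w)) x \<oplus> scl (\<lambda>w. of_real (c w)) y"
    by (rule scl_add_right[OF m x y])
  with dens_add[OF xL yL]
  have "AE w in M. dens (scl (\<lambda>w. of_real (c w)) (x \<oplus> y)) w = dens (scl (\<lambda>w. of_real (c w)) x) w + dens (scl (\<lambda>w. of_real (c w)) y) w"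
    by simp
  moreover have "AE w in M. ext_dens (x \<oplus> y) w = of_real (1 / c w) * dens (scl (\<lambda>w. of_real (c w)) (x \<oplus> y)) w"
    using x y by (intro ext_dens_eq[OF _ _ c01 sL]) auto
  moreover have "AE w in M. ext_dens x w = of_real (1 / c w) * dens (scl (\<lambda>w. of_real (c w)) x) w"
    using x by (intro ext_dens_eq[OF _ _ c01 xL]) auto
  moreover have "AE w in M. ext_dens y w = of_real (1 / c w) * dens (scl (\<lambda>w. of_real (c w)) y) w"
    using y by (intro ext_dens_eq[OF _ _ c01 yL]) auto
  ultimately show ?thesis by eventually_elim (simp add: distrib_left)
qed

lemma ext_dens_scl:
  assumes x [measurable]: "x \<in> carrier S" and a [measurable]: "a \<in> borel_measurable M"
  shows "AE w in M. ext_dens (scl a x) w = a w * ext_dens x w"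
proof -
  \<comment> \<open>\<open>e\<close> turns \<open>a\<close> into a multiplier bounded by 1 and
    \<open>sfac x\<close> brings \<open>x\<close> into \<open>Lp\<close>; their product is then an
    admissible factor for \<open>scl a x\<close>.\<close>
  define e where "e w = 1 / (1 + norm (a w))" for w
  define c where "c w = e w * sfac x w" for w
  have [measurable]: "e \<in> borel_measurable M" unfolding e_def by measurable
  then have [measurable]: "c \<in> borel_measurable M" unfolding c_def by measurable
  have e01: "0 < e w" "e w \<le> 1" for w
    by (auto simp: e_def add_pos_nonneg divide_le_eq)
  have c01: "0 < c w" "c w \<le> 1" for w
    using e01[of w] sfac_pos[of x w] sfac_le_1[of x w] by (auto simp: c_def intro: mult_le_one)
  let ?b = "\<lambda>w. of_real (e w) * a w" and ?g = "scl (\<lambda>w. of_real (sfac x w)) x"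
  have m [measurable]: "?b \<in> borel_measurable M" "(\<lambda>w. of_real (sfac x w) :: 'k) \<in> borel_measurable M"
     "(\<lambda>w. of_real (c w) :: 'k) \<in> borel_measurable M" by measurable
  have b: "norm (?b w) \<le> 1" for w
    using e01(1)[of w] by (simp add: norm_mult abs_of_pos) (simp add: e_def divide_le_eq add_pos_nonneg)
  have eq: "scl (\<lambda>w. of_real (c w)) (scl a x) = scl ?b ?g"
  proof -
    have "(\<lambda>w. of_real (c w) * a w) = (\<lambda>w. ?b w * of_real (sfac x w))"
      by (simp add: c_def mult_ac)
    then show ?thesis by (simp only: scl_scl[OF m(3) a x] scl_scl[OF m(1) m(2) x])
  qed
  have bL: "scl ?b ?g \<in> Lp" using b by (intro Lp_bounded_scl(1)[OF m(1) sfac_Lp[OF x], of 1]) auto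
  have "AE w in M. ext_dens (scl a x) w = of_real (1 / c w) * dens (scl (\<lambda>w. of_real (c w)) (scl a x)) w"
    by (rule ext_dens_eq[OF _ _ c01]) (use a x bL in \<open>auto simp: eq\<close>)
  moreover have "AE w in M. dens (scl ?b ?g) w = ?b w * dens ?g w"
    by (rule dens_scl[OF sfac_Lp[OF x] m(1) b])
  ultimately show ?thesis
  proof eventually_elim
    case (elim w)
    have "(of_real (e w) :: 'k) \<noteq> 0" "(of_real (sfac x w) :: 'k) \<noteq> 0"
      using e01(1)[of w] sfac_pos[of x w] by auto
    moreover have "ext_dens (scl a x) w = of_real (1 / c w) * (?b w * dens ?g w)"
      using elim(1) unfolding eq elim(2) .
    ultimately show ?case by (simp add: ext_dens_def c_def)
  qed
qed

lemma ext_dens_cond_exp: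
  assumes g: "g \<in> Lp"
  shows "cond_integrable (ext_dens g)" "AE w in M. condE (ext_dens g) w = \<phi> g w"
proof -
  note [measurable] = Lp_carrier[OF g] 
  have m: "dens g \<in> borel_measurable M" using g by (rule dens_measurable)
  have ae: "AE w in M. ext_dens g w = dens g w" by (rule ext_dens_Lp[OF g])
  then show "cond_integrable (ext_dens g)"
    by (intro cond_integrable_dominated[OF dens_ci[OF g]]) (auto elim: eventually_mono)
  have "AE w in M. condE (\<lambda>w. 1 * dens g w) w = \<phi> (scl (\<lambda>_. 1) g) w"
    by (rule dens_bounded[OF g, of _ 1]) auto
  then have "AE w in M. condE (dens g) w = \<phi> g w"
    by (simp add: scl_one Lp_carrier[OF g])
  moreover have "AE w in M. condE (ext_dens g) w = condE (dens g) w"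
    by (rule cond_exp_cong[OF ae _ m]) measurable
  ultimately show "AE w in M. condE (ext_dens g) w = \<phi> g w" by eventually_elim simp
qed

end

section \<open>The dual norm estimate\<close>

context prob_subalgebra
begin

text \<open>The negative part of \<open>u\<close> contributes nothing, and the conditional
  expectation of a real multiple of the unit is computed through the coordinates
  \<open>1 \<bullet> b\<close>.\<close>

lemma norm_cond_exp_of_real:
  fixes u :: "'w \<Rightarrow> real"
  assumes u [measurable]: "u \<in> borel_measurable M" and nn: "\<And>v. 0 \<le> u v"
    and ci: "cond_integrable (\<lambda>v. of_real (u v) :: 'b::{real_normed_field, euclidean_space})"
  shows "AE v in M. norm (condE (\<lambda>v. of_real (u v) :: 'b) v) = enn2real (nnE (\<lambda>v. ennreal (u v)) v)"
proof -
  have ciu: "cond_integrable u"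
    using ci nn by (simp add: cond_integrable_def)
  have eq: "AE v in M. condE (\<lambda>v. of_real (u v) :: 'b) v = of_real (realE u v)"
  proof (rule cond_exp_eqI)
    fix b :: 'b
    have "AE v in M. realE (\<lambda>v. ((1::'b) \<bullet> b) * u v) v = (1 \<bullet> b) * realE u v"
      by (rule real_cond_exp_mult'[OF ciu]) simp
    then show "AE v in M. realE (\<lambda>v. (of_real (u v) :: 'b) \<bullet> b) v = of_real (realE u v) \<bullet> b"
      by (simp add: of_real_def mult.commute)
  qed
  have "AE v in M. nnE (\<lambda>v. ennreal (- u v)) v = 0"
  proof -
    have "(\<lambda>v. ennreal (- u v)) = (\<lambda>v. 0)" using nn by (auto simp: ennreal_neg fun_eq_iff)
    moreover have "AE v in M. nnE (\<lambda>v. 0) v = 0"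
      using nn_cond_exp_F_meas[of "\<lambda>v. 0"] by (auto elim: eventually_mono)
    ultimately show ?thesis by simp
  qed
  with eq show ?thesis
    by eventually_elim (simp add: real_cond_exp_def)
qed

end

context cond_Lp_module
begin

context
  fixes ff :: "'s \<Rightarrow> 'w \<Rightarrow> 'k" and \<eta> :: "'w \<Rightarrow> real"
  assumes ff_meas [measurable]: "\<And>x. x \<in> carrier S \<Longrightarrow> ff x \<in> borel_measurable M"
    and ff_add: "\<And>x y. \<lbrakk>x \<in> carrier S; y \<in> carrier S\<rbrakk> \<Longrightarrow> AE w in M. ff (x \<oplus> y) w = ff x w + ff y w"
    and ff_scl: "\<And>a x. \<lbrakk>a \<in> borel_measurable M; x \<in> carrier S\<rbrakk> \<Longrightarrow> AE w in M. ff (scl a x) w = a w * ff x w"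
    and ff_ci: "\<And>x. x \<in> Lp \<Longrightarrow> cond_integrable (ff x)"
    and ff_bound: "\<And>x. x \<in> Lp \<Longrightarrow> AE w in M. norm (condE (ff x) w) \<le> \<eta> w * Lp_norm x w"
    and \<eta> [measurable]: "\<eta> \<in> borel_measurable F" and \<eta>0: "\<And>w. 0 \<le> \<eta> w"
begin

text \<open>The phase that rotates \<open>z\<close> onto its norm. At 0 total division gives 0, so
  the norm never exceeds 1.\<close>

definition csgn :: "'k \<Rightarrow> 'k" where
  "csgn z = of_real (norm z) / z"

lemma csgn_mult: "csgn z * z = of_real (norm z)" and norm_csgn: "norm (csgn z) = (if z = 0 then 0 else 1)"
  by (auto simp: csgn_def norm_divide)

lemma csgn_measurable [measurable]: "csgn \<in> borel_measurable borel"
  unfolding csgn_def by measurable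

text \<open>\<open>scl a x\<close> has norm at most \<open>r\<close> and is mapped to
  \<open>r\<close> times \<open>norm (ff x)\<close>, which turns the bound on \<open>Lp\<close> into
  one between nonnegative conditional expectations. The bound \<open>c\<close> on \<open>r\<close>
  makes both finite, as later cancellations require.\<close>

lemma test_bound:
  assumes x: "x \<in> carrier S" and nx: "AE w in M. nm x w \<le> 1"
    and r [measurable]: "r \<in> borel_measurable M" and r0: "\<And>w. 0 \<le> r w" and rc: "\<And>w. r w \<le> c"
  shows "AE w in M. enn2real (nnE (\<lambda>w. ennreal (r w * norm (ff x w))) w) \<le>
      \<eta> w * enn2real (nnE (\<lambda>w. ennreal (r w powr p)) w) powr (1 / p)"
    and "AE w in M. nnE (\<lambda>w. ennreal (r w * norm (ff x w))) w < \<infinity>"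
    and "AE w in M. nnE (\<lambda>w. ennreal (r w powr p)) w < \<infinity>"
proof -
  note [measurable] = ff_meas[OF x]
  \<comment> \<open>chosen so that \<open>a f(x) = r |f(x)|\<close>\<close>
  define a where "a w = of_real (r w) * csgn (ff x w)" for w
  have a [measurable]: "a \<in> borel_measurable M" unfolding a_def by measurable
  have na: "norm (a w) \<le> r w" for w
    using r0[of w] by (auto simp: a_def norm_mult norm_csgn)
  have aff: "a w * ff x w = of_real (r w * norm (ff x w))" for w
    by (simp add: a_def mult.assoc csgn_mult)
  have xL: "x \<in> Lp" by (rule Lp_bounded[OF x nx])
  have nac: "norm (a w) \<le> c" for w using na[of w] rc[of w] by linarith
  have axL: "scl a x \<in> Lp" using nac by (intro Lp_bounded_scl(1)[OF a xL]) auto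
  note [measurable] = Lp_carrier[OF axL] ff_meas[OF Lp_carrier[OF axL]]
  have ae: "AE w in M. ff (scl a x) w = of_real (r w * norm (ff x w))"
    using ff_scl[OF a x] by eventually_elim (simp add: aff)
  have ci: "cond_integrable (\<lambda>w. of_real (r w * norm (ff x w)) :: 'k)"
    using ae by (intro cond_integrable_dominated[OF ff_ci[OF axL]]) (auto elim!: eventually_mono)
  have "AE w in M. norm (condE (\<lambda>w. of_real (r w * norm (ff x w)) :: 'k) w) = enn2real (nnE (\<lambda>w. ennreal (r w * norm (ff x w))) w)"
    by (rule norm_cond_exp_of_real[OF _ _ ci]) (auto simp: r0)
  moreover have "AE w in M. condE (ff (scl a x)) w = condE (\<lambda>w. of_real (r w * norm (ff x w)) :: 'k) w"
    by (rule cond_exp_cong[OF ae]) measurable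
  moreover have "AE w in M. norm (condE (ff (scl a x)) w) \<le> \<eta> w * Lp_norm (scl a x) w"
    by (rule ff_bound[OF axL])
  moreover have cp: "AE w in M. cpow (scl a x) w \<le> nnE (\<lambda>w. ennreal (r w powr p)) w"
    unfolding cpow_def
  proof (rule nn_cond_exp_mono)
    show "AE w in M. ennreal (nm (scl a x) w powr p) \<le> ennreal (r w powr p)"
      using nm_scl[OF a x] nx
    proof eventually_elim
      case (elim w)
      have "nm (scl a x) w \<le> r w * 1"
        unfolding elim(1) using na[of w] elim(2) r0[of w] by (intro mult_mono) auto
      then show ?case using p by (intro ennreal_leI powr_mono2) auto
    qed
  qed measurable
  moreover show fin: "AE w in M. nnE (\<lambda>w. ennreal (r w powr p)) w < \<infinity>"
  proof -
    have "AE w in M. nnE (\<lambda>w. ennreal (r w powr p)) w \<le> nnE (\<lambda>w. ennreal (c powr p)) w"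
      using r0 rc p by (intro nn_cond_exp_mono AE_I2 ennreal_leI powr_mono2) auto
    moreover have "AE w in M. ennreal (c powr p) = nnE (\<lambda>w. ennreal (c powr p)) w"
      by (rule nn_cond_exp_F_meas) simp
    ultimately show ?thesis
      by eventually_elim (metis ennreal_less_top infinity_ennreal_def le_less_trans)
  qed
  ultimately show "AE w in M. enn2real (nnE (\<lambda>w. ennreal (r w * norm (ff x w))) w) \<le>
      \<eta> w * enn2real (nnE (\<lambda>w. ennreal (r w powr p)) w) powr (1 / p)"
  proof eventually_elim
    case (elim w)
    have "enn2real (cpow (scl a x) w) \<le> enn2real (nnE (\<lambda>w. ennreal (r w powr p)) w)"
      using elim by (intro enn2real_mono) auto
    then have "Lp_norm (scl a x) w \<le> enn2real (nnE (\<lambda>w. ennreal (r w powr p)) w) powr (1 / p)"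
      unfolding Lp_norm_def using p by (intro powr_mono2) auto
    then have "\<eta> w * Lp_norm (scl a x) w \<le> \<eta> w * enn2real (nnE (\<lambda>w. ennreal (r w powr p)) w) powr (1 / p)"
      using \<eta>0[of w] by (intro mult_left_mono) auto
    with elim show ?case by simp
  qed
  have "AE w in M. nnE (\<lambda>w. ennreal (norm (of_real (r w * norm (ff x w)) :: 'k))) w < \<infinity>"
    using ci by (simp add: cond_integrable_def)
  then show "AE w in M. nnE (\<lambda>w. ennreal (r w * norm (ff x w))) w < \<infinity>"
    using r0 by (simp add: norm_mult)
qed

text \<open>Testing with the indicator of the set where \<open>norm (ff x)\<close> exceeds
  \<open>\<eta>\<close> shows that the nonnegative excess has conditional expectation 0, hence
  vanishes.\<close>

lemma unit_ball_bound_1: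
  assumes x: "x \<in> carrier S" and nx: "AE w in M. nm x w \<le> 1" and p1: "p = 1"
  shows "AE w in M. norm (ff x w) \<le> \<eta> w"
proof -
  note [measurable] = ff_meas[OF x]
  define B where "B = {w \<in> space M. \<eta> w < norm (ff x w)}"
  have [measurable]: "B \<in> sets M" unfolding B_def by measurable
  let ?i = "indicator B :: 'w \<Rightarrow> real"
  let ?u = "\<lambda>w. ennreal (?i w * norm (ff x w))" and ?d = "\<lambda>w. ennreal (?i w * (norm (ff x w) - \<eta> w))"
    and ?e = "\<lambda>w. ennreal (\<eta> w * ?i w)"
  have pw: "(\<lambda>w. ennreal (?i w powr p)) = (\<lambda>w. ennreal (?i w))"
    using p1 by (auto simp: indicator_def)
  have im: "?i \<in> borel_measurable M" by measurable
  have i01: "0 \<le> ?i w" "?i w \<le> 1" for w by (auto simp: indicator_def)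
  note tb = test_bound[where r = ?i and c = 1, OF x nx im i01, unfolded pw]
  have e_eq: "AE w in M. nnE ?e w = ennreal (\<eta> w) * nnE (\<lambda>w. ennreal (?i w)) w"
    by (rule nn_cond_exp_F_mult) (auto simp: \<eta>0)
  have sum: "AE w in M. nnE ?d w + nnE ?e w = nnE (\<lambda>w. ?d w + ?e w) w"
    by (rule nn_cond_exp_sum) measurable
  have de: "AE w in M. ?d w + ?e w = ?u w"
  proof (rule AE_I2)
    fix w show "?d w + ?e w = ?u w"
      using \<eta>0[of w] by (auto simp: B_def indicator_def ennreal_plus[symmetric] simp del: ennreal_plus)
  qed
  have du: "AE w in M. nnE (\<lambda>w. ?d w + ?e w) w = nnE ?u w"
    by (rule nn_cond_exp_cong[OF de]) measurable
  have "AE w in M. nnE ?d w = 0"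
    using tb e_eq sum du
  proof eventually_elim
    case (elim w)
    define s where "s = enn2real (nnE (\<lambda>w. ennreal (?i w)) w)"
    define t where "t = enn2real (nnE ?u w)"
    have s: "nnE (\<lambda>w. ennreal (?i w)) w = ennreal s" "0 \<le> s"
      using elim(3) by (auto simp: s_def)
    have t: "nnE ?u w = ennreal t" "0 \<le> t"
      using elim(2) by (auto simp: t_def)
    have e: "nnE ?e w = ennreal (\<eta> w * s)"
      using elim(4) s \<eta>0[of w] by (simp add: ennreal_mult')
    have "t \<le> \<eta> w * s" using elim(1) p1 by (simp add: s_def t_def)
    then have "ennreal (\<eta> w * s) + nnE ?d w \<le> ennreal (\<eta> w * s) + 0"
      using elim(5,6) t(1) unfolding e by (simp add: ennreal_leI add.commute)
    then show ?case
      unfolding ennreal_add_left_cancel_le by simp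
  qed
  then have "(\<integral>\<^sup>+w. 1 * nnE ?d w \<partial>M) = 0"
    by (subst nn_integral_0_iff_AE) auto
  then have "(\<integral>\<^sup>+w. 1 * ?d w \<partial>M) = 0"
    by (subst (asm) nn_cond_exp_intg) auto
  then have "AE w in M. 1 * ?d w = 0"
    by (subst (asm) nn_integral_0_iff_AE) auto
  then show ?thesis
    using AE_space
  proof eventually_elim
    case (elim w)
    show ?case
    proof (rule ccontr)
      assume a: "\<not> norm (ff x w) \<le> \<eta> w"
      then have "w \<in> B" using elim(2) by (simp add: B_def)
      with elim(1) a show False by (simp add: ennreal_eq_0_iff)
    qed
  qed
qed

text \<open>\<open>r = norm (ff x) powr (q - 1)\<close> is the extremal multiplier of Hoelder's
  inequality: \<open>r powr p\<close> and \<open>r * norm (ff x)\<close> both equal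
  \<open>norm (ff x) powr q\<close>. The test thus reads
  \<open>s \<le> \<eta> s powr (1 / p)\<close> for its conditional expectation \<open>s\<close>.
  Truncation makes \<open>r\<close> bounded and \<open>s\<close> finite.\<close>

lemma unit_ball_bound:
  assumes x: "x \<in> carrier S" and nx: "AE w in M. nm x w \<le> 1" and pq: "1 < p" "1 < q" "1 / p + 1 / q = 1"
  shows "AE w in M. nnE (\<lambda>w. ennreal (norm (ff x w) powr q)) w \<le> ennreal (\<eta> w powr q)"
proof -
  note [measurable] = ff_meas[OF x]
  \<comment> \<open>Cutting to 0 above \<open>n\<close>, rather than to \<open>n\<close>, preserves
    the identities \<open>r * norm (ff x) = u = r powr p\<close>.\<close>
  define u where "u n w = (if norm (ff x w) \<le> real n then norm (ff x w) powr q else 0)" for n w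
  define r where "r n w = (if norm (ff x w) \<le> real n then norm (ff x w) powr (q - 1) else 0)" for n w
  have [measurable]: "u n \<in> borel_measurable M" and rm: "r n \<in> borel_measurable M" for n
    unfolding u_def r_def by measurable
  have pq': "(q - 1) * p = q" using pq by (simp add: field_simps)
  have ru: "r n w * norm (ff x w) = u n w" for n w
  proof (cases "ff x w = 0")
    case False
    then have "norm (ff x w) powr (q - 1) * norm (ff x w) powr 1 = norm (ff x w) powr q"
      by (subst powr_add[symmetric]) simp
    then show ?thesis by (simp add: r_def u_def)
  qed (simp add: r_def u_def)
  have rp: "r n w powr p = u n w" for n w
    by (simp add: r_def u_def powr_powr pq')
  have r0: "0 \<le> r n w" for n w by (simp add: r_def)
  have rc: "r n w \<le> real n powr (q - 1)" for n w
    using pq by (auto simp: r_def intro!: powr_mono2)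
  note tb = test_bound[where r = "r n" and c = "real n powr (q - 1)" for n, OF x nx rm r0 rc, unfolded ru rp]
  have un: "AE w in M. nnE (\<lambda>w. ennreal (u n w)) w \<le> ennreal (\<eta> w powr q)" for n
    using tb[of n]
  proof eventually_elim
    case (elim w)
    define s where "s = enn2real (nnE (\<lambda>w. ennreal (u n w)) w)"
    have s: "nnE (\<lambda>w. ennreal (u n w)) w = ennreal s" "0 \<le> s"
      using elim(2) by (auto simp: s_def)
    have le: "s \<le> \<eta> w * s powr (1 / p)" using elim(1) by (simp add: s_def)
    \<comment> \<open>Cancelling \<open>s powr (1 / p)\<close>, which is positive unless
      \<open>s = 0\<close>, leaves \<open>s powr (1 / q)\<close> by conjugacy.\<close>
    have "s \<le> \<eta> w powr q"
    proof (cases "s = 0")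
      case False
      then have "s powr (1 / q) * s powr (1 / p) = s"
        using s(2) pq(3) by (simp add: powr_add[symmetric] add.commute)
      then have "s powr (1 / q) * s powr (1 / p) \<le> \<eta> w * s powr (1 / p)" using le by simp
      then have "s powr (1 / q) \<le> \<eta> w" using False s(2) by (simp add: mult_le_cancel_right)
      then have "(s powr (1 / q)) powr q \<le> \<eta> w powr q" using pq by (intro powr_mono2) auto
      then show ?thesis using pq s(2) by (simp add: powr_powr)
    qed simp
    then show ?case by (simp add: s ennreal_leI)
  qed
  have inc: "ennreal (u n w) \<le> ennreal (u (Suc n) w)" for n w
    by (intro ennreal_leI) (auto simp: u_def)
  have "AE w in M. nnE (\<lambda>w. SUP n. ennreal (u n w)) w \<le> ennreal (\<eta> w powr q)"
    by (rule nn_cond_exp_SUP_le[of "\<lambda>n w. ennreal (u n w)"]) (auto simp: un inc)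
  moreover have "(SUP n. ennreal (u n w)) = ennreal (norm (ff x w) powr q)" for w
  proof (rule antisym)
    show "(SUP n. ennreal (u n w)) \<le> ennreal (norm (ff x w) powr q)"
      by (rule SUP_least) (auto simp: u_def intro!: ennreal_leI)
    obtain n where "norm (ff x w) \<le> real n" using real_arch_simple by blast
    then have "ennreal (norm (ff x w) powr q) = ennreal (u n w)" by (simp add: u_def)
    then show "ennreal (norm (ff x w) powr q) \<le> (SUP n. ennreal (u n w))"
      by (simp only:) (rule SUP_upper, simp)
  qed
  ultimately show ?thesis by simp
qed

lemma ff_zero: "AE w in M. ff \<zero> w = 0"
  using ff_add[of \<zero> \<zero>] by (simp add: eventually_mono)

lemma nm_zero_imp:
  assumes "x \<in> carrier S" "AE w in M. nm x w = 0"
  shows "x = \<zero>"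
proof -
  have "rnorm S x = \<zero>\<^bsub>L0_ring M\<^esub>"
    unfolding rnorm_eq[OF assms(1)] L0_ring_zero
    by (intro L0_class_cong) (use assms in auto)
  then show ?thesis using rnorm_eq_zero_iff[OF assms(1)] by simp
qed

lemma nm_zero: "AE w in M. nm \<zero> w = 0"
proof -
  have "rnorm S \<zero> = L0_class M (\<lambda>w. 0)"
    using rnorm_eq_zero_iff[of \<zero>] by (simp add: L0_ring_zero)
  from nm_cong_class[OF _ this] show ?thesis by simp
qed

text \<open>Cutting \<open>x\<close> to the set where its norm vanishes gives an element of norm 0,
  which is \<open>\<zero>\<close>. This covers the set on which \<open>x\<close> cannot be
  normalised.\<close>

lemma ff_zero_on:
  assumes x [measurable]: "x \<in> carrier S"
  shows "AE w in M. nm x w = 0 \<longrightarrow> ff x w = 0"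
proof -
  define Z where "Z = {w \<in> space M. nm x w = 0}"
  have [measurable]: "Z \<in> sets M" unfolding Z_def by measurable
  have m: "(indicator Z :: 'w \<Rightarrow> 'k) \<in> borel_measurable M" by measurable
  have "AE w in M. nm (scl (indicator Z) x) w = 0"
    using nm_scl[OF m x] by eventually_elim (auto simp: Z_def indicator_def)
  then have "scl (indicator Z) x = \<zero>"
    by (intro nm_zero_imp scl_closed m x)
  with ff_scl[OF m x] have "AE w in M. ff \<zero> w = indicator Z w * ff x w" by simp
  then show ?thesis using ff_zero AE_space by eventually_elim (auto simp: Z_def)
qed

text \<open>\<open>x\<close> is glued to \<open>y\<close> along the set where
  \<open>norm (ff x)\<close> is the larger value; for two pieces the module operations
  suffice.\<close>

lemma unit_ball_directed:
  assumes x: "x \<in> carrier S" "AE w in M. nm x w \<le> 1" and y: "y \<in> carrier S" "AE w in M. nm y w \<le> 1"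
  obtains z where "z \<in> carrier S" "AE w in M. nm z w \<le> 1" "AE w in M. norm (ff z w) = max (norm (ff x w)) (norm (ff y w))"
proof -
  note [measurable] = ff_meas[OF x(1)] ff_meas[OF y(1)]
  define A where "A = {w \<in> space M. norm (ff y w) \<le> norm (ff x w)}"
  have [measurable]: "A \<in> sets M" unfolding A_def by measurable
  define a where "a w = (indicator A w :: 'k)" for w
  define b where "b w = (1 - indicator A w :: 'k)" for w
  have m: "a \<in> borel_measurable M" "b \<in> borel_measurable M"
    unfolding a_def b_def by measurable
  have ab: "(a w = 1 \<and> b w = 0) \<or> (a w = 0 \<and> b w = 1)" for w by (auto simp: a_def b_def indicator_def)
  let ?z = "scl a x \<oplus> scl b y"
  have c: "scl a x \<in> carrier S" "scl b y \<in> carrier S" using m x y by auto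
  show ?thesis
  proof
    show "?z \<in> carrier S" using c by simp
    show "AE w in M. nm ?z w \<le> 1"
      using nm_add[OF c] nm_scl[OF m(1) x(1)] nm_scl[OF m(2) y(1)] x(2) y(2)
    proof eventually_elim
      case (elim w)
      then show ?case using ab[of w] by auto
    qed
    show "AE w in M. norm (ff ?z w) = max (norm (ff x w)) (norm (ff y w))"
      using ff_add[OF c] ff_scl[OF m(1) x(1)] ff_scl[OF m(2) y(1)] AE_space
    proof eventually_elim
      case (elim w)
      then show ?case by (cases "w \<in> A") (auto simp: a_def b_def A_def max_def)
    qed
  qed
qed

text \<open>\<open>ff\<close> obeys its laws only almost everywhere because there are two uses:
  finding a bound that places a newly built \<open>f\<close> in the conjugate module, and estimating
  the norm of an \<open>f\<close> already known to lie there.\<close>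

lemma dual_norm_exists:
  obtains N where "N \<in> borel_measurable M" "\<And>w. (0::real) \<le> N w"
    "\<And>x. x \<in> carrier S \<Longrightarrow> AE w in M. norm (ff x w) \<le> N w * nm x w"
    "p = 1 \<Longrightarrow> AE w in M. N w \<le> \<eta> w"
    "\<And>q. \<lbrakk>1 < p; 1 < q; 1 / p + 1 / q = 1\<rbrakk> \<Longrightarrow> AE w in M. nnE (\<lambda>w. ennreal (N w powr q)) w \<le> ennreal (\<eta> w powr q)"
proof -
  define U where "U = {x \<in> carrier S. AE w in M. nm x w \<le> 1}"
  define H where "H = (\<lambda>x w. ennreal (norm (ff x w))) ` U"
  have "\<zero> \<in> U" using nm_zero by (auto simp: U_def elim: eventually_mono)
  then have "H \<noteq> {}" by (auto simp: H_def)
  moreover have "H \<subseteq> borel_measurable M"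
  proof
    fix h assume "h \<in> H"
    then obtain x where "x \<in> carrier S" "h = (\<lambda>w. ennreal (norm (ff x w)))" by (auto simp: H_def U_def)
    then show "h \<in> borel_measurable M" using ff_meas[of x] by simp
  qed
  ultimately obtain s :: "nat \<Rightarrow> 'w \<Rightarrow> ennreal" where s: "range s \<subseteq> H" "\<And>h. h \<in> H \<Longrightarrow> AE w in M. h w \<le> (SUP n. s n w)"
    using ess_sup_countable[of H] by blast
  have "\<exists>x\<in>U. s n = (\<lambda>w. ennreal (norm (ff x w)))" for n
  proof -
    have "s n \<in> H" using s(1) by auto
    then show ?thesis by (auto simp: H_def)
  qed
  then obtain X where X: "\<And>n. X n \<in> U" "\<And>n. s n = (\<lambda>w. ennreal (norm (ff (X n) w)))" by metis
  have [measurable]: "ff (X n) \<in> borel_measurable M" for n using X(1) by (auto simp: U_def)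
  define m where "m n w = Max ((\<lambda>k. norm (ff (X k) w)) ` {..n})" for n w
  have m0: "m 0 w = norm (ff (X 0) w)" for w by (simp add: m_def)
  have mS: "m (Suc n) w = max (m n w) (norm (ff (X (Suc n)) w))" for n w
    by (simp add: m_def atMost_Suc max.commute)
  have [measurable]: "m n \<in> borel_measurable M" for n
  proof (induction n)
    case 0
    have "m 0 = (\<lambda>w. norm (ff (X 0) w))" by (simp add: m0 fun_eq_iff)
    then show ?case by simp
  next
    case (Suc n)
    have "m (Suc n) = (\<lambda>w. max (m n w) (norm (ff (X (Suc n)) w)))" by (simp add: mS fun_eq_iff)
    then show ?case using Suc by simp
  qed
  have m_nonneg: "0 \<le> m n w" for n w by (induction n) (auto simp: m0 mS)
  have m_ge: "norm (ff (X n) w) \<le> m n w" for n w by (cases n) (auto simp: m0 mS)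
  \<comment> \<open>Each \<open>n\<close> takes finitely many gluings, so an element
    \<open>y\<close> of \<open>S\<close> exists; the supremum over all \<open>n\<close> need not
    come from one.\<close>
  have y: "\<exists>y\<in>U. AE w in M. norm (ff y w) = m n w" for n
  proof (induction n)
    case 0
    show ?case using X(1)[of 0] by (auto simp: m0)
  next
    case (Suc n)
    then obtain y where "y \<in> U" and y: "AE w in M. norm (ff y w) = m n w" by auto
    then obtain z where "z \<in> carrier S" "AE w in M. nm z w \<le> 1"
      and "AE w in M. norm (ff z w) = max (norm (ff y w)) (norm (ff (X (Suc n)) w))"
      using X(1)[of "Suc n"] unit_ball_directed[of y "X (Suc n)"] unfolding U_def by blast
    moreover from this(3) y have "AE w in M. norm (ff z w) = m (Suc n) w"
      by eventually_elim (simp add: mS)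
    ultimately show ?case by (auto simp: U_def)
  qed
  define T where "T w = (SUP n. ennreal (m n w))" for w
  define N where "N w = enn2real (T w)" for w
  have [measurable]: "T \<in> borel_measurable M" unfolding T_def by measurable
  have T1: "AE w in M. T w \<le> ennreal (\<eta> w)" if p1: "p = 1"
  proof -
    have "AE w in M. m n w \<le> \<eta> w" for n
    proof -
      obtain y where "y \<in> U" and y: "AE w in M. norm (ff y w) = m n w" using y by auto
      then have "AE w in M. norm (ff y w) \<le> \<eta> w" by (intro unit_ball_bound_1 p1) (auto simp: U_def)
      with y show ?thesis by eventually_elim simp
    qed
    then have "AE w in M. \<forall>n. m n w \<le> \<eta> w" by (simp add: AE_all_countable)
    then show ?thesis unfolding T_def by eventually_elim (auto intro!: SUP_least ennreal_leI)
  qed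
  have Tq: "AE w in M. nnE (\<lambda>w. SUP n. ennreal (m n w powr q)) w \<le> ennreal (\<eta> w powr q)"
    "AE w in M. T w < \<infinity> \<and> ennreal (N w powr q) \<le> (SUP n. ennreal (m n w powr q))"
    if pq: "1 < p" "1 < q" "1 / p + 1 / q = 1" for q
  proof -
    have inc: "ennreal (m n w powr q) \<le> ennreal (m (Suc n) w powr q)" for n w
      using pq m_nonneg by (intro ennreal_leI powr_mono2) (auto simp: mS)
    have mn: "AE w in M. nnE (\<lambda>w. ennreal (m n w powr q)) w \<le> ennreal (\<eta> w powr q)" for n
    proof -
      obtain y where "y \<in> U" and y: "AE w in M. norm (ff y w) = m n w" using y by auto
      then have yc: "y \<in> carrier S" and "AE w in M. nm y w \<le> 1" by (auto simp: U_def)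
      then have "AE w in M. nnE (\<lambda>w. ennreal (norm (ff y w) powr q)) w \<le> ennreal (\<eta> w powr q)"
        by (intro unit_ball_bound pq)
      moreover have "AE w in M. nnE (\<lambda>w. ennreal (norm (ff y w) powr q)) w = nnE (\<lambda>w. ennreal (m n w powr q)) w"
      proof (rule nn_cond_exp_cong)
        show "AE w in M. ennreal (norm (ff y w) powr q) = ennreal (m n w powr q)"
          using y by eventually_elim simp
      qed (use ff_meas[OF yc] in measurable)
      ultimately show ?thesis by eventually_elim simp
    qed
    show V: "AE w in M. nnE (\<lambda>w. SUP n. ennreal (m n w powr q)) w \<le> ennreal (\<eta> w powr q)"
      by (rule nn_cond_exp_SUP_le[of "\<lambda>n w. ennreal (m n w powr q)"]) (auto simp: mn inc)
    then have "AE w in M. nnE (\<lambda>w. SUP n. ennreal (m n w powr q)) w < \<infinity>"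
      by eventually_elim (erule le_less_trans, simp)
    then have "AE w in M. (SUP n. ennreal (m n w powr q)) < \<infinity>"
      by (rule nn_cond_exp_finite_imp_finite[rotated]) measurable
    then show "AE w in M. T w < \<infinity> \<and> ennreal (N w powr q) \<le> (SUP n. ennreal (m n w powr q))"
    proof eventually_elim
      case (elim w)
      then obtain v where v: "(SUP n. ennreal (m n w powr q)) = ennreal v" "0 \<le> v"
        by (cases "SUP n. ennreal (m n w powr q)") auto
      have "m n w \<le> v powr (1 / q)" for n
      proof -
        have "ennreal (m n w powr q) \<le> ennreal v" unfolding v(1)[symmetric] by (rule SUP_upper) simp
        then have "m n w powr q \<le> v" using v(2) by (simp add: ennreal_le_iff)
        then have "(m n w powr q) powr (1 / q) \<le> v powr (1 / q)" using pq by (intro powr_mono2) auto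
        then show ?thesis using pq m_nonneg[of n w] by (simp add: powr_powr)
      qed
      then have T: "T w \<le> ennreal (v powr (1 / q))"
        unfolding T_def by (intro SUP_least ennreal_leI)
      then have fin: "T w < \<infinity>" by (rule le_less_trans) simp
      have "N w \<le> v powr (1 / q)" unfolding N_def using enn2real_mono[OF T] by simp
      then have "N w powr q \<le> (v powr (1 / q)) powr q" using pq by (intro powr_mono2) (auto simp: N_def)
      then have "N w powr q \<le> v" using pq v(2) by (simp add: powr_powr)
      with fin show ?case by (simp add: v ennreal_leI)
    qed
  qed
  have Tfin: "AE w in M. T w < \<infinity>"
  proof (cases "p = 1")
    case True
    from T1[OF this] show ?thesis by eventually_elim (erule le_less_trans, simp)
  next
    case False
    \<comment> \<open>Finiteness of \<open>T\<close> must not depend on a given \<open>q\<close>,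
      which is universally quantified in the conclusion, so the conjugate exponent is exhibited
      here.\<close>
    define q where "q = p / (p - 1)"
    have "1 < p" "1 < q" "1 / p + 1 / q = 1" using False p by (auto simp: q_def field_simps)
    from Tq(2)[OF this] show ?thesis by eventually_elim simp
  qed
  show ?thesis
  proof
    show "N \<in> borel_measurable M" unfolding N_def by measurable
    show "0 \<le> N w" for w by (simp add: N_def)
    show "AE w in M. N w \<le> \<eta> w" if "p = 1"
      using T1[OF that]
    proof eventually_elim
      case (elim w)
      show ?case unfolding N_def using enn2real_mono[OF elim] \<eta>0[of w] by simp
    qed
    show "AE w in M. nnE (\<lambda>w. ennreal (N w powr q)) w \<le> ennreal (\<eta> w powr q)"
      if pq: "1 < p" "1 < q" "1 / p + 1 / q = 1" for q
    proof -
      have "AE w in M. nnE (\<lambda>w. ennreal (N w powr q)) w \<le> nnE (\<lambda>w. SUP n. ennreal (m n w powr q)) w"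
      proof (rule nn_cond_exp_mono)
        show "AE w in M. ennreal (N w powr q) \<le> (SUP n. ennreal (m n w powr q))"
          using Tq(2)[OF pq] by eventually_elim simp
        show "(\<lambda>w. ennreal (N w powr q)) \<in> borel_measurable M" unfolding N_def by measurable
      qed measurable
      with Tq(1)[OF pq] show ?thesis by eventually_elim simp
    qed
    fix x assume x [measurable]: "x \<in> carrier S"
    \<comment> \<open>Total division makes \<open>a\<close> vanish where \<open>nm x\<close> does,
      so \<open>scl a x\<close> lies in the unit ball; on that set \<open>ff_zero_on\<close> gives
      the final inequality.\<close>
    define a where "a w = (of_real (1 / nm x w) :: 'k)" for w
    have m: "a \<in> borel_measurable M" unfolding a_def by measurable
    have "AE w in M. nm (scl a x) w \<le> 1"
      using nm_scl[OF m x]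
    proof eventually_elim
      case (elim w)
      then show ?case by (cases "nm x w = 0") (auto simp: a_def norm_divide)
    qed
    then have "scl a x \<in> U" using m x by (simp add: U_def)
    then have "AE w in M. ennreal (norm (ff (scl a x) w)) \<le> (SUP n. s n w)"
      by (intro s(2)) (auto simp: H_def)
    then show "AE w in M. norm (ff x w) \<le> N w * nm x w"
      using Tfin ff_scl[OF m x] ff_zero_on[OF x]
    proof eventually_elim
      case (elim w)
      note elim(1)
      also have "(SUP n. s n w) \<le> T w"
        unfolding T_def X(2) by (rule SUP_mono) (auto intro: m_ge ennreal_leI)
      also have "T w = ennreal (N w)" using elim(2) by (simp add: N_def)
      finally have "norm (ff (scl a x) w) \<le> N w" by (simp add: ennreal_le_iff N_def)
      then show ?case using elim(3,4)
        by (cases "nm x w = 0") (auto simp: a_def norm_mult norm_divide divide_le_eq nm_nonneg less_le)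
    qed
  qed
qed

end
end

section \<open>Classes and norms\<close>

text \<open>The infimum of \<open>L0_order\<close> is a chosen greatest lower bound. It agrees with
  a smallest element of the set, because two classes below each other have almost everywhere equal
  representatives and so coincide.\<close>

lemma L0_inf_eq:
  assumes A: "A \<subseteq> L0 M" and Z: "Z \<in> A" and le: "\<And>X. X \<in> A \<Longrightarrow> L0_le M Z X"
  shows "\<Sqinter>\<^bsub>L0_order M\<^esub> A = Z"
proof -
  have Z0: "Z \<in> L0 M" using A Z by auto
  have "greatest (L0_order M) Z (Lower (L0_order M) A)"
    using A Z le by (auto simp: greatest_def Lower_def L0_order_def)
  then have g: "greatest (L0_order M) (\<Sqinter>\<^bsub>L0_order M\<^esub> A) (Lower (L0_order M) A)"
    unfolding inf_def by (rule someI)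
  then have X0: "\<Sqinter>\<^bsub>L0_order M\<^esub> A \<in> L0 M" and 1: "L0_le M (\<Sqinter>\<^bsub>L0_order M\<^esub> A) Z"
    using Z Z0 by (auto simp: greatest_def Lower_def L0_order_def)
  have 2: "L0_le M Z (\<Sqinter>\<^bsub>L0_order M\<^esub> A)"
    using g A Z le Z0 by (auto simp: greatest_def Lower_def L0_order_def)
  have "AE w in M. L0_rep (\<Sqinter>\<^bsub>L0_order M\<^esub> A) w = L0_rep Z w"
    using 1 2 unfolding L0_le_def by eventually_elim (rule antisym)
  from L0_class_cong[OF this L0_rep_measurable[OF X0] L0_rep_measurable[OF Z0]]
  show ?thesis by (simp add: L0_class_rep X0 Z0)
qed

lemma L0_map_class:
  assumes "f \<in> borel_measurable M" "h \<in> borel_measurable borel"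
  shows "L0_map M h (L0_class M f) = L0_class M (\<lambda>w. h (f w))"
  unfolding L0_map_def
proof (rule L0_class_cong)
  show "AE w in M. h (L0_rep (L0_class M f) w) = h (f w)"
    using L0_rep_class[OF assms(1)] by eventually_elim simp
  show "(\<lambda>w. h (L0_rep (L0_class M f) w)) \<in> borel_measurable M"
    by (rule measurable_compose[OF L0_rep_measurable[OF L0_class_in_L0[OF assms(1)]] assms(2)])
  show "(\<lambda>w. h (f w)) \<in> borel_measurable M" by (rule measurable_compose[OF assms])
qed

lemma L0_le_class:
  assumes "f \<in> borel_measurable M" "g \<in> borel_measurable M"
  shows "L0_le M (L0_class M f) (L0_class M g) \<longleftrightarrow> (AE w in M. f w \<le> g w)"
proof
  assume "L0_le M (L0_class M f) (L0_class M g)"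
  then show "AE w in M. f w \<le> g w"
    unfolding L0_le_def using L0_rep_class[OF assms(1)] L0_rep_class[OF assms(2)] by eventually_elim simp
next
  assume "AE w in M. f w \<le> g w"
  then show "L0_le M (L0_class M f) (L0_class M g)"
    unfolding L0_le_def using L0_rep_class[OF assms(1)] L0_rep_class[OF assms(2)] by eventually_elim simp
qed

text \<open>The measure and the module are arbitrary because this serves both \<open>S\<close> over
  \<open>M\<close> and the \<open>Lp\<close> module over \<open>FM\<close>.\<close>

lemma rn_bounds_class:
  fixes f :: "'s \<Rightarrow> ('w \<Rightarrow> 'k::{real_normed_field, euclidean_space}) set"
  assumes n [measurable]: "n \<in> borel_measurable M"
    and f: "\<And>x. x \<in> carrier T \<Longrightarrow> f x \<in> L0 M"
    and nu: "\<And>x. x \<in> carrier T \<Longrightarrow> \<nu> x \<in> borel_measurable M"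
      "\<And>x. x \<in> carrier T \<Longrightarrow> rnorm T x = L0_class M (\<nu> x)"
  shows "L0_class M n \<in> rn_bounds M T f \<longleftrightarrow>
    (AE w in M. 0 \<le> n w) \<and> (\<forall>x\<in>carrier T. AE w in M. norm (L0_rep (f x) w) \<le> n w * \<nu> x w)"
proof -
  have "L0_class M n \<in> L0_nonneg M \<longleftrightarrow> (AE w in M. 0 \<le> n w)"
  proof -
    have "(AE w in M. 0 \<le> L0_rep (L0_class M n) w) \<longleftrightarrow> (AE w in M. 0 \<le> n w)"
    proof
      assume "AE w in M. 0 \<le> L0_rep (L0_class M n) w"
      then show "AE w in M. 0 \<le> n w" using L0_rep_class[OF n] by eventually_elim simp
    next
      assume "AE w in M. 0 \<le> n w"
      then show "AE w in M. 0 \<le> L0_rep (L0_class M n) w" using L0_rep_class[OF n] by eventually_elim simp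
    qed
    then show ?thesis by (simp add: L0_nonneg_def L0_class_in_L0)
  qed
  moreover have "L0_le M (L0_map M norm (f x)) (L0_class M n \<otimes>\<^bsub>L0_ring M\<^esub> rnorm T x) \<longleftrightarrow>
      (AE w in M. norm (L0_rep (f x) w) \<le> n w * \<nu> x w)" if x: "x \<in> carrier T" for x
  proof -
    have [measurable]: "L0_rep (f x) \<in> borel_measurable M" "\<nu> x \<in> borel_measurable M"
      using f[OF x] nu(1)[OF x] by (auto intro: L0_rep_measurable)
    have "L0_map M norm (f x) = L0_class M (\<lambda>w. norm (L0_rep (f x) w))"
      by (simp add: L0_map_def)
    moreover have "L0_class M n \<otimes>\<^bsub>L0_ring M\<^esub> rnorm T x = L0_class M (\<lambda>w. n w * \<nu> x w)"
      unfolding nu(2)[OF x] by (rule L0_ring_mult_class) measurable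
    ultimately show ?thesis by (simp add: L0_le_class)
  qed
  ultimately show ?thesis unfolding rn_bounds_def by auto
qed

context prob_subalgebra
begin

abbreviation "FM \<equiv> restr_to_subalg M F"

lemma borel_measurable_FM: "(f \<in> borel_measurable FM) = (f \<in> borel_measurable F)"
  using measurable_in_subalg[OF subalg] measurable_in_subalg'[OF subalg] by blast

lemma L0_FM_rep_measurable: "X \<in> L0 FM \<Longrightarrow> L0_rep X \<in> borel_measurable F"
  using L0_rep_measurable[of X FM] by (simp add: borel_measurable_FM)

text \<open>Passing from \<open>M\<close> down to \<open>FM\<close> requires an exceptional set in
  \<open>F\<close>, which \<open>F\<close>-measurability of \<open>f\<close> and \<open>g\<close>
  provides.\<close>

lemma AE_FM_eq_iff:
  fixes f g :: "'w \<Rightarrow> 'b::{second_countable_topology, t2_space}"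
  assumes [measurable]: "f \<in> borel_measurable F" "g \<in> borel_measurable F"
  shows "(AE w in FM. f w = g w) \<longleftrightarrow> (AE w in M. f w = g w)"
proof
  assume "AE w in M. f w = g w"
  then show "AE w in FM. f w = g w"
    by (rule AE_restr_to_subalg2[OF subalg]) measurable
qed (rule AE_restr_to_subalg[OF subalg])

lemma AE_FM_le_iff:
  fixes f g :: "'w \<Rightarrow> 'b::{second_countable_topology, linorder_topology}"
  assumes [measurable]: "f \<in> borel_measurable F" "g \<in> borel_measurable F"
  shows "(AE w in FM. f w \<le> g w) \<longleftrightarrow> (AE w in M. f w \<le> g w)"
proof
  assume "AE w in M. f w \<le> g w"
  then show "AE w in FM. f w \<le> g w"
    by (rule AE_restr_to_subalg2[OF subalg]) measurable
qed (rule AE_restr_to_subalg[OF subalg])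

lemma L0_class_FM_cong:
  fixes f g :: "'w \<Rightarrow> 'b::{second_countable_topology, t2_space}"
  assumes "AE w in M. f w = g w" "f \<in> borel_measurable F" "g \<in> borel_measurable F"
  shows "L0_class FM f = L0_class FM g"
  using assms by (intro L0_class_cong) (auto simp: AE_FM_eq_iff borel_measurable_FM)

lemma L0_rep_class_FM:
  assumes "f \<in> borel_measurable F"
  shows "AE w in M. L0_rep (L0_class FM f) w = f w"
  by (rule AE_restr_to_subalg[OF subalg L0_rep_class]) (simp add: borel_measurable_FM assms)

lemma L0_incl_class:
  assumes "f \<in> borel_measurable F"
  shows "L0_incl M (L0_class FM f) = L0_class M f"
  unfolding L0_incl_def
proof (rule L0_class_cong)
  show "AE w in M. L0_rep (L0_class FM f) w = f w" by (rule L0_rep_class_FM[OF assms])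
  show "L0_rep (L0_class FM f) \<in> borel_measurable M"
    by (intro F_measurable L0_FM_rep_measurable L0_class_in_L0) (simp add: borel_measurable_FM assms)
  show "f \<in> borel_measurable M" by (rule F_measurable[OF assms])
qed

lemma L0_le_class_FM:
  fixes f g :: "'w \<Rightarrow> 'b::{second_countable_topology, linorder_topology}"
  assumes "f \<in> borel_measurable F" "g \<in> borel_measurable F"
  shows "L0_le FM (L0_class FM f) (L0_class FM g) \<longleftrightarrow> (AE w in M. f w \<le> g w)"
  using assms by (simp add: L0_le_class borel_measurable_FM AE_FM_le_iff)

lemma ennreal_powr_measurable [measurable]: "(\<lambda>x. ennreal_powr x r) \<in> borel_measurable borel"
  unfolding ennreal_powr_def by measurable

text \<open>The definition uses a chosen representative of the norm; the conditional expectation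
  does not notice the change to another one.\<close>

lemma cond_norm_class:
  fixes T :: "('w, 'k::{real_normed_field, euclidean_space}, 's) rn_module"
  assumes q: "q \<noteq> \<infinity>" and N: "rnorm T f = L0_class M N" and [measurable]: "N \<in> borel_measurable M"
  shows "cond_norm M F q T f = L0_class FM
     (\<lambda>w. ennreal_powr (nnE (\<lambda>v. ennreal (N v powr enn2real q)) w) (1 / enn2real q))"
proof -
  have [measurable]: "L0_rep (L0_class M N) \<in> borel_measurable M"
    by (simp add: L0_rep_measurable L0_class_in_L0)
  have "AE w in M. nnE (\<lambda>v. ennreal (L0_rep (L0_class M N) v powr enn2real q)) w =
      nnE (\<lambda>v. ennreal (N v powr enn2real q)) w"
  proof (rule nn_cond_exp_cong)
    show "AE v in M. ennreal (L0_rep (L0_class M N) v powr enn2real q) = ennreal (N v powr enn2real q)"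
      using L0_rep_class[OF \<open>N \<in> borel_measurable M\<close>] by eventually_elim simp
  qed measurable
  then have ae: "AE w in M. ennreal_powr (nnE (\<lambda>v. ennreal (L0_rep (L0_class M N) v powr enn2real q)) w) (1 / enn2real q) =
     ennreal_powr (nnE (\<lambda>v. ennreal (N v powr enn2real q)) w) (1 / enn2real q)"
    by eventually_elim simp
  show ?thesis unfolding cond_norm_def N using q
    by simp (intro L0_class_FM_cong ae[simplified]; measurable)
qed

text \<open>Countably many \<open>F\<close>-measurable majorants realise the essential infimum, and
  a countable infimum of majorants is again one. The infimum is thus a minimum, which
  \<open>L0_inf_eq\<close> identifies.\<close>

lemma cond_norm_inf_class:
  fixes T :: "('w, 'k::{real_normed_field, euclidean_space}, 's) rn_module"
  assumes N: "rnorm T f = L0_class M N" and N_meas [measurable]: "N \<in> borel_measurable M"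
  obtains \<kappa> where "\<kappa> \<in> borel_measurable F" "cond_norm M F \<infinity> T f = L0_class FM \<kappa>"
    "AE w in M. ennreal (N w) \<le> \<kappa> w"
    "\<And>\<xi>. \<lbrakk>\<xi> \<in> borel_measurable F; AE w in M. ennreal (N w) \<le> \<xi> w\<rbrakk> \<Longrightarrow> AE w in M. \<kappa> w \<le> \<xi> w"
proof -
  define H where "H = {\<xi> \<in> borel_measurable F. AE w in M. ennreal (N w) \<le> \<xi> w}"
  have "(\<lambda>_. \<infinity>) \<in> H" by (simp add: H_def)
  then have "H \<noteq> {}" by auto
  moreover have "H \<subseteq> borel_measurable M" by (auto simp: H_def intro: F_measurable)
  ultimately obtain s :: "nat \<Rightarrow> 'w \<Rightarrow> ennreal"
    where s: "range s \<subseteq> H" "\<And>h. h \<in> H \<Longrightarrow> AE w in M. (INF n. s n w) \<le> h w"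
    using ess_inf_countable[of H] by blast
  have sH: "s n \<in> borel_measurable F" "AE w in M. ennreal (N w) \<le> s n w" for n
  proof -
    have "s n \<in> H" using s(1) by auto
    then show "s n \<in> borel_measurable F" "AE w in M. ennreal (N w) \<le> s n w" by (auto simp: H_def)
  qed
  define \<kappa> where "\<kappa> w = (INF n. s n w)" for w
  have \<kappa> [measurable]: "\<kappa> \<in> borel_measurable F" unfolding \<kappa>_def using sH(1) by measurable
  have "AE w in M. \<forall>n. ennreal (N w) \<le> s n w" using sH(2) by (simp add: AE_all_countable)
  then have N\<kappa>: "AE w in M. ennreal (N w) \<le> \<kappa> w" unfolding \<kappa>_def by eventually_elim (auto intro: INF_greatest)
  have min: "AE w in M. \<kappa> w \<le> \<xi> w" if "\<xi> \<in> borel_measurable F" "AE w in M. ennreal (N w) \<le> \<xi> w" for \<xi>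
    using s(2)[of \<xi>] that by (simp add: H_def \<kappa>_def)
  let ?A = "{\<xi> \<in> L0 FM. L0_le M (L0_map M ennreal (rnorm T f)) (L0_incl M \<xi>)}"
  have mapN: "L0_map M ennreal (rnorm T f) = L0_class M (\<lambda>w. ennreal (N w))"
    unfolding N by (rule L0_map_class) measurable
  have memb: "L0_class FM \<xi> \<in> ?A \<longleftrightarrow> (AE w in M. ennreal (N w) \<le> \<xi> w)" if \<xi>: "\<xi> \<in> borel_measurable F" for \<xi>
    using \<xi> by (simp add: mapN L0_incl_class L0_le_class F_measurable L0_class_in_L0 borel_measurable_FM)
  have "\<Sqinter>\<^bsub>L0_order FM\<^esub> ?A = L0_class FM \<kappa>"
  proof (rule L0_inf_eq)
    show "L0_class FM \<kappa> \<in> ?A" using memb[OF \<kappa>] N\<kappa> by simp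
    fix X assume X: "X \<in> ?A"
    then have X0: "X \<in> L0 FM" by simp
    note m = L0_FM_rep_measurable[OF X0]
    have "AE w in M. ennreal (N w) \<le> L0_rep X w"
      using X memb[OF m] by (simp add: L0_class_rep X0)
    then have "AE w in M. \<kappa> w \<le> L0_rep X w" by (rule min[OF m])
    then have "L0_le FM (L0_class FM \<kappa>) (L0_class FM (L0_rep X))" using m by (simp add: L0_le_class_FM)
    then show "L0_le FM (L0_class FM \<kappa>) X" by (simp add: L0_class_rep X0)
  qed auto
  then have "cond_norm M F \<infinity> T f = L0_class FM \<kappa>" by (simp add: cond_norm_def)
  with \<kappa> N\<kappa> min show ?thesis using that by blast
qed

end

lemma ennreal_powr_le:
  assumes "x \<le> ennreal (t powr r)" "0 \<le> t" "0 < r"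
  shows "ennreal_powr x (1 / r) \<le> ennreal t"
proof -
  have "x < \<infinity>" using assms(1) by (rule le_less_trans) simp
  then have fin: "x \<noteq> \<infinity>" by auto
  have "enn2real x \<le> t powr r" using enn2real_mono[OF assms(1)] by simp
  then have "enn2real x powr (1 / r) \<le> (t powr r) powr (1 / r)" using assms by (intro powr_mono2) auto
  then show ?thesis using assms(2,3) fin by (simp add: ennreal_powr_def powr_powr ennreal_leI)
qed

lemma enn2real_ennreal_powr: "enn2real (ennreal_powr x r) = enn2real x powr r"
  by (simp add: ennreal_powr_def)

lemma ennreal_powr_less_top_iff: "ennreal_powr x r < \<infinity> \<longleftrightarrow> x < \<infinity>"
  by (simp add: ennreal_powr_def less_top[symmetric])

text \<open>Since \<open>1 / \<infinity> = 0\<close>, the equation forces \<open>p = 1\<close> when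
  \<open>q = \<infinity>\<close> and excludes \<open>p = 1\<close> for finite \<open>q\<close>; in
  the latter case it can be read in the reals.\<close>

lemma ennreal_conjugate_exponents:
  fixes p q :: ennreal
  assumes "1 \<le> p" "p < \<infinity>" "1 < q" "1 / p + 1 / q = 1"
  shows "p = ennreal (enn2real p)" "1 \<le> enn2real p"
    and "(enn2real p = 1 \<and> q = \<infinity>) \<or>
      (1 < enn2real p \<and> 1 < enn2real q \<and> q \<noteq> \<infinity> \<and> 1 / enn2real p + 1 / enn2real q = 1)"
proof -
  obtain r where r: "p = ennreal r" "0 \<le> r" using assms(2) by (cases p) auto
  then have r1: "1 \<le> r" using assms(1) by (simp add: ennreal_1[symmetric] del: ennreal_1)
  show "p = ennreal (enn2real p)" "1 \<le> enn2real p" using r r1 by auto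
  have p: "1 / p = ennreal (1 / r)"
    using r r1 divide_ennreal[of 1 r] by simp
  show "(enn2real p = 1 \<and> q = \<infinity>) \<or>
      (1 < enn2real p \<and> 1 < enn2real q \<and> q \<noteq> \<infinity> \<and> 1 / enn2real p + 1 / enn2real q = 1)"
  proof (cases q)
    case top
    then have "ennreal (1 / r) = ennreal 1" using assms(4) p by simp
    then have "1 / r = 1" using r1 by (subst (asm) ennreal_inj) auto
    then show ?thesis using top r by simp
  next
    case (real s)
    then have s: "1 < s" using assms(3) by (simp add: ennreal_1[symmetric] ennreal_less_iff del: ennreal_1)
    have "1 / q = ennreal (1 / s)" using real s divide_ennreal[of 1 s] by simp
    then have "ennreal (1 / r + 1 / s) = ennreal 1" using assms(4) p r1 s by (simp add: ennreal_plus)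
    then have eq: "1 / r + 1 / s = 1" using r1 s by (subst (asm) ennreal_inj) auto
    moreover have "r \<noteq> 1" using eq s by auto
    ultimately show ?thesis using real s r r1 by auto
  qed
qed

context prob_subalgebra
begin

text \<open>This hides the distinction between \<open>q < \<infinity>\<close> and \<open>q = \<infinity>\<close>: for \<open>\<kappa> = |||f|||\<^sub>q\<close> it gives Hoelder's
  inequality and the bound \<open>\<kappa> \<le> \<eta>\<close> whenever the estimates of \<open>dual_norm_exists\<close> hold for some \<open>N' \<ge> \<parallel>f\<parallel>\<^sup>*\<close>.\<close>

lemma conjugate_cond_norm:
  fixes T :: "('w, 'k::{real_normed_field, euclidean_space}, 's) rn_module" and p q :: ennreal
  defines "r \<equiv> enn2real p"
  assumes pq: "1 \<le> p" "p < \<infinity>" "1 < q" "1 / p + 1 / q = 1"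
    and N: "rnorm T f = L0_class M N" and N_meas [measurable]: "N \<in> borel_measurable M" and N0: "\<And>w. 0 \<le> N w"
  obtains \<kappa> where "\<kappa> \<in> borel_measurable F" "cond_norm M F q T f = L0_class FM \<kappa>"
    "\<And>u. \<lbrakk>u \<in> borel_measurable M; \<And>w. 0 \<le> u w; AE w in M. nnE (\<lambda>w. ennreal (u w powr r)) w < \<infinity>;
        AE w in M. \<kappa> w < \<infinity>\<rbrakk> \<Longrightarrow>
      AE w in M. nnE (\<lambda>w. ennreal (N w * u w)) w \<le>
        ennreal (enn2real (\<kappa> w) * enn2real (nnE (\<lambda>w. ennreal (u w powr r)) w) powr (1 / r))"
    "\<And>\<eta> N'. \<lbrakk>\<eta> \<in> borel_measurable F; N' \<in> borel_measurable M; \<And>w. 0 \<le> \<eta> w; AE w in M. N w \<le> N' w;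
        r = 1 \<Longrightarrow> AE w in M. N' w \<le> \<eta> w;
        \<And>s. \<lbrakk>1 < r; 1 < s; 1 / r + 1 / s = 1\<rbrakk> \<Longrightarrow>
          AE w in M. nnE (\<lambda>w. ennreal (N' w powr s)) w \<le> ennreal (\<eta> w powr s)\<rbrakk> \<Longrightarrow>
      AE w in M. \<kappa> w \<le> ennreal (\<eta> w)"
proof -
  consider (inf) "r = 1" "q = \<infinity>" | (fin) "1 < r" "1 < enn2real q" "q \<noteq> \<infinity>" "1 / r + 1 / enn2real q = 1"
    using ennreal_conjugate_exponents(3)[OF pq] unfolding r_def by blast
  then show ?thesis
  proof cases
    case inf
    obtain \<kappa> where \<kappa> [measurable]: "\<kappa> \<in> borel_measurable F" and c: "cond_norm M F \<infinity> T f = L0_class FM \<kappa>"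
      and N\<kappa>: "AE w in M. ennreal (N w) \<le> \<kappa> w"
      and min: "\<And>\<xi>. \<lbrakk>\<xi> \<in> borel_measurable F; AE w in M. ennreal (N w) \<le> \<xi> w\<rbrakk> \<Longrightarrow> AE w in M. \<kappa> w \<le> \<xi> w"
      using cond_norm_inf_class[of T f N, OF N N_meas] by blast
    show ?thesis
    proof (rule that[OF \<kappa>])
      show "cond_norm M F q T f = L0_class FM \<kappa>" using c inf by simp
    next
      fix u :: "'w \<Rightarrow> real" assume [measurable]: "u \<in> borel_measurable M" and u0: "\<And>w. 0 \<le> u w"
        and fin: "AE w in M. nnE (\<lambda>w. ennreal (u w powr r)) w < \<infinity>" "AE w in M. \<kappa> w < \<infinity>"
      have "AE w in M. nnE (\<lambda>w. ennreal (N w * u w)) w \<le> nnE (\<lambda>w. \<kappa> w * ennreal (u w)) w"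
      proof (rule nn_cond_exp_mono)
        show "AE w in M. ennreal (N w * u w) \<le> \<kappa> w * ennreal (u w)"
          using N\<kappa> by eventually_elim (simp add: ennreal_mult' N0 mult_right_mono)
      qed measurable
      \<comment> \<open>In the endpoint case \<open>\<kappa>\<close> is an
        \<open>F\<close>-measurable majorant of \<open>N\<close> and leaves the conditional
        expectation as a whole.\<close>
      moreover have "AE w in M. \<kappa> w * nnE (\<lambda>w. ennreal (u w)) w = nnE (\<lambda>w. \<kappa> w * ennreal (u w)) w"
        by (rule nn_cond_exp_prod) measurable
      ultimately show "AE w in M. nnE (\<lambda>w. ennreal (N w * u w)) w \<le>
        ennreal (enn2real (\<kappa> w) * enn2real (nnE (\<lambda>w. ennreal (u w powr r)) w) powr (1 / r))"
        using fin
      proof eventually_elim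
        case (elim w)
        have u1: "(\<lambda>w. ennreal (u w powr r)) = (\<lambda>w. ennreal (u w))" using u0 inf by simp
        have "\<kappa> w * nnE (\<lambda>w. ennreal (u w)) w =
            ennreal (enn2real (\<kappa> w)) * ennreal (enn2real (nnE (\<lambda>w. ennreal (u w)) w))"
          using elim(3,4) unfolding u1 by simp
        then show ?case using elim(1,2) inf unfolding u1 by (simp add: ennreal_mult')
      qed
    next
      fix \<eta> N' assume "\<eta> \<in> borel_measurable F" "AE w in M. N w \<le> N' w" "r = 1 \<Longrightarrow> AE w in M. N' w \<le> \<eta> w"
      note * = this
      have "AE w in M. ennreal (N w) \<le> ennreal (\<eta> w)"
        using *(2) *(3)[OF inf(1)] by eventually_elim (auto intro: ennreal_leI)
      then show "AE w in M. \<kappa> w \<le> ennreal (\<eta> w)" using *(1) by (intro min) auto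
    qed
  next
    case fin
    let ?s = "enn2real q"
    define \<kappa> where "\<kappa> w = ennreal_powr (nnE (\<lambda>v. ennreal (N v powr ?s)) w) (1 / ?s)" for w
    have \<kappa> [measurable]: "\<kappa> \<in> borel_measurable F" unfolding \<kappa>_def by measurable
    show ?thesis
    proof (rule that[OF \<kappa>])
      show "cond_norm M F q T f = L0_class FM \<kappa>"
        unfolding \<kappa>_def by (rule cond_norm_class[OF fin(3) N N_meas])
    next
      fix u :: "'w \<Rightarrow> real" assume u [measurable]: "u \<in> borel_measurable M" and u0: "\<And>w. 0 \<le> u w"
        and fu: "AE w in M. nnE (\<lambda>w. ennreal (u w powr r)) w < \<infinity>" and f\<kappa>: "AE w in M. \<kappa> w < \<infinity>"
      have "AE w in M. nnE (\<lambda>w. ennreal (N w powr ?s)) w < \<infinity>"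
        using f\<kappa> unfolding \<kappa>_def ennreal_powr_less_top_iff .
      from nn_cond_exp_Hoelder[OF fin(1,2,4) u N_meas u0 N0 fu this]
      show "AE w in M. nnE (\<lambda>w. ennreal (N w * u w)) w \<le>
        ennreal (enn2real (\<kappa> w) * enn2real (nnE (\<lambda>w. ennreal (u w powr r)) w) powr (1 / r))"
        unfolding \<kappa>_def enn2real_ennreal_powr by (simp add: mult.commute)
    next
      fix \<eta> N' assume [measurable]: "\<eta> \<in> borel_measurable F" "N' \<in> borel_measurable M" and \<eta>0: "\<And>w. 0 \<le> \<eta> w"
        and NN': "AE w in M. N w \<le> N' w"
        and b: "\<And>s. \<lbrakk>1 < r; 1 < s; 1 / r + 1 / s = 1\<rbrakk> \<Longrightarrow>
          AE w in M. nnE (\<lambda>w. ennreal (N' w powr s)) w \<le> ennreal (\<eta> w powr s)"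
      have "AE w in M. nnE (\<lambda>w. ennreal (N w powr ?s)) w \<le> nnE (\<lambda>w. ennreal (N' w powr ?s)) w"
      proof (rule nn_cond_exp_mono)
        show "AE w in M. ennreal (N w powr ?s) \<le> ennreal (N' w powr ?s)"
          using NN' by eventually_elim (use fin N0 in \<open>auto intro!: ennreal_leI powr_mono2\<close>)
      qed measurable
      then show "AE w in M. \<kappa> w \<le> ennreal (\<eta> w)"
        using b[OF fin(1,2,4)]
      proof eventually_elim
        case (elim w)
        then show ?case unfolding \<kappa>_def using \<eta>0[of w] fin(2) by (intro ennreal_powr_le) auto
      qed
    qed
  qed
qed

end

context random_normed_module
begin

lemma conjugateD:
  assumes f: "f \<in> carrier (random_conjugate M S)"
  shows "x \<in> carrier S \<Longrightarrow> f x \<in> L0 M"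
    and "x \<in> carrier S \<Longrightarrow> L0_rep (f x) \<in> borel_measurable M"
    and "\<lbrakk>x \<in> carrier S; y \<in> carrier S\<rbrakk> \<Longrightarrow> AE w in M. L0_rep (f (x \<oplus> y)) w = L0_rep (f x) w + L0_rep (f y) w"
    and "\<lbrakk>a \<in> borel_measurable M; x \<in> carrier S\<rbrakk> \<Longrightarrow> AE w in M. L0_rep (f (scl a x)) w = a w * L0_rep (f x) w"
proof -
  have fL: "f x \<in> L0 M" if "x \<in> carrier S" for x
    using f that by (auto simp: random_conjugate_def)
  then show "x \<in> carrier S \<Longrightarrow> f x \<in> L0 M" .
  have m: "L0_rep (f x) \<in> borel_measurable M" if "x \<in> carrier S" for x
    using fL[OF that] by (rule L0_rep_measurable)
  then show "x \<in> carrier S \<Longrightarrow> L0_rep (f x) \<in> borel_measurable M" .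
  { assume x: "x \<in> carrier S" and y: "y \<in> carrier S"
    have "f (x \<oplus> y) = L0_class M (\<lambda>w. L0_rep (f x) w + L0_rep (f y) w)"
      using f x y by (auto simp: random_conjugate_def L0_ring_def)
    then show "AE w in M. L0_rep (f (x \<oplus> y)) w = L0_rep (f x) w + L0_rep (f y) w"
      using m[OF x] m[OF y] by (simp add: L0_rep_class) }
  { assume a: "a \<in> borel_measurable M" and x: "x \<in> carrier S"
    have "f (scl a x) = L0_class M a \<otimes>\<^bsub>L0_ring M\<^esub> f x"
      using f x a unfolding scl_def by (auto simp: random_conjugate_def L0_class_in_L0)
    also have "f x = L0_class M (L0_rep (f x))" using fL[OF x] by (simp add: L0_class_rep)
    also have "L0_class M a \<otimes>\<^bsub>L0_ring M\<^esub> L0_class M (L0_rep (f x)) = L0_class M (\<lambda>w. a w * L0_rep (f x) w)"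
      by (rule L0_ring_mult_class[OF a m[OF x]])
    finally show "AE w in M. L0_rep (f (scl a x)) w = a w * L0_rep (f x) w"
      using a m[OF x] by (simp add: L0_rep_class) }
qed

text \<open>The infimum defining the norm is attained: countably many bounds realise the essential
  infimum, and their pointwise infimum is still a bound. Where \<open>nm x\<close> is positive one
  divides by it; where it is 0, all bounds say the same.\<close>

lemma conjugate_norm:
  assumes f: "f \<in> carrier (random_conjugate M S)"
  obtains N where "N \<in> borel_measurable M" "\<And>w. 0 \<le> N w" "rnorm (random_conjugate M S) f = L0_class M N"
    "\<And>x. x \<in> carrier S \<Longrightarrow> AE w in M. norm (L0_rep (f x) w) \<le> N w * nm x w"
    "\<And>N'. \<lbrakk>N' \<in> borel_measurable M; \<And>w. 0 \<le> N' w;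
        \<And>x. x \<in> carrier S \<Longrightarrow> AE w in M. norm (L0_rep (f x) w) \<le> N' w * nm x w\<rbrakk> \<Longrightarrow> AE w in M. N w \<le> N' w"
proof -
  let ?B = "rn_bounds M S f"
  note bc = rn_bounds_class[of _ M S f nm, OF _ conjugateD(1)[OF f] nm_measurable rnorm_eq]
  define H where "H = (\<lambda>\<xi> w. ennreal (L0_rep \<xi> w)) ` ?B"
  have BL: "\<xi> \<in> L0 M" if "\<xi> \<in> ?B" for \<xi> using that by (auto simp: rn_bounds_def L0_nonneg_def)
  have Bm: "L0_rep \<xi> \<in> borel_measurable M" if "\<xi> \<in> ?B" for \<xi>
    using BL[OF that] by (rule L0_rep_measurable)
  have Bb: "AE w in M. 0 \<le> L0_rep \<xi> w" "x \<in> carrier S \<Longrightarrow> AE w in M. norm (L0_rep (f x) w) \<le> L0_rep \<xi> w * nm x w"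
    if "\<xi> \<in> ?B" for \<xi> x
    using bc[OF Bm[OF that]] that by (auto simp: L0_class_rep BL)
  have "?B \<noteq> {}" using f by (simp add: random_conjugate_def)
  then have "H \<noteq> {}" by (simp add: H_def)
  moreover have "H \<subseteq> borel_measurable M" using Bm by (auto simp: H_def)
  ultimately obtain s :: "nat \<Rightarrow> 'w \<Rightarrow> ennreal"
    where s: "range s \<subseteq> H" "\<And>h. h \<in> H \<Longrightarrow> AE w in M. (INF n. s n w) \<le> h w"
    using ess_inf_countable[of H] by blast
  have "\<exists>\<xi>\<in>?B. s n = (\<lambda>w. ennreal (L0_rep \<xi> w))" for n
  proof -
    have "s n \<in> H" using s(1) by auto
    then show ?thesis by (auto simp: H_def)
  qed
  then obtain X where X: "\<And>n. X n \<in> ?B" "\<And>n. s n = (\<lambda>w. ennreal (L0_rep (X n) w))" by metis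
  have [measurable]: "s n \<in> borel_measurable M" for n
    using Bm[OF X(1)] by (simp add: X(2))
  define N where "N w = enn2real (INF n. s n w)" for w
  have N [measurable]: "N \<in> borel_measurable M" unfolding N_def by measurable
  have N0: "0 \<le> N w" for w by (simp add: N_def)
  have fin: "(INF n. s n w) = ennreal (N w)" for w
  proof -
    have "(INF n. s n w) \<le> s 0 w" by (rule INF_lower) simp
    also have "s 0 w < \<infinity>" by (simp add: X(2))
    finally show ?thesis by (simp add: N_def)
  qed
  have Nb: "AE w in M. norm (L0_rep (f x) w) \<le> N w * nm x w" if x: "x \<in> carrier S" for x
  proof -
    have "AE w in M. \<forall>n. 0 \<le> L0_rep (X n) w" using Bb(1)[OF X(1)] by (simp add: AE_all_countable)
    moreover have "AE w in M. \<forall>n. norm (L0_rep (f x) w) \<le> L0_rep (X n) w * nm x w"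
      using Bb(2)[OF X(1) x] by (simp add: AE_all_countable)
    ultimately show ?thesis
    proof eventually_elim
      case (elim w)
      show ?case
      proof (cases "nm x w = 0")
        case True
        then show ?thesis using elim(2) by simp
      next
        case False
        then have pos: "0 < nm x w" using nm_nonneg[of x w] by linarith
        have "ennreal (norm (L0_rep (f x) w) / nm x w) \<le> (INF n. s n w)"
        proof (rule INF_greatest)
          fix n
          show "ennreal (norm (L0_rep (f x) w) / nm x w) \<le> s n w"
            using elim pos by (auto simp: X(2) divide_le_eq intro!: ennreal_leI)
        qed
        then have "norm (L0_rep (f x) w) / nm x w \<le> N w"
          unfolding fin using N0[of w] by (simp add: ennreal_le_iff)
        then show ?thesis using pos by (simp add: divide_le_eq)
      qed
    qed
  qed
  have NB: "L0_class M N \<in> ?B" using bc[OF N] N0 Nb by simp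
  have min: "AE w in M. N w \<le> L0_rep \<xi> w" if \<xi>: "\<xi> \<in> ?B" for \<xi>
  proof -
    have "AE w in M. (INF n. s n w) \<le> ennreal (L0_rep \<xi> w)" using \<xi> by (intro s(2)) (auto simp: H_def)
    with Bb(1)[OF \<xi>] show ?thesis unfolding fin by eventually_elim (simp add: ennreal_le_iff)
  qed
  have "rnorm (random_conjugate M S) f = \<Sqinter>\<^bsub>L0_order M\<^esub> ?B" by (simp add: random_conjugate_def)
  also have "\<dots> = L0_class M N"
  proof (rule L0_inf_eq[OF _ NB])
    show "?B \<subseteq> L0 M" using BL by auto
    fix X assume X: "X \<in> ?B"
    have "L0_le M (L0_class M N) (L0_class M (L0_rep X))"
      using min[OF X] Bm[OF X] by (simp add: L0_le_class)
    then show "L0_le M (L0_class M N) X" by (simp add: L0_class_rep BL X)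
  qed
  finally have eq: "rnorm (random_conjugate M S) f = L0_class M N" .
  show ?thesis
  proof (rule that[OF N N0 eq Nb])
    fix N' :: "'w \<Rightarrow> real" assume N': "N' \<in> borel_measurable M" "\<And>w. 0 \<le> N' w"
      "\<And>x. x \<in> carrier S \<Longrightarrow> AE w in M. norm (L0_rep (f x) w) \<le> N' w * nm x w"
    then have "L0_class M N' \<in> ?B" using bc[OF N'(1)] by simp
    from min[OF this] L0_rep_class[OF N'(1)] show "AE w in M. N w \<le> N' w" by eventually_elim simp
  qed
qed

end

section \<open>The \<open>Lp\<close> module in concrete terms, and the norm of an element of the
  conjugate module\<close>

context cond_Lp_module
begin

abbreviation "LpS \<equiv> cond_Lp M F (ennreal p) S"

lemma cond_norm_p:
  assumes "x \<in> carrier S"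
  shows "cond_norm M F (ennreal p) S x = L0_class FM (\<lambda>w. ennreal_powr (cpow x w) (1 / p))"
  using cond_norm_class[OF _ rnorm_eq[OF assms] nm_measurable[OF assms], of "ennreal p"] p
  by (simp add: cpow_def)

lemma cond_Lp_carrier: "carrier LpS = Lp"
proof -
  have "(AE w in M. L0_rep (cond_norm M F (ennreal p) S x) w < \<infinity>) \<longleftrightarrow> (AE w in M. cpow x w < \<infinity>)"
    if x: "x \<in> carrier S" for x
  proof -
    have "AE w in M. L0_rep (cond_norm M F (ennreal p) S x) w = ennreal_powr (cpow x w) (1 / p)"
      unfolding cond_norm_p[OF x] by (rule L0_rep_class_FM) measurable
    then have "AE w in M. (L0_rep (cond_norm M F (ennreal p) S x) w < \<infinity>) = (cpow x w < \<infinity>)"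
      by eventually_elim (simp add: ennreal_powr_less_top_iff del: infinity_ennreal_def)
    then show ?thesis by (rule eventually_cong)
  qed
  then show ?thesis
    unfolding Lp_def cond_Lp_def by (simp del: infinity_ennreal_def cong: conj_cong)
qed

lemma cond_Lp_rnorm:
  assumes "x \<in> carrier S"
  shows "rnorm LpS x = L0_class FM (Lp_norm x)"
proof -
  have "rnorm LpS x = L0_map FM enn2real (L0_class FM (\<lambda>w. ennreal_powr (cpow x w) (1 / p)))"
    by (simp add: cond_Lp_def cond_norm_p[OF assms])
  also have "\<dots> = L0_class FM (\<lambda>w. enn2real (ennreal_powr (cpow x w) (1 / p)))"
    by (rule L0_map_class) (simp_all add: borel_measurable_FM)
  finally show ?thesis by (simp add: enn2real_ennreal_powr Lp_norm_def[abs_def])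
qed

lemma cond_Lp_add: "x \<oplus>\<^bsub>LpS\<^esub> y = x \<oplus> y"
  by (simp add: cond_Lp_def)

text \<open>An \<open>F\<close>-measurable function represents both its class over \<open>FM\<close>
  and the image of that class under \<open>L0_incl\<close>.\<close>

lemma cond_Lp_smult: "a \<in> borel_measurable F \<Longrightarrow> L0_class FM a \<odot>\<^bsub>LpS\<^esub> x = scl a x"
  by (simp add: cond_Lp_def L0_incl_class scl_def)

lemma Lp_bounds_class:
  assumes n: "n \<in> borel_measurable F" and \<Phi>: "\<And>g. g \<in> Lp \<Longrightarrow> \<Phi> g \<in> L0 FM"
  shows "L0_class FM n \<in> rn_bounds FM LpS \<Phi> \<longleftrightarrow>
    (AE w in M. 0 \<le> n w) \<and> (\<forall>g\<in>Lp. AE w in M. norm (L0_rep (\<Phi> g) w) \<le> n w * Lp_norm g w)"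
proof -
  have "L0_class FM n \<in> rn_bounds FM LpS \<Phi> \<longleftrightarrow>
    (AE w in FM. 0 \<le> n w) \<and> (\<forall>g\<in>carrier LpS. AE w in FM. norm (L0_rep (\<Phi> g) w) \<le> n w * Lp_norm g w)"
    using n \<Phi> by (intro rn_bounds_class)
      (auto simp: borel_measurable_FM cond_Lp_carrier cond_Lp_rnorm Lp_carrier)
  also have "(AE w in FM. 0 \<le> n w) \<longleftrightarrow> (AE w in M. 0 \<le> n w)"
    using n by (intro AE_FM_le_iff) auto
  also have "(\<forall>g\<in>carrier LpS. AE w in FM. norm (L0_rep (\<Phi> g) w) \<le> n w * Lp_norm g w) \<longleftrightarrow>
      (\<forall>g\<in>Lp. AE w in M. norm (L0_rep (\<Phi> g) w) \<le> n w * Lp_norm g w)"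
    unfolding cond_Lp_carrier
  proof (rule ball_cong[OF refl])
    fix g assume "g \<in> Lp"
    have [measurable]: "L0_rep (\<Phi> g) \<in> borel_measurable F" using \<Phi>[OF \<open>g \<in> Lp\<close>] by (rule L0_FM_rep_measurable)
    note [measurable] = n
    show "(AE w in FM. norm (L0_rep (\<Phi> g) w) \<le> n w * Lp_norm g w) \<longleftrightarrow> (AE w in M. norm (L0_rep (\<Phi> g) w) \<le> n w * Lp_norm g w)"
      by (rule AE_FM_le_iff) measurable
  qed
  finally show ?thesis .
qed

text \<open>A bound is nonnegative only almost everywhere, while the locale asks for it everywhere;
  hence the maximum with 0.\<close>

lemma Lp_conjugate_functional:
  assumes \<Phi>: "\<Phi> \<in> carrier (random_conjugate FM LpS)" and \<xi>: "\<xi> \<in> rn_bounds FM LpS \<Phi>"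
  shows "Lp_functional M F S p (\<lambda>g. L0_rep (\<Phi> g)) (\<lambda>w. max 0 (L0_rep \<xi> w))"
proof -
  have L: "\<Phi> g \<in> L0 FM" if "g \<in> Lp" for g
    using \<Phi> that by (auto simp: random_conjugate_def cond_Lp_carrier)
  have m: "L0_rep (\<Phi> g) \<in> borel_measurable F" if "g \<in> Lp" for g
    using L[OF that] by (rule L0_FM_rep_measurable)
  have \<xi>L: "\<xi> \<in> L0 FM" using \<xi> by (auto simp: rn_bounds_def L0_nonneg_def)
  note \<xi>m = L0_FM_rep_measurable[OF \<xi>L]
  show ?thesis
  proof (unfold_locales)
    show "g \<in> Lp \<Longrightarrow> L0_rep (\<Phi> g) \<in> borel_measurable F" for g by (rule m)
    show "(\<lambda>w. max 0 (L0_rep \<xi> w)) \<in> borel_measurable F" using \<xi>m by measurable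
    show "0 \<le> max 0 (L0_rep \<xi> w)" for w by simp
  next
    fix g h assume g: "g \<in> Lp" and h: "h \<in> Lp"
    have "\<Phi> (g \<oplus> h) = L0_class FM (\<lambda>w. L0_rep (\<Phi> g) w + L0_rep (\<Phi> h) w)"
      using \<Phi> g h by (auto simp: random_conjugate_def cond_Lp_carrier cond_Lp_add L0_ring_def)
    then show "AE w in M. L0_rep (\<Phi> (g \<oplus> h)) w = L0_rep (\<Phi> g) w + L0_rep (\<Phi> h) w"
      using m[OF g] m[OF h] by (simp add: L0_rep_class_FM)
  next
    fix a :: "'w \<Rightarrow> 'k" and g assume a: "a \<in> borel_measurable F" and g: "g \<in> Lp"
    have aL: "L0_class FM a \<in> L0 FM" using a by (simp add: L0_class_in_L0 borel_measurable_FM)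
    have "\<Phi> (scl a g) = L0_class FM a \<otimes>\<^bsub>L0_ring FM\<^esub> \<Phi> g"
      using \<Phi> g aL by (auto simp: random_conjugate_def cond_Lp_carrier cond_Lp_smult[OF a, symmetric])
    also have "\<Phi> g = L0_class FM (L0_rep (\<Phi> g))" using L[OF g] by (simp add: L0_class_rep)
    also have "L0_class FM a \<otimes>\<^bsub>L0_ring FM\<^esub> L0_class FM (L0_rep (\<Phi> g)) = L0_class FM (\<lambda>w. a w * L0_rep (\<Phi> g) w)"
      by (rule L0_ring_mult_class) (simp_all add: borel_measurable_FM a m[OF g])
    finally show "AE w in M. L0_rep (\<Phi> (scl a g)) w = a w * L0_rep (\<Phi> g) w"
      using a m[OF g] by (simp add: L0_rep_class_FM)
  next
    fix g assume g: "g \<in> Lp"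
    have "AE w in M. norm (L0_rep (\<Phi> g) w) \<le> L0_rep \<xi> w * Lp_norm g w"
      using Lp_bounds_class[OF \<xi>m L] \<xi> g by (simp add: L0_class_rep \<xi>L)
    then show "AE w in M. norm (L0_rep (\<Phi> g) w) \<le> max 0 (L0_rep \<xi> w) * Lp_norm g w"
      by eventually_elim (erule order_trans, intro mult_right_mono, auto)
  qed
qed

context
  fixes q :: ennreal
  assumes q: "1 < q" "1 / ennreal p + 1 / q = 1"
begin

lemma exponents: "1 \<le> ennreal p" "ennreal p < \<infinity>" "1 < q" "1 / ennreal p + 1 / q = 1"
  using p q by (auto simp: ennreal_1[symmetric] simp del: ennreal_1)

text \<open>Covers the whole conjugate module, before \<open>f\<close> is known to lie in the
  \<open>q\<close>-module. The clauses under finiteness of \<open>\<kappa>\<close> express Hoelder's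
  inequality. The last is its converse, which gives finiteness for surjectivity and minimality for
  norm preservation.\<close>

lemma conjugate_element:
  assumes f: "f \<in> carrier (random_conjugate M S)"
  obtains \<kappa> where "\<kappa> \<in> borel_measurable F" "cond_norm M F q (random_conjugate M S) f = L0_class FM \<kappa>"
    "\<And>g. \<lbrakk>AE w in M. \<kappa> w < \<infinity>; g \<in> Lp\<rbrakk> \<Longrightarrow> cond_integrable (L0_rep (f g))"
    "\<And>g. \<lbrakk>AE w in M. \<kappa> w < \<infinity>; g \<in> Lp\<rbrakk> \<Longrightarrow>
        AE w in M. norm (condE (L0_rep (f g)) w) \<le> enn2real (\<kappa> w) * Lp_norm g w"
    "\<And>\<eta>. \<lbrakk>\<eta> \<in> borel_measurable F; \<And>w. 0 \<le> \<eta> w; \<And>g. g \<in> Lp \<Longrightarrow> cond_integrable (L0_rep (f g));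
        \<And>g. g \<in> Lp \<Longrightarrow> AE w in M. norm (condE (L0_rep (f g)) w) \<le> \<eta> w * Lp_norm g w\<rbrakk> \<Longrightarrow>
        AE w in M. \<kappa> w \<le> ennreal (\<eta> w)"
proof -
  note fD = conjugateD[OF f]
  obtain N where N [measurable]: "N \<in> borel_measurable M" and N0: "\<And>w. 0 \<le> N w"
    and rN: "rnorm (random_conjugate M S) f = L0_class M N"
    and Nb: "\<And>x. x \<in> carrier S \<Longrightarrow> AE w in M. norm (L0_rep (f x) w) \<le> N w * nm x w"
    and Nmin: "\<And>N'. \<lbrakk>N' \<in> borel_measurable M; \<And>w. 0 \<le> N' w;
        \<And>x. x \<in> carrier S \<Longrightarrow> AE w in M. norm (L0_rep (f x) w) \<le> N' w * nm x w\<rbrakk> \<Longrightarrow> AE w in M. N w \<le> N' w"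
    using conjugate_norm[OF f] by blast
  have r: "enn2real (ennreal p) = p" using p by simp
  show ?thesis
  proof (rule conjugate_cond_norm[OF exponents rN N N0, unfolded r])
    fix \<kappa> assume \<kappa> [measurable]: "\<kappa> \<in> borel_measurable F"
      and c: "cond_norm M F q (random_conjugate M S) f = L0_class FM \<kappa>"
      and hoelder: "\<And>u. \<lbrakk>u \<in> borel_measurable M; \<And>w. 0 \<le> u w; AE w in M. nnE (\<lambda>w. ennreal (u w powr p)) w < \<infinity>;
          AE w in M. \<kappa> w < \<infinity>\<rbrakk> \<Longrightarrow>
        AE w in M. nnE (\<lambda>w. ennreal (N w * u w)) w \<le>
          ennreal (enn2real (\<kappa> w) * enn2real (nnE (\<lambda>w. ennreal (u w powr p)) w) powr (1 / p))"
      and min: "\<And>\<eta> N'. \<lbrakk>\<eta> \<in> borel_measurable F; N' \<in> borel_measurable M; \<And>w. 0 \<le> \<eta> w; AE w in M. N w \<le> N' w;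
          p = 1 \<Longrightarrow> AE w in M. N' w \<le> \<eta> w;
          \<And>s. \<lbrakk>1 < p; 1 < s; 1 / p + 1 / s = 1\<rbrakk> \<Longrightarrow>
            AE w in M. nnE (\<lambda>w. ennreal (N' w powr s)) w \<le> ennreal (\<eta> w powr s)\<rbrakk> \<Longrightarrow>
        AE w in M. \<kappa> w \<le> ennreal (\<eta> w)"
    have NE: "AE w in M. nnE (\<lambda>w. ennreal (N w * nm g w)) w \<le> ennreal (enn2real (\<kappa> w) * Lp_norm g w)"
      if "AE w in M. \<kappa> w < \<infinity>" "g \<in> Lp" for g
      using hoelder[OF nm_measurable nm_nonneg _ that(1), of g] that(2)
      by (simp add: Lp_def Lp_norm_def cpow_def)
    have ci: "cond_integrable (L0_rep (f g))" if "AE w in M. \<kappa> w < \<infinity>" "g \<in> Lp" for g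
    proof (rule cond_integrable_bound[OF _ Nb[OF Lp_carrier[OF that(2)]]])
      show "AE w in M. nnE (\<lambda>v. ennreal (N v * nm g v)) w < \<infinity>"
        using NE[OF that] by eventually_elim (erule le_less_trans, simp)
      show "(\<lambda>w. N w * nm g w) \<in> borel_measurable M" using Lp_carrier[OF that(2)] by measurable
      show "L0_rep (f g) \<in> borel_measurable M" by (rule fD(2)[OF Lp_carrier[OF that(2)]])
    qed
    show ?thesis
    proof (rule that[OF \<kappa> c ci])
      fix g assume fin: "AE w in M. \<kappa> w < \<infinity>" and g: "g \<in> Lp"
      note [measurable] = Lp_carrier[OF g] fD(2)[OF Lp_carrier[OF g]]
      have "AE w in M. nnE (\<lambda>w. ennreal (norm (L0_rep (f g) w))) w \<le> nnE (\<lambda>w. ennreal (N w * nm g w)) w"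
      proof (rule nn_cond_exp_mono)
        show "AE w in M. ennreal (norm (L0_rep (f g) w)) \<le> ennreal (N w * nm g w)"
          using Nb[OF Lp_carrier[OF g]] by eventually_elim (rule ennreal_leI)
      qed measurable
      with cond_exp_norm_le[OF ci[OF fin g]] NE[OF fin g]
      show "AE w in M. norm (condE (L0_rep (f g)) w) \<le> enn2real (\<kappa> w) * Lp_norm g w"
      proof eventually_elim
        case (elim w)
        then have "ennreal (norm (condE (L0_rep (f g)) w)) \<le> ennreal (enn2real (\<kappa> w) * Lp_norm g w)"
          by (meson order_trans)
        then show ?case by (simp add: ennreal_le_iff)
      qed
    next
      fix \<eta> assume \<eta>: "\<eta> \<in> borel_measurable F" "\<And>w. 0 \<le> \<eta> w" and ci': "\<And>g. g \<in> Lp \<Longrightarrow> cond_integrable (L0_rep (f g))"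
        and b: "\<And>g. g \<in> Lp \<Longrightarrow> AE w in M. norm (condE (L0_rep (f g)) w) \<le> \<eta> w * Lp_norm g w"
      show "AE w in M. \<kappa> w \<le> ennreal (\<eta> w)"
      proof (rule dual_norm_exists[of "\<lambda>x. L0_rep (f x)", OF fD(2) fD(3) fD(4) ci' b \<eta>])
        fix N' assume N': "N' \<in> borel_measurable M" "\<And>w. (0::real) \<le> N' w"
        "\<And>x. x \<in> carrier S \<Longrightarrow> AE w in M. norm (L0_rep (f x) w) \<le> N' w * nm x w"
        "p = 1 \<Longrightarrow> AE w in M. N' w \<le> \<eta> w"
        "\<And>s. \<lbrakk>1 < p; 1 < s; 1 / p + 1 / s = 1\<rbrakk> \<Longrightarrow> AE w in M. nnE (\<lambda>w. ennreal (N' w powr s)) w \<le> ennreal (\<eta> w powr s)"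
        show "AE w in M. \<kappa> w \<le> ennreal (\<eta> w)"
          \<comment> \<open>\<open>N'\<close> bounds \<open>f\<close>, so it dominates the least
            bound \<open>N\<close>, and \<open>min\<close> accepts estimates for any such
            majorant.\<close>
          by (rule min[OF \<eta>(1) N'(1) \<eta>(2) Nmin[OF N'(1-3)] N'(4,5)])
      qed
    qed
  qed
qed

end
end

section \<open>The canonical mapping\<close>

context cond_Lp_module
begin

context
  fixes q :: ennreal
  assumes q: "1 < q" "1 / ennreal p + 1 / q = 1"
begin

abbreviation "LqS \<equiv> cond_Lp M F q (random_conjugate M S)"

abbreviation "T \<equiv> canonical_map M F (ennreal p) S"

lemma finite_class_iff:
  assumes "\<kappa> \<in> borel_measurable F"
  shows "(AE w in M. L0_rep (L0_class FM \<kappa>) w < (\<infinity>::ennreal)) \<longleftrightarrow> (AE w in M. \<kappa> w < \<infinity>)"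
  using L0_rep_class_FM[OF assms] by (intro eventually_cong) (auto elim: eventually_mono)

lemma canonical_map_apply:
  "g \<in> Lp \<Longrightarrow> T f g = L0_class FM (condE (L0_rep (f g)))"
  by (simp add: canonical_map_def cond_Lp_carrier)

text \<open>\<open>enn2real (\<kappa> w)\<close> bounds \<open>T f\<close> by Hoelder's inequality.
  Any other bound satisfies the premises of the converse estimate, so this one is the least.\<close>

lemma canonical_map_conjugate:
  assumes f: "f \<in> carrier LqS"
  shows "T f \<in> carrier (random_conjugate FM LpS)"
    and "rnorm (random_conjugate FM LpS) (T f) = rnorm LqS f"
proof -
  have fS: "f \<in> carrier (random_conjugate M S)" using f by (simp add: cond_Lp_def)
  note fD = conjugateD[OF fS]
  have Tm: "condE (L0_rep (f g)) \<in> borel_measurable F" for g by (rule cond_exp_F_measurable)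
  have TL: "T f g \<in> L0 FM" if "g \<in> Lp" for g
    using that by (simp add: canonical_map_apply L0_class_in_L0 borel_measurable_FM Tm)
  have rT: "AE w in M. L0_rep (T f g) w = condE (L0_rep (f g)) w" if "g \<in> Lp" for g
    unfolding canonical_map_apply[OF that] by (rule L0_rep_class_FM[OF Tm])
  have "T f \<in> carrier (random_conjugate FM LpS) \<and> rnorm (random_conjugate FM LpS) (T f) = rnorm LqS f"
  proof (rule conjugate_element[OF q fS])
    fix \<kappa> assume \<kappa> [measurable]: "\<kappa> \<in> borel_measurable F"
      and c: "cond_norm M F q (random_conjugate M S) f = L0_class FM \<kappa>"
      and ci: "\<And>g. \<lbrakk>AE w in M. \<kappa> w < \<infinity>; g \<in> Lp\<rbrakk> \<Longrightarrow> cond_integrable (L0_rep (f g))"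
      and bound: "\<And>g. \<lbrakk>AE w in M. \<kappa> w < \<infinity>; g \<in> Lp\<rbrakk> \<Longrightarrow>
        AE w in M. norm (condE (L0_rep (f g)) w) \<le> enn2real (\<kappa> w) * Lp_norm g w"
      and min: "\<And>\<eta>. \<lbrakk>\<eta> \<in> borel_measurable F; \<And>w. 0 \<le> \<eta> w; \<And>g. g \<in> Lp \<Longrightarrow> cond_integrable (L0_rep (f g));
        \<And>g. g \<in> Lp \<Longrightarrow> AE w in M. norm (condE (L0_rep (f g)) w) \<le> \<eta> w * Lp_norm g w\<rbrakk> \<Longrightarrow>
        AE w in M. \<kappa> w \<le> ennreal (\<eta> w)"
    have fin: "AE w in M. \<kappa> w < \<infinity>"
      using f unfolding finite_class_iff[OF \<kappa>, symmetric] c[symmetric] by (simp add: cond_Lp_def)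
    let ?Z = "L0_class FM (\<lambda>w. enn2real (\<kappa> w))"
    have km: "(\<lambda>w. enn2real (\<kappa> w)) \<in> borel_measurable F" by measurable
    have rn: "rnorm LqS f = ?Z"
      unfolding cond_Lp_def by (simp add: c L0_map_class borel_measurable_FM)
    have ZB: "?Z \<in> rn_bounds FM LpS (T f)"
      unfolding Lp_bounds_class[of "\<lambda>w. enn2real (\<kappa> w)" "T f", OF km TL, simplified]
    proof
      fix g assume g: "g \<in> Lp"
      show "AE w in M. norm (L0_rep (T f g) w) \<le> enn2real (\<kappa> w) * Lp_norm g w"
        using rT[OF g] bound[OF fin g] by eventually_elim simp
    qed
    have add: "T f (g \<oplus>\<^bsub>LpS\<^esub> h) = T f g \<oplus>\<^bsub>L0_ring FM\<^esub> T f h" if g: "g \<in> Lp" and h: "h \<in> Lp" for g h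
    proof -
      note gc = Lp_carrier[OF g] and hc = Lp_carrier[OF h]
      note [measurable] = fD(2)[OF gc] fD(2)[OF hc] fD(2)[OF a_closed[OF gc hc]]
      have "AE w in M. condE (L0_rep (f (g \<oplus> h))) w = condE (\<lambda>w. L0_rep (f g) w + L0_rep (f h) w) w"
        by (rule cond_exp_cong[OF fD(3)[OF gc hc]]) measurable
      with cond_exp_add[OF ci[OF fin g] ci[OF fin h]]
      have "AE w in M. condE (L0_rep (f (g \<oplus> h))) w = condE (L0_rep (f g)) w + condE (L0_rep (f h)) w"
        by eventually_elim simp
      then have "L0_class FM (condE (L0_rep (f (g \<oplus> h)))) = L0_class FM (\<lambda>w. condE (L0_rep (f g)) w + condE (L0_rep (f h)) w)"
        by (rule L0_class_FM_cong) measurable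
      then show ?thesis
        by (simp add: cond_Lp_add canonical_map_apply Lp_add g h L0_ring_add_class borel_measurable_FM Tm)
    qed
    have smult: "T f (A \<odot>\<^bsub>LpS\<^esub> g) = A \<otimes>\<^bsub>L0_ring FM\<^esub> T f g" if A: "A \<in> L0 FM" and g: "g \<in> Lp" for A g
    proof -
      obtain a where a: "a \<in> borel_measurable F" "A = L0_class FM a"
        using L0_cases[OF A] by (auto simp: borel_measurable_FM)
      note gc = Lp_carrier[OF g] and am = F_measurable[OF a(1)]
      note [measurable] = a(1) fD(2)[OF gc] fD(2)[OF scl_closed[OF am gc]]
      have "AE w in M. condE (L0_rep (f (scl a g))) w = condE (\<lambda>w. a w * L0_rep (f g) w) w"
        by (rule cond_exp_cong[OF fD(4)[OF am gc]]) measurable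
      with cond_exp_mult[OF ci[OF fin g] a(1)]
      have "AE w in M. condE (L0_rep (f (scl a g))) w = a w * condE (L0_rep (f g)) w"
        by eventually_elim simp
      then have "L0_class FM (condE (L0_rep (f (scl a g)))) = L0_class FM (\<lambda>w. a w * condE (L0_rep (f g)) w)"
        by (rule L0_class_FM_cong) measurable
      then show ?thesis
        by (simp add: a(2) cond_Lp_smult[OF a(1)] canonical_map_apply Lp_F_scl(1)[OF a(1) g] g L0_ring_mult_class borel_measurable_FM Tm a(1))
    qed
    have "T f \<in> carrier LpS \<rightarrow>\<^sub>E L0 FM"
    proof (rule PiE_I)
      show "T f g \<in> L0 FM" if "g \<in> carrier LpS" for g using that TL by (simp add: cond_Lp_carrier)
      show "T f g = undefined" if "g \<notin> carrier LpS" for g using that by (simp add: canonical_map_def)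
    qed
    then have 1: "T f \<in> carrier (random_conjugate FM LpS)"
      using add smult ZB by (auto simp: random_conjugate_def cond_Lp_carrier)
    have "\<Sqinter>\<^bsub>L0_order FM\<^esub> (rn_bounds FM LpS (T f)) = ?Z"
    proof (rule L0_inf_eq[OF _ ZB])
      show "rn_bounds FM LpS (T f) \<subseteq> L0 FM" by (auto simp: rn_bounds_def L0_nonneg_def)
      fix \<xi> assume \<xi>: "\<xi> \<in> rn_bounds FM LpS (T f)"
      then have \<xi>L: "\<xi> \<in> L0 FM" by (auto simp: rn_bounds_def L0_nonneg_def)
      note [measurable] = L0_FM_rep_measurable[OF \<xi>L]
      interpret Lp_functional M F S p "\<lambda>g. L0_rep (T f g)" "\<lambda>w. max 0 (L0_rep \<xi> w)"
        by (rule Lp_conjugate_functional[OF 1 \<xi>])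
      have "AE w in M. \<kappa> w \<le> ennreal (max 0 (L0_rep \<xi> w))"
      proof (rule min)
        fix g assume g: "g \<in> Lp"
        show "cond_integrable (L0_rep (f g))" by (rule ci[OF fin g])
        show "AE w in M. norm (condE (L0_rep (f g)) w) \<le> max 0 (L0_rep \<xi> w) * Lp_norm g w"
          using \<phi>_bound[OF g] rT[OF g] by eventually_elim simp
      qed simp_all
      moreover have "AE w in M. 0 \<le> L0_rep \<xi> w"
        using \<xi> by (auto simp: rn_bounds_def L0_nonneg_def intro: AE_restr_to_subalg[OF subalg])
      ultimately have "AE w in M. enn2real (\<kappa> w) \<le> L0_rep \<xi> w"
      proof eventually_elim
        case (elim w)
        then show ?case using enn2real_mono[OF elim(1)] by simp
      qed
      then have "L0_le FM ?Z (L0_class FM (L0_rep \<xi>))" by (simp add: L0_le_class_FM)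
      then show "L0_le FM ?Z \<xi>" by (simp add: L0_class_rep \<xi>L)
    qed
    then have 2: "rnorm (random_conjugate FM LpS) (T f) = ?Z" by (simp add: random_conjugate_def)
    show ?thesis using 1 2 rn by simp
  qed
  then show "T f \<in> carrier (random_conjugate FM LpS)"
    "rnorm (random_conjugate FM LpS) (T f) = rnorm LqS f" by auto
qed

lemma canonical_map_surjective:
  assumes \<Phi>: "\<Phi> \<in> carrier (random_conjugate FM LpS)"
  shows "\<exists>f\<in>carrier LqS. T f = \<Phi>"
proof -
  obtain \<xi> where \<xi>: "\<xi> \<in> rn_bounds FM LpS \<Phi>" using \<Phi> by (auto simp: random_conjugate_def)
  interpret Lp_functional M F S p "\<lambda>g. L0_rep (\<Phi> g)" "\<lambda>w. max 0 (L0_rep \<xi> w)"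
    by (rule Lp_conjugate_functional[OF \<Phi> \<xi>])
  let ?\<eta> = "\<lambda>w. max 0 (L0_rep \<xi> w)"
  have \<Phi>L: "\<Phi> g \<in> L0 FM" if "g \<in> Lp" for g
    using \<Phi> that by (auto simp: random_conjugate_def cond_Lp_carrier)
  have bound: "AE w in M. norm (condE (ext_dens g) w) \<le> ?\<eta> w * Lp_norm g w" if "g \<in> Lp" for g
    using ext_dens_cond_exp(2)[OF that] \<phi>_bound[OF that] by eventually_elim simp
  define f where "f = (\<lambda>x\<in>carrier S. L0_class M (ext_dens x))"
  have fx: "f x = L0_class M (ext_dens x)" if "x \<in> carrier S" for x
    using that by (simp add: f_def)
  have rf: "AE w in M. L0_rep (f x) w = ext_dens x w" if "x \<in> carrier S" for x
    unfolding fx[OF that] by (rule L0_rep_class[OF ext_dens_measurable[OF that]])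
  have fL: "f x \<in> L0 M" if "x \<in> carrier S" for x
    by (simp add: fx that L0_class_in_L0 ext_dens_measurable)
  have fS: "f \<in> carrier (random_conjugate M S)"
  \<comment> \<open>The estimate is applied to \<open>ext_dens\<close> itself, since a bound must be
    found before \<open>f\<close> counts as an element of the conjugate module.\<close>
  proof (rule dual_norm_exists[of ext_dens, OF ext_dens_measurable ext_dens_add ext_dens_scl ext_dens_cond_exp(1) bound \<eta>_measurable \<eta>_nonneg])
    fix N assume N: "N \<in> borel_measurable M" "\<And>w. (0::real) \<le> N w"
      and Nb: "\<And>x. x \<in> carrier S \<Longrightarrow> AE w in M. norm (ext_dens x w) \<le> N w * nm x w"
    have "AE w in M. norm (L0_rep (f x) w) \<le> N w * nm x w" if x: "x \<in> carrier S" for x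
      using rf[OF x] Nb[OF x] by eventually_elim simp
    then have "L0_class M N \<in> rn_bounds M S f"
      using rn_bounds_class[of N M S f nm, OF N(1) fL nm_measurable rnorm_eq] N(2) by simp
    moreover have "f (x \<oplus> y) = f x \<oplus>\<^bsub>L0_ring M\<^esub> f y" if x: "x \<in> carrier S" and y: "y \<in> carrier S" for x y
    proof -
      note [measurable] = ext_dens_measurable[OF x] ext_dens_measurable[OF y] ext_dens_measurable[OF a_closed[OF x y]]
      have "L0_class M (ext_dens (x \<oplus> y)) = L0_class M (\<lambda>w. ext_dens x w + ext_dens y w)"
        by (rule L0_class_cong[OF ext_dens_add[OF x y]]) measurable
      then show ?thesis using x y by (simp add: fx L0_ring_add_class)
    qed
    moreover have "f (A \<odot> x) = A \<otimes>\<^bsub>L0_ring M\<^esub> f x" if A: "A \<in> L0 M" and x: "x \<in> carrier S" for A x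
    proof -
      obtain a where a: "a \<in> borel_measurable M" "A = L0_class M a" using L0_cases[OF A] by blast
      note [measurable] = a(1) ext_dens_measurable[OF x] ext_dens_measurable[OF scl_closed[OF a(1) x]]
      have "L0_class M (ext_dens (scl a x)) = L0_class M (\<lambda>w. a w * ext_dens x w)"
        by (rule L0_class_cong[OF ext_dens_scl[OF x a(1)]]) measurable
      then show ?thesis
        using fx[OF scl_closed[OF a(1) x]] by (simp add: a(2) fx x L0_ring_mult_class scl_def)
    qed
    moreover have "f \<in> carrier S \<rightarrow>\<^sub>E L0 M" using fL by (auto simp: f_def)
    ultimately show ?thesis by (auto simp: random_conjugate_def)
  qed
  note fm = conjugateD(2)[OF fS]
  have ci: "cond_integrable (L0_rep (f g))" if g: "g \<in> Lp" for g
    using rf[OF Lp_carrier[OF g]] fm[OF Lp_carrier[OF g]]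
    by (intro cond_integrable_dominated[OF ext_dens_cond_exp(1)[OF g]]) (auto elim: eventually_mono)
  have ce: "AE w in M. condE (L0_rep (f g)) w = L0_rep (\<Phi> g) w" if g: "g \<in> Lp" for g
  proof -
    have "AE w in M. condE (L0_rep (f g)) w = condE (ext_dens g) w"
      by (rule cond_exp_cong[OF rf[OF Lp_carrier[OF g]] fm[OF Lp_carrier[OF g]] ext_dens_measurable[OF Lp_carrier[OF g]]])
    with ext_dens_cond_exp(2)[OF g] show ?thesis by eventually_elim simp
  qed
  have "f \<in> carrier LqS"
  proof (rule conjugate_element[OF q fS])
    fix \<kappa> assume \<kappa>: "\<kappa> \<in> borel_measurable F"
      and c: "cond_norm M F q (random_conjugate M S) f = L0_class FM \<kappa>"
      and min: "\<And>\<eta>. \<lbrakk>\<eta> \<in> borel_measurable F; \<And>w. 0 \<le> \<eta> w; \<And>g. g \<in> Lp \<Longrightarrow> cond_integrable (L0_rep (f g));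
        \<And>g. g \<in> Lp \<Longrightarrow> AE w in M. norm (condE (L0_rep (f g)) w) \<le> \<eta> w * Lp_norm g w\<rbrakk> \<Longrightarrow>
        AE w in M. \<kappa> w \<le> ennreal (\<eta> w)"
    \<comment> \<open>The converse estimate bounds \<open>\<kappa>\<close> by the real-valued
      \<open>?\<eta>\<close>, so \<open>f\<close> lies in the \<open>q\<close>-module.\<close>
    have "AE w in M. \<kappa> w \<le> ennreal (?\<eta> w)"
    proof (rule min[OF \<eta>_measurable \<eta>_nonneg ci])
      fix g assume g: "g \<in> Lp"
      show "AE w in M. norm (condE (L0_rep (f g)) w) \<le> ?\<eta> w * Lp_norm g w"
        using ce[OF g] \<phi>_bound[OF g] by eventually_elim simp
    qed
    then have "AE w in M. \<kappa> w < \<infinity>" by eventually_elim (erule le_less_trans, simp)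
    then show ?thesis
      using fS unfolding finite_class_iff[OF \<kappa>, symmetric] c[symmetric] by (simp add: cond_Lp_def)
  qed
  moreover have "T f = \<Phi>"
  proof
    fix g
    show "T f g = \<Phi> g"
    proof (cases "g \<in> Lp")
      case True
      have "L0_class FM (condE (L0_rep (f g))) = L0_class FM (L0_rep (\<Phi> g))"
        by (rule L0_class_FM_cong[OF ce[OF True] cond_exp_F_measurable L0_FM_rep_measurable[OF \<Phi>L[OF True]]])
      then show ?thesis by (simp add: canonical_map_apply True L0_class_rep \<Phi>L)
    next
      \<comment> \<open>Off \<open>Lp\<close> both sides are \<open>undefined\<close> by
        extensionality.\<close>
      case False
      then show ?thesis using \<Phi>
        by (auto simp: canonical_map_def random_conjugate_def cond_Lp_carrier PiE_def extensional_def)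
    qed
  qed
  ultimately show ?thesis by blast
qed

end
end

theorem theorem4p8:
  fixes M F :: "'w measure"
    and S :: "('w, 'k::{real_normed_field, euclidean_space}, 's) rn_module"
    and p q :: ennreal
  assumes "prob_space M"
    and "subalgebra M F"
    and "random_normed_module M S"
    and "1 \<le> p" and "p < \<infinity>" and "1 < q" and "q \<le> \<infinity>"
    and "1 / p + 1 / q = 1"
  shows "canonical_map M F p S \<in>
        carrier (cond_Lp M F q (random_conjugate M S)) \<rightarrow>
        carrier (random_conjugate (restr_to_subalg M F) (cond_Lp M F p S)) \<and>
      canonical_map M F p S ` carrier (cond_Lp M F q (random_conjugate M S)) =
        carrier (random_conjugate (restr_to_subalg M F) (cond_Lp M F p S)) \<and>
      (\<forall>f\<in>carrier (cond_Lp M F q (random_conjugate M S)).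
        rnorm (random_conjugate (restr_to_subalg M F) (cond_Lp M F p S)) (canonical_map M F p S f) =
        rnorm (cond_Lp M F q (random_conjugate M S)) f)"
proof -
  note r = ennreal_conjugate_exponents[OF assms(4-6,8)]
  define r where "r = enn2real p"
  have p_eq: "p = ennreal r" using r(1) by (simp add: r_def)
  interpret cond_Lp_module M F S r
    using assms(1-3) r(2)
    by (simp add: cond_Lp_module_def cond_Lp_module_axioms_def rn_module_subalgebra_def
        prob_subalgebra_def prob_subalgebra_axioms_def r_def)
  note q = assms(6) assms(8)[unfolded p_eq]
  show ?thesis
    unfolding p_eq using canonical_map_conjugate[OF q] canonical_map_surjective[OF q] by blast
qed

end
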